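(* Let $(M,g)$ be a simply connected Lorentzian surface, oriented in space and in time, with given spin structure, and let $H:M\to\mathbb{R}$ be a smooth function. The existence of a spinor field $\psi\in\Gamma(\Sigma M)$ solution of $$D\psi=H\psi\qquad\text{with}\qquad|\psi|^2=1$$ is equivalent to the existence of an isometric immersion of $M$ into the Minkowski space $\mathbb{R}^{1,2}$ with mean curvature $H$, i.e. with mean curvature vector $HN$ for a unit normal vector field $N$.
   Context: $\mathbb{R}^{1,2}$ is $\mathbb{R}^3$ with metric $dx_1^2-dx_2^2+dx_3^2$ (the subspace $x_0=0$ of $\mathbb{R}^4$ with metric $-dx_0^2+dx_1^2-dx_2^2+dx_3^2$), so that $\langle N,N\rangle=1$. $(e_2,e_3)$ denotes a positively oriented orthonormal frame of $TM$: $\langle e_2,e_2\rangle=-1$ with $e_2$ future-directed, $\langle e_3,e_3\rangle=1$. $\Sigma M$ is the (rank 2 complex) spinor bundle of $M$ with its spinorial connection $\nabla$ and Clifford action satisfying $X\cdot X=-\langle X,X\rangle$; $e_2\cdot e_3$ acts as $+id$ on $\Sigma^+M$ and as $-id$ on $\Sigma^-M$, and in a spinorial frame over $(e_2,e_3)$ spinors have coordinates $\begin{pmatrix}a+ib\\c+id\end{pmatrix}\in\mathbb{C}^2$ (first component in $\Sigma^+M$, second in $\Sigma^-M$), the element $\pm e^u\in Spin(1,1)$ acting as $\pm e^u$ on the first and $\pm e^{-u}$ on the second component, $e_2\cdot$ acting by $\begin{pmatrix}0&1\\1&0\end{pmatrix}$ and $e_3\cdot$ by $\begin{pmatrix}0&-1\\1&0\end{pmatrix}$.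 The Dirac operator is $D\psi=-e_2\cdot\nabla_{e_2}\psi+e_3\cdot\nabla_{e_3}\psi$. The scalar product on $\Sigma M$ is given in coordinates by $$\left\langle\begin{pmatrix}a+ib\\c+id\end{pmatrix},\begin{pmatrix}a'+ib'\\c'+id'\end{pmatrix}\right\rangle=\frac{ad'+a'd-bc'-b'c}{2};$$ it satisfies $\langle X\cdot\psi,\psi'\rangle=-\langle\psi,X\cdot\psi'\rangle$, and $|\psi|^2:=\langle\psi,\psi\rangle$. The mean curvature vector is half the trace of the second fundamental form. *)

theory Defs
  imports "HOL-Analysis.Analysis"
begin

section \<open>Smooth maps and surfaces\<close>

fun Ck_on :: "nat \<Rightarrow> 'a::real_normed_vector set \<Rightarrow> ('a \<Rightarrow> 'b::real_normed_vector) \<Rightarrow> bool" where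
  "Ck_on 0 S f \<longleftrightarrow> continuous_on S f"
| "Ck_on (Suc k) S f \<longleftrightarrow>
     (\<forall>x\<in>S. f differentiable (at x)) \<and> (\<forall>v. Ck_on k S (\<lambda>x. frechet_derivative f (at x) v))"

text \<open>Only used on open sets \<open>S\<close>.\<close>

definition smooth_on :: "'a::real_normed_vector set \<Rightarrow> ('a \<Rightarrow> 'b::real_normed_vector) \<Rightarrow> bool" where
  "smooth_on S f \<longleftrightarrow> (\<forall>k. Ck_on k S f)"

text \<open>A chart is its domain together with its coordinate map; the coordinate map is only
  meaningful on the domain. The surface is the whole type \<open>'m\<close>.\<close>

type_synonym 'm chart = "'m set \<times> ('m \<Rightarrow> real^2)"

definition cdom :: "'m chart \<Rightarrow> 'm set" where
  "cdom c = fst c"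

definition crd :: "'m chart \<Rightarrow> 'm \<Rightarrow> real^2" where
  "crd c = snd c"

definition icrd :: "'m chart \<Rightarrow> real^2 \<Rightarrow> 'm" where
  "icrd c = inv_into (cdom c) (crd c)"

definition smooth_atlas :: "'m::topological_space chart set \<Rightarrow> bool" where
  "smooth_atlas A \<longleftrightarrow>
     (\<forall>c\<in>A. open (cdom c) \<and> open (crd c ` cdom c) \<and>
        homeomorphism (cdom c) (crd c ` cdom c) (crd c) (icrd c)) \<and>
     (\<Union>c\<in>A. cdom c) = UNIV \<and>
     (\<forall>c\<in>A. \<forall>d\<in>A. smooth_on (crd c ` (cdom c \<inter> cdom d)) (crd d \<circ> icrd c))"

definition smooth_map_on ::
    "'m chart set \<Rightarrow> 'm set \<Rightarrow> ('m \<Rightarrow> 'b::real_normed_vector) \<Rightarrow> bool" where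
  "smooth_map_on A U f \<longleftrightarrow> (\<forall>c\<in>A. smooth_on (crd c ` (U \<inter> cdom c)) (f \<circ> icrd c))"

definition chart_at :: "'m chart set \<Rightarrow> 'm \<Rightarrow> 'm chart" where
  "chart_at A p = (SOME c. c \<in> A \<and> p \<in> cdom c)"


section \<open>Tangent vectors\<close>

text \<open>A tangent vector at \<open>p\<close> is the family of its components in all charts around \<open>p\<close>,
  transforming by the Jacobians of the coordinate changes, and zero on the irrelevant charts.\<close>

type_synonym 'm tangent = "'m chart \<Rightarrow> real^2"

definition tangent_space :: "'m chart set \<Rightarrow> 'm \<Rightarrow> 'm tangent set" where
  "tangent_space A p =
     {v. (\<forall>c\<in>A. \<forall>d\<in>A. p \<in> cdom c \<and> p \<in> cdom d \<longrightarrow>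
            v d = frechet_derivative (crd d \<circ> icrd c) (at (crd c p)) (v c)) \<and>
         (\<forall>c. \<not> (c \<in> A \<and> p \<in> cdom c) \<longrightarrow> v c = 0)}"

definition lincomb :: "real \<Rightarrow> 'm tangent \<Rightarrow> real \<Rightarrow> 'm tangent \<Rightarrow> 'm tangent" where
  "lincomb a v b w = (\<lambda>c. a *\<^sub>R v c + b *\<^sub>R w c)"

definition coord_vec :: "'m chart set \<Rightarrow> 'm chart \<Rightarrow> 'm \<Rightarrow> 2 \<Rightarrow> 'm tangent" where
  "coord_vec A c p i =
     (\<lambda>d. if d \<in> A \<and> p \<in> cdom d
          then frechet_derivative (crd d \<circ> icrd c) (at (crd c p)) (axis i 1) else 0)"

definition smooth_vector_field_on ::
    "'m chart set \<Rightarrow> 'm set \<Rightarrow> ('m \<Rightarrow> 'm tangent) \<Rightarrow> bool" where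
  "smooth_vector_field_on A U X \<longleftrightarrow>
     (\<forall>p\<in>U. X p \<in> tangent_space A p) \<and>
     (\<forall>c\<in>A. smooth_on (crd c ` (U \<inter> cdom c)) (\<lambda>x. X (icrd c x) c))"

definition differential ::
    "'m chart set \<Rightarrow> ('m \<Rightarrow> 'b::real_normed_vector) \<Rightarrow> 'm \<Rightarrow> 'm tangent \<Rightarrow> 'b" where
  "differential A f p v =
     (let c = chart_at A p in frechet_derivative (f \<circ> icrd c) (at (crd c p)) (v c))"


section \<open>Lorentzian metrics, orientations, Levi-Civita connection\<close>

type_synonym 'm metric = "'m \<Rightarrow> 'm tangent \<Rightarrow> 'm tangent \<Rightarrow> real"

definition gram :: "'m chart set \<Rightarrow> 'm metric \<Rightarrow> 'm chart \<Rightarrow> 'm \<Rightarrow> real^2^2" where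
  "gram A g c p = (\<chi> i j. g p (coord_vec A c p i) (coord_vec A c p j))"

definition lorentzian_metric :: "'m chart set \<Rightarrow> 'm metric \<Rightarrow> bool" where
  "lorentzian_metric A g \<longleftrightarrow>
     (\<forall>p. \<forall>v\<in>tangent_space A p. \<forall>w\<in>tangent_space A p.
        g p v w = g p w v \<and>
        (\<forall>u\<in>tangent_space A p. \<forall>a b. g p (lincomb a v b w) u = a * g p v u + b * g p w u)) \<and>
     (\<forall>p. \<exists>v\<in>tangent_space A p. \<exists>w\<in>tangent_space A p.
        g p v v = -1 \<and> g p v w = 0 \<and> g p w w = 1) \<and>
     (\<forall>c\<in>A. \<forall>i j. smooth_on (crd c ` cdom c) (\<lambda>x. gram A g c (icrd c x) $ i $ j))"

text \<open>A smooth choice of one of the two components of \<open>{v. \<sigma> g(v,v) > 0}\<close> in each tangent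
  plane: for \<open>\<sigma> = -1\<close> a time orientation (\<open>C p\<close> is the set of future-directed vectors),
  for \<open>\<sigma> = 1\<close> a space orientation. The component containing \<open>X\<close> is cut out by
  \<open>\<sigma> g(v,X) > 0\<close>.\<close>

definition cone_orientation ::
    "'m::topological_space chart set \<Rightarrow> 'm metric \<Rightarrow> real \<Rightarrow> ('m \<Rightarrow> 'm tangent set) \<Rightarrow> bool" where
  "cone_orientation A g \<sigma> C \<longleftrightarrow>
     (\<forall>p. \<exists>U X. open U \<and> p \<in> U \<and> smooth_vector_field_on A U X \<and>
        (\<forall>q\<in>U. \<sigma> * g q (X q) (X q) > 0 \<and>
           C q = {v \<in> tangent_space A q. \<sigma> * g q v v > 0 \<and> \<sigma> * g q v (X q) > 0}))"

abbreviation "time_orientation A g \<equiv> cone_orientation A g (-1)"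
abbreviation "space_orientation A g \<equiv> cone_orientation A g 1"

text \<open>\<open>(p, e\<^sub>2, e\<^sub>3)\<close>: a base point with a positively oriented orthonormal frame there.\<close>

type_synonym 'm frame = "'m \<times> 'm tangent \<times> 'm tangent"

definition oriented_frames ::
    "'m chart set \<Rightarrow> 'm metric \<Rightarrow> ('m \<Rightarrow> 'm tangent set) \<Rightarrow> ('m \<Rightarrow> 'm tangent set) \<Rightarrow> 'm frame set" where
  "oriented_frames A g T S =
     {(p, e2, e3). e2 \<in> T p \<and> e3 \<in> S p \<and> g p e2 e2 = -1 \<and> g p e2 e3 = 0 \<and> g p e3 e3 = 1}"

definition christoffel :: "'m chart set \<Rightarrow> 'm metric \<Rightarrow> 'm chart \<Rightarrow> 'm \<Rightarrow> 2 \<Rightarrow> 2 \<Rightarrow> 2 \<Rightarrow> real" where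
  "christoffel A g c p k i j =
     (let dg = (\<lambda>i j l. frechet_derivative (\<lambda>x. gram A g c (icrd c x) $ j $ l)
                          (at (crd c p)) (axis i 1))
      in (\<Sum>l\<in>UNIV. matrix_inv (gram A g c p) $ k $ l * (dg i j l + dg j i l - dg l i j)) / 2)"

text \<open>The covariant derivative of the local vector field \<open>Y\<close> at \<open>p\<close> in the direction \<open>v\<close>.\<close>

definition levi_civita ::
    "'m chart set \<Rightarrow> 'm metric \<Rightarrow> 'm \<Rightarrow> 'm tangent \<Rightarrow> ('m \<Rightarrow> 'm tangent) \<Rightarrow> 'm tangent" where
  "levi_civita A g p v Y =
     (\<lambda>c. if c \<in> A \<and> p \<in> cdom c
          then frechet_derivative (\<lambda>x. Y (icrd c x) c) (at (crd c p)) (v c) +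
               (\<chi> k. \<Sum>i\<in>UNIV. \<Sum>j\<in>UNIV. christoffel A g c p k i j * v c $ i * Y p c $ j)
          else 0)"


section \<open>The group \<open>Spin(1,1)\<close> and its action on spinors\<close>

text \<open>\<open>Spin(1,1) = {\<plusminus> e^u}\<close> is identified with the multiplicative group of nonzero reals.\<close>

definition Spin11 :: "real set" where
  "Spin11 = - {0}"

definition rho :: "real \<Rightarrow> complex^2^2" where
  "rho h = vector [vector [of_real h, 0], vector [0, of_real (inverse h)]]"

definition E2 :: "complex^2^2" where
  "E2 = vector [vector [0, 1], vector [1, 0]]"

definition E3 :: "complex^2^2" where
  "E3 = vector [vector [0, -1], vector [1, 0]]"

text \<open>The double covering \<open>Spin(1,1) \<rightarrow> SO\<^sub>0(1,1)\<close>, \<open>h \<mapsto> (v \<mapsto> h v h\<^sup>-\<^sup>1)\<close>, as a right action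
  on frames. It is a boost since \<open>h = \<plusminus>(cosh u + sinh u e\<^sub>2e\<^sub>3)\<close>; see \<open>rho_conjugates\<close> below.\<close>

definition frame_act :: "'m frame \<Rightarrow> real \<Rightarrow> 'm frame" where
  "frame_act = (\<lambda>(p, e2, e3) h.
     let ch = (h\<^sup>2 + inverse h ^ 2) / 2; sh = (h\<^sup>2 - inverse h ^ 2) / 2
     in (p, lincomb ch e2 (- sh) e3, lincomb (- sh) e2 ch e3))"

lemma matrix_2_eqI:
  fixes M N :: "'a^2^2"
  assumes "M$1$1 = N$1$1" "M$1$2 = N$1$2" "M$2$1 = N$2$1" "M$2$2 = N$2$2"
  shows "M = N"
  using assms by (simp add: vec_eq_iff forall_2)

lemma clifford_relations:
  "E2 ** E2 = mat 1" "E3 ** E3 = - mat 1" "E2 ** E3 + E3 ** E2 = 0"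
  by (rule matrix_2_eqI; simp add: E2_def E3_def matrix_matrix_mult_def sum_2 mat_def)+

lemma rho_conjugates:
  assumes "h \<in> Spin11"
  defines "ch \<equiv> (h\<^sup>2 + inverse h ^ 2) / 2" and "sh \<equiv> (h\<^sup>2 - inverse h ^ 2) / 2"
  shows "rho h ** E2 ** rho (inverse h) = ch *\<^sub>R E2 + (- sh) *\<^sub>R E3"
    and "rho h ** E3 ** rho (inverse h) = (- sh) *\<^sub>R E2 + ch *\<^sub>R E3"
  by (rule matrix_2_eqI;
      simp add: rho_def E2_def E3_def matrix_matrix_mult_def sum_2 ch_def sh_def
        complex_eq_iff power2_eq_square field_simps)+

definition spinor_inner :: "complex^2 \<Rightarrow> complex^2 \<Rightarrow> real" where
  "spinor_inner z z' =
     (let a = Re (z$1); b = Im (z$1); c = Re (z$2); d = Im (z$2);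
          a' = Re (z'$1); b' = Im (z'$1); c' = Re (z'$2); d' = Im (z'$2)
      in (a * d' + a' * d - b * c' - b' * c) / 2)"


section \<open>Spin structures, spinor fields and the Dirac operator\<close>

text \<open>The spin structure is the equivariant map \<open>\<Phi>\<close> from the total space (the type \<open>'q\<close>) of a
  principal \<open>Spin(1,1)\<close>-bundle to the bundle of positively oriented orthonormal frames. Since
  \<open>\<Phi>\<close> is a covering, the smooth structure of the total space is pulled back from the frame
  bundle: a continuous local section is smooth iff the frame field below it is.\<close>

definition proj :: "('q \<Rightarrow> 'm frame) \<Rightarrow> 'q \<Rightarrow> 'm" where
  "proj \<Phi> q = fst (\<Phi> q)"

definition frame2 :: "('q \<Rightarrow> 'm frame) \<Rightarrow> 'q \<Rightarrow> 'm tangent" where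
  "frame2 \<Phi> q = fst (snd (\<Phi> q))"

definition frame3 :: "('q \<Rightarrow> 'm frame) \<Rightarrow> 'q \<Rightarrow> 'm tangent" where
  "frame3 \<Phi> q = snd (snd (\<Phi> q))"

definition spinorial_frame ::
    "'m::topological_space chart set \<Rightarrow> ('q::topological_space \<Rightarrow> 'm frame) \<Rightarrow> 'm set \<Rightarrow> ('m \<Rightarrow> 'q) \<Rightarrow> bool" where
  "spinorial_frame A \<Phi> U s \<longleftrightarrow>
     open U \<and> continuous_on U s \<and> (\<forall>p\<in>U. proj \<Phi> (s p) = p) \<and>
     smooth_vector_field_on A U (\<lambda>p. frame2 \<Phi> (s p)) \<and>
     smooth_vector_field_on A U (\<lambda>p. frame3 \<Phi> (s p))"

definition spin_structure ::
    "'m::topological_space chart set \<Rightarrow> 'm metric \<Rightarrow> ('m \<Rightarrow> 'm tangent set) \<Rightarrow> ('m \<Rightarrow> 'm tangent set) \<Rightarrow>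
     ('q::topological_space \<Rightarrow> 'm frame) \<Rightarrow> ('q \<Rightarrow> real \<Rightarrow> 'q) \<Rightarrow> bool" where
  "spin_structure A g T S \<Phi> act \<longleftrightarrow>
     range \<Phi> \<subseteq> oriented_frames A g T S \<and>
     continuous_on UNIV (proj \<Phi>) \<and>
     (\<forall>q. act q 1 = q) \<and>
     (\<forall>q. \<forall>h\<in>Spin11. \<forall>k\<in>Spin11. act q (h * k) = act (act q h) k) \<and>
     (\<forall>q. \<forall>h\<in>Spin11. \<Phi> (act q h) = frame_act (\<Phi> q) h) \<and>
     (\<forall>p. \<exists>U s. p \<in> U \<and> spinorial_frame A \<Phi> U s \<and>
        (\<exists>t. homeomorphism (U \<times> Spin11) {q. proj \<Phi> q \<in> U} (\<lambda>(x, h). act (s x) h) t))"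

text \<open>Sections of the associated bundle \<open>\<Sigma>M\<close> are represented by the equivariant maps from the
  spin bundle to \<open>\<complex>\<^sup>2\<close>; \<open>\<psi> (s p)\<close> are the coordinates of \<open>\<psi>\<close> at \<open>p\<close> in the spinorial frame \<open>s\<close>.\<close>

definition spinor_field ::
    "'m::topological_space chart set \<Rightarrow> ('q::topological_space \<Rightarrow> 'm frame) \<Rightarrow> ('q \<Rightarrow> real \<Rightarrow> 'q) \<Rightarrow>
     ('q \<Rightarrow> complex^2) \<Rightarrow> bool" where
  "spinor_field A \<Phi> act \<psi> \<longleftrightarrow>
     (\<forall>q. \<forall>h\<in>Spin11. \<psi> (act q h) = rho (inverse h) *v \<psi> q) \<and>
     (\<forall>U s. spinorial_frame A \<Phi> U s \<longrightarrow> smooth_map_on A U (\<lambda>p. \<psi> (s p)))"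

text \<open>The connection term is \<open>1/2 \<epsilon>\<^sub>2 \<epsilon>\<^sub>3 \<langle>\<nabla>\<^sub>v e\<^sub>2, e\<^sub>3\<rangle> e\<^sub>2 \<cdot> e\<^sub>3 \<cdot> \<psi>\<close> with \<open>\<epsilon>\<^sub>2 = -1\<close>, \<open>\<epsilon>\<^sub>3 = 1\<close>.
  By the following identities Clifford multiplication is parallel, as
  \<open>\<nabla>\<^sub>v e\<^sub>2 = \<omega>(v) e\<^sub>3\<close> and \<open>\<nabla>\<^sub>v e\<^sub>3 = \<omega>(v) e\<^sub>2\<close> for \<open>\<omega>(v) = \<langle>\<nabla>\<^sub>v e\<^sub>2, e\<^sub>3\<rangle>\<close>.\<close>

lemma spin_connection_clifford:
  defines "W \<equiv> (- 1/2) *\<^sub>R (E2 ** E3)"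
  shows "W ** E2 - E2 ** W = E3" "W ** E3 - E3 ** W = E2"
  unfolding W_def
  by (rule matrix_2_eqI; simp add: E2_def E3_def matrix_matrix_mult_def sum_2 complex_eq_iff)+

text \<open>The value of \<open>\<nabla>\<^sub>v \<psi>\<close> is expressed in the frame \<open>q\<close>, by means of any spinorial frame whose
  value at the base point of \<open>q\<close> is \<open>q\<close>; it does not depend on the one chosen.\<close>

definition spin_nabla ::
    "'m::topological_space chart set \<Rightarrow> 'm metric \<Rightarrow> ('q::topological_space \<Rightarrow> 'm frame) \<Rightarrow>
     ('q \<Rightarrow> complex^2) \<Rightarrow> 'm tangent \<Rightarrow> 'q \<Rightarrow> complex^2" where
  "spin_nabla A g \<Phi> \<psi> v q =
     (let p = proj \<Phi> q;
          s = (SOME s. \<exists>U. p \<in> U \<and> spinorial_frame A \<Phi> U s \<and> s p = q)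
      in differential A (\<lambda>x. \<psi> (s x)) p v -
         (g p (levi_civita A g p v (\<lambda>x. frame2 \<Phi> (s x))) (frame3 \<Phi> q) / 2) *\<^sub>R
           (E2 *v (E3 *v \<psi> q)))"

definition dirac ::
    "'m::topological_space chart set \<Rightarrow> 'm metric \<Rightarrow> ('q::topological_space \<Rightarrow> 'm frame) \<Rightarrow>
     ('q \<Rightarrow> complex^2) \<Rightarrow> 'q \<Rightarrow> complex^2" where
  "dirac A g \<Phi> \<psi> q =
     - (E2 *v spin_nabla A g \<Phi> \<psi> (frame2 \<Phi> q) q) + E3 *v spin_nabla A g \<Phi> \<psi> (frame3 \<Phi> q) q"


section \<open>Immersions into Minkowski space\<close>

definition mink :: "real^3 \<Rightarrow> real^3 \<Rightarrow> real" where
  "mink x y = x$1 * y$1 - x$2 * y$2 + x$3 * y$3"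

definition isometric_immersion :: "'m chart set \<Rightarrow> 'm metric \<Rightarrow> ('m \<Rightarrow> real^3) \<Rightarrow> bool" where
  "isometric_immersion A g F \<longleftrightarrow>
     smooth_map_on A UNIV F \<and>
     (\<forall>p. inj_on (differential A F p) (tangent_space A p) \<and>
        (\<forall>v\<in>tangent_space A p. \<forall>w\<in>tangent_space A p.
           mink (differential A F p v) (differential A F p w) = g p v w))"

definition unit_normal_field :: "'m chart set \<Rightarrow> ('m \<Rightarrow> real^3) \<Rightarrow> ('m \<Rightarrow> real^3) \<Rightarrow> bool" where
  "unit_normal_field A F N \<longleftrightarrow>
     smooth_map_on A UNIV N \<and>
     (\<forall>p. mink (N p) (N p) = 1 \<and> (\<forall>v\<in>tangent_space A p. mink (N p) (differential A F p v) = 0))"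

definition normal_part :: "'m chart set \<Rightarrow> ('m \<Rightarrow> real^3) \<Rightarrow> 'm \<Rightarrow> real^3 \<Rightarrow> real^3" where
  "normal_part A F p y =
     (THE n. (\<forall>v\<in>tangent_space A p. mink n (differential A F p v) = 0) \<and>
             y - n \<in> differential A F p ` tangent_space A p)"

text \<open>The normal part of the derivative along \<open>v\<close> of \<open>dF(W)\<close>, where \<open>W\<close> extends \<open>w\<close> with constant
  components in a chart.\<close>

definition second_fundamental_form ::
    "'m chart set \<Rightarrow> ('m \<Rightarrow> real^3) \<Rightarrow> 'm \<Rightarrow> 'm tangent \<Rightarrow> 'm tangent \<Rightarrow> real^3" where
  "second_fundamental_form A F p v w =
     (let c = chart_at A p
      in normal_part A F p
           (frechet_derivative (\<lambda>x. frechet_derivative (F \<circ> icrd c) (at x) (w c))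
              (at (crd c p)) (v c)))"

definition mean_curvature_vector ::
    "'m chart set \<Rightarrow> 'm metric \<Rightarrow> ('m \<Rightarrow> real^3) \<Rightarrow> 'm \<Rightarrow> real^3" where
  "mean_curvature_vector A g F p =
     (let c = chart_at A p
      in (1/2) *\<^sub>R (\<Sum>i\<in>UNIV. \<Sum>j\<in>UNIV. matrix_inv (gram A g c p) $ i $ j *\<^sub>R
           second_fundamental_form A F p (coord_vec A c p i) (coord_vec A c p j)))"

end

theory Submission
  imports Defs
begin

text \<open>
  The Minkowski space is identified with the symmetric tensors on \<open>\<real>\<^sup>2 = \<complex>\<close>: the product
  \<open>z \<cdot> w = (Re (z w), Re (z w\<^sup>*), Im (z w))\<close> (\<open>w\<^sup>*\<close> the conjugate of \<open>w\<close>) is symmetric and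
  bilinear, \<open>z \<cdot> z\<close> is a null vector, and if the determinant of \<open>(z, w)\<close> is \<open>1\<close>, then
  \<open>z \<cdot> z\<close>, \<open>w \<cdot> w\<close> are null vectors of product \<open>-2\<close> with the unit normal \<open>z \<cdot> w\<close>.
  For a spinor with components \<open>(z, w)\<close> this determinant is \<open>|\<psi>|\<^sup>2\<close>, and a change of frame
  multiplies \<open>z\<close> and \<open>w\<close> by the inverse numbers \<open>h\<^sup>-\<^sup>1\<close> and \<open>h\<close>, while it multiplies
  \<open>e\<^sub>+ = e\<^sub>2 + e\<^sub>3\<close> and \<open>e\<^sub>- = e\<^sub>2 - e\<^sub>3\<close> by \<open>h\<^sup>-\<^sup>2\<close> and \<open>h\<^sup>2\<close>. A spinor field of norm one is
  therefore, up to its sign, the same thing as the data \<open>\<xi>(e\<^sub>+) = z \<cdot> z\<close>, \<open>\<xi>(e\<^sub>-) = w \<cdot> w\<close>,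
  \<open>N = z \<cdot> w\<close> of an isometric one-form \<open>\<xi>\<close> with values in the Minkowski space and its unit
  normal, of a fixed time direction and orientation.

  The Dirac equation reads \<open>\<nabla>\<^sub>- z = - H w\<close>, \<open>\<nabla>\<^sub>+ w = - H z\<close>, with covariant derivatives along
  \<open>e\<^sub>-\<close> and \<open>e\<^sub>+\<close>. As the Levi-Civita connection is torsion free,
  \<open>d\<xi>(e\<^sub>+, e\<^sub>-) = 2 w \<cdot> \<nabla>\<^sub>+ w - 2 z \<cdot> \<nabla>\<^sub>- z\<close>, and the normal part of the half trace of the
  derivative of \<open>\<xi>\<close> is \<open>- \<langle>z \<cdot> \<nabla>\<^sub>- z + w \<cdot> \<nabla>\<^sub>+ w, N\<rangle> / 2\<close>. Expanding \<open>\<nabla>\<^sub>- z\<close> and \<open>\<nabla>\<^sub>+ w\<close> in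
  the basis \<open>(z, w)\<close> shows that the Dirac equation holds at a point exactly if there \<open>\<xi>\<close> is
  closed and this half trace is \<open>H\<close> (\<open>dirac_iff_form\<close>, \<open>dirac_iff_dform\<close>, \<open>dirac_iff_xi\<close>).

  Given the spinor field, \<open>\<xi>\<close> is thus closed and has a primitive \<open>F\<close> on the simply connected
  surface; it is the immersion, with normal \<open>N\<close> and mean curvature \<open>H\<close>
  (\<open>immersion_of_spinor\<close>). Given \<open>F\<close> and \<open>N\<close>, after a reflection of the Minkowski space that
  makes \<open>dF(e\<^sub>2)\<close> future-directed and \<open>N\<close> the normal of the right orientation, \<open>z\<close> is a square
  root of a complex-valued function and \<open>w\<close> is then determined; the two choices of the sign
  form a double covering of the surface, which has a section as the surface is simply connected
  (\<open>spinor_of_immersion\<close>). Primitives and signs are both continued by \<open>monodromy\<close>.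
\<close>


section \<open>Calculus of smooth maps\<close>

lemma frechet_derivative_eqI: "(f has_derivative D) (at x) \<Longrightarrow> frechet_derivative f (at x) = D"
  using frechet_derivative_at by metis

lemma differentiable_has_frechet_derivative:
  "f differentiable (at x) \<Longrightarrow> (f has_derivative frechet_derivative f (at x)) (at x)"
  using frechet_derivative_works by blast

lemma has_derivative_cong_open:
  assumes "(f has_derivative D) (at x)" "open S" "x \<in> S" "\<And>y. y \<in> S \<Longrightarrow> f y = g y"
  shows "(g has_derivative D) (at x)"
  using has_derivative_transform_within_open assms by metis

lemma Ck_on_mono: "T \<subseteq> S \<Longrightarrow> Ck_on k S f \<Longrightarrow> Ck_on k T f"
proof (induction k arbitrary: f)
  case 0 then show ?case using continuous_on_subset by auto
next
  case (Suc k) then show ?case by auto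
qed

lemma Ck_on_cong:
  assumes "open S" "\<And>x. x \<in> S \<Longrightarrow> f x = g x" "Ck_on k S f"
  shows "Ck_on k S g"
  using assms(2,3)
proof (induction k arbitrary: f g)
  case 0 then show ?case by (auto cong: continuous_on_cong)
next
  case (Suc k)
  have d: "(g has_derivative frechet_derivative f (at x)) (at x)" if "x \<in> S" for x
    using Suc.prems that
    by (intro has_derivative_cong_open[OF differentiable_has_frechet_derivative \<open>open S\<close>]) auto
  have "Ck_on k S (\<lambda>x. frechet_derivative g (at x) v)" for v
    by (rule Suc.IH[where f="\<lambda>x. frechet_derivative f (at x) v"])
      (use Suc.prems frechet_derivative_eqI[OF d] in auto)
  with d show ?case by (auto simp: differentiable_def)
qed

lemma Ck_on_SucI:
  assumes "open S" "\<And>x. x \<in> S \<Longrightarrow> (f has_derivative D x) (at x)" "\<And>v. Ck_on k S (\<lambda>x. D x v)"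
  shows "Ck_on (Suc k) S f"
proof -
  have "Ck_on k S (\<lambda>x. frechet_derivative f (at x) v)" for v
    by (rule Ck_on_cong[OF assms(1) _ assms(3)[of v]]) (simp add: frechet_derivative_eqI[OF assms(2)])
  then show ?thesis using assms(2) by (auto simp: differentiable_def)
qed

lemma Ck_on_SucD: "open S \<Longrightarrow> Ck_on (Suc k) S f \<Longrightarrow> Ck_on k S f"
proof (induction k arbitrary: f)
  case 0
  then show ?case
    by (auto intro!: continuous_at_imp_continuous_on differentiable_imp_continuous_within)
next
  case (Suc k) then show ?case by simp
qed

lemma Ck_on_local:
  assumes "\<And>x. x \<in> S \<Longrightarrow> \<exists>T. open T \<and> x \<in> T \<and> Ck_on k T f"
  shows "Ck_on k S f"
  using assms
proof (induction k arbitrary: f)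
  case 0
  have "continuous (at x within S) f" if x: "x \<in> S" for x
  proof -
    obtain T where "open T" "x \<in> T" "continuous_on T f" using 0 x by auto
    then have "isCont f x" by (simp add: continuous_on_eq_continuous_at)
    then show ?thesis using continuous_at_imp_continuous_at_within by blast
  qed
  then show ?case by (simp add: continuous_on_eq_continuous_within)
next
  case (Suc k)
  have 1: "f differentiable (at x)" if "x \<in> S" for x
    using Suc.prems[OF that] by auto
  have "Ck_on k S (\<lambda>x. frechet_derivative f (at x) v)" for v
    by (rule Suc.IH) (use Suc.prems in fastforce)
  then show ?case using 1 by simp
qed

lemma Ck_on_const: "Ck_on k S (\<lambda>x. c)"
proof (induction k arbitrary: c)
  case (Suc k)
  then show ?case by (simp add: frechet_derivative_eqI[OF has_derivative_const])
qed auto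

lemma Ck_on_bounded_linear:
  assumes "open S" "bounded_linear L" "Ck_on k S f"
  shows "Ck_on k S (\<lambda>x. L (f x))"
  using assms(3)
proof (induction k arbitrary: f)
  case 0
  then show ?case using bounded_linear.continuous_on[OF assms(2)] by auto
next
  case (Suc k)
  show ?case
    by (rule Ck_on_SucI[OF assms(1) bounded_linear.has_derivative[OF assms(2)
          differentiable_has_frechet_derivative] Suc.IH]) (use Suc.prems in auto)
qed

lemma Ck_on_add:
  assumes "open S" "Ck_on k S f" "Ck_on k S g"
  shows "Ck_on k S (\<lambda>x. f x + g x)"
  using assms(2,3)
proof (induction k arbitrary: f g)
  case 0 then show ?case by (auto intro: continuous_intros)
next
  case (Suc k)
  show ?case
    by (rule Ck_on_SucI[OF assms(1) has_derivative_add[OF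
          differentiable_has_frechet_derivative differentiable_has_frechet_derivative] Suc.IH])
       (use Suc.prems in auto)
qed

lemma Ck_on_bilinear:
  assumes "open S" "bounded_bilinear B" "Ck_on k S f" "Ck_on k S g"
  shows "Ck_on k S (\<lambda>x. B (f x) (g x))"
  using assms(3,4)
proof (induction k arbitrary: f g)
  case 0 then show ?case by (auto intro: bounded_bilinear.continuous_on[OF assms(2)])
next
  case (Suc k)
  have 1: "Ck_on k S (\<lambda>x. B (f x) (frechet_derivative g (at x) v) + B (frechet_derivative f (at x) v) (g x))" for v
    by (intro Ck_on_add assms(1) Suc.IH) (use Suc.prems Ck_on_SucD[OF assms(1)] in auto)
  show ?case
    by (rule Ck_on_SucI[OF assms(1) bounded_bilinear.FDERIV[OF assms(2)
          differentiable_has_frechet_derivative differentiable_has_frechet_derivative] 1])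
       (use Suc.prems in auto)
qed

lemma Ck_on_inverse:
  fixes f :: "'a::real_normed_vector \<Rightarrow> 'b::real_normed_field"
  assumes "open S" "\<And>x. x \<in> S \<Longrightarrow> f x \<noteq> 0" "Ck_on k S f"
  shows "Ck_on k S (\<lambda>x. inverse (f x))"
  using assms(3)
proof (induction k)
  case 0 then show ?case using assms(2) by (auto intro!: continuous_intros)
next
  case (Suc k)
  have d: "((\<lambda>x. inverse (f x)) has_derivative
      (\<lambda>h. - (inverse (f x) * frechet_derivative f (at x) h * inverse (f x)))) (at x)" if "x \<in> S" for x
    by (rule Deriv.has_derivative_inverse) (use assms(2) Suc.prems that differentiable_has_frechet_derivative in auto)
  have k: "Ck_on k S (\<lambda>x. inverse (f x))" using Suc Ck_on_SucD[OF assms(1)] by blast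
  have "Ck_on k S (\<lambda>x. inverse (f x) * frechet_derivative f (at x) v * inverse (f x))" for v
    by (intro Ck_on_bilinear[OF assms(1) bounded_bilinear_mult] k) (use Suc.prems in auto)
  then have fin: "Ck_on k S (\<lambda>x. - (inverse (f x) * frechet_derivative f (at x) v * inverse (f x)))" for v
    using Ck_on_bounded_linear[OF assms(1) bounded_linear_minus[OF bounded_linear_ident]] by blast
  show ?case by (rule Ck_on_SucI[OF assms(1) d _], assumption, rule fin)
qed

text \<open>A continuous square root \<open>z\<close> of \<open>w\<close> satisfies
  \<open>z x - z a = (w x - w a) / (z x + z a)\<close>, whose denominator has the nonzero limit \<open>2 z a\<close>.\<close>

lemma has_derivative_square_root:
  fixes z w :: "'a::real_normed_vector \<Rightarrow> complex"
  assumes "open S" "a \<in> S" "continuous_on S z" "\<And>x. x \<in> S \<Longrightarrow> (z x)\<^sup>2 = w x" "z a \<noteq> 0"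
    and w: "(w has_derivative D) (at a)"
  shows "(z has_derivative (\<lambda>h. D h * inverse (2 * z a))) (at a)"
proof -
  interpret D: bounded_linear D using has_derivative_bounded_linear[OF w] .
  define k where "k x = inverse (z x + z a)" for x
  have cz: "z \<midarrow>a\<rightarrow> z a" using assms(1-3) by (simp add: continuous_on_eq_continuous_at isCont_def)
  have ck: "k \<midarrow>a\<rightarrow> inverse (2 * z a)"
  proof -
    have "(\<lambda>x. inverse (z x + z a)) \<midarrow>a\<rightarrow> inverse (z a + z a)"
      using assms(5) by (intro tendsto_inverse tendsto_add cz tendsto_const) simp
    moreover have "z a + z a = 2 * z a" by simp
    ultimately show ?thesis unfolding k_def by metis
  qed
  have ev: "\<forall>\<^sub>F x in at a. x \<in> S \<and> z x + z a \<noteq> 0"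
  proof (rule eventually_conj)
    show "\<forall>\<^sub>F x in at a. x \<in> S" using assms(1,2) eventually_at_topological by blast
    have "((\<lambda>x. z x + z a) \<longlongrightarrow> z a + z a) (at a)" by (intro tendsto_add cz tendsto_const)
    then show "\<forall>\<^sub>F x in at a. z x + z a \<noteq> 0"
      by (rule tendsto_imp_eventually_ne) (use assms(5) in simp)
  qed
  obtain K where K: "\<And>h. norm (D h) \<le> norm h * K" "K > 0" using D.pos_bounded by blast
  have w': "((\<lambda>x. norm (w x - w a - D (x - a)) / norm (x - a)) \<longlongrightarrow> 0) (at a)"
    using w by (simp add: has_derivative_iff_norm)
  have bd: "((\<lambda>x. norm (w x - w a - D (x - a)) / norm (x - a) * norm (k x)
      + K * norm (k x - inverse (2 * z a))) \<longlongrightarrow> 0 * norm (inverse (2 * z a)) + K * norm (inverse (2 * z a) - inverse (2 * z a))) (at a)"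
    by (intro tendsto_intros w' ck)
  have "((\<lambda>x. norm (z x - z a - D (x - a) * inverse (2 * z a)) / norm (x - a)) \<longlongrightarrow> 0) (at a)"
  proof (rule tendsto_sandwich[OF _ _ tendsto_const])
    show "((\<lambda>x. norm (w x - w a - D (x - a)) / norm (x - a) * norm (k x)
      + K * norm (k x - inverse (2 * z a))) \<longlongrightarrow> 0) (at a)" using bd by simp
    show "\<forall>\<^sub>F x in at a. norm (z x - z a - D (x - a) * inverse (2 * z a)) / norm (x - a)
       \<le> norm (w x - w a - D (x - a)) / norm (x - a) * norm (k x) + K * norm (k x - inverse (2 * z a))"
      using ev eventually_neq_at_within[of a a UNIV]
    proof eventually_elim
      case (elim x)
      have "w x - w a = (z x - z a) * (z x + z a)"
        using assms(4)[of x] assms(4)[OF assms(2)] elim by (simp add: power2_eq_square algebra_simps)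
      then have "z x - z a = (w x - w a) * k x" using elim by (simp add: k_def)
      then have "z x - z a - D (x - a) * inverse (2 * z a)
          = (w x - w a - D (x - a)) * k x + D (x - a) * (k x - inverse (2 * z a))"
        by (simp add: algebra_simps)
      then have "norm (z x - z a - D (x - a) * inverse (2 * z a))
          \<le> norm (w x - w a - D (x - a)) * norm (k x) + norm (D (x - a)) * norm (k x - inverse (2 * z a))"
        by (metis norm_mult norm_triangle_ineq)
      also have "\<dots> \<le> norm (w x - w a - D (x - a)) * norm (k x) + (norm (x - a) * K) * norm (k x - inverse (2 * z a))"
        by (intro add_left_mono mult_right_mono K) auto
      finally show ?case using elim by (simp add: field_simps)
    qed
  qed (auto intro!: always_eventually)
  moreover have "bounded_linear (\<lambda>h. D h * inverse (2 * z a))"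
    by (rule bounded_linear_mult_const) (rule D.bounded_linear_axioms)
  ultimately show ?thesis by (simp add: has_derivative_iff_norm)
qed

lemma Ck_on_square_root:
  fixes z w :: "'a::real_normed_vector \<Rightarrow> complex"
  assumes "open S" "continuous_on S z" "\<And>x. x \<in> S \<Longrightarrow> (z x)\<^sup>2 = w x" "\<And>x. x \<in> S \<Longrightarrow> z x \<noteq> 0"
    and "Ck_on k S w"
  shows "Ck_on k S z"
  using assms(5)
proof (induction k)
  case 0 then show ?case using assms(2) by simp
next
  case (Suc k)
  have d: "(z has_derivative (\<lambda>h. frechet_derivative w (at x) h * inverse (2 * z x))) (at x)" if "x \<in> S" for x
    by (rule has_derivative_square_root[OF assms(1) that assms(2,3,4)])
      (use that Suc.prems differentiable_has_frechet_derivative in auto)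
  have k: "Ck_on k S z" using Suc Ck_on_SucD[OF assms(1)] by blast
  have "Ck_on k S (\<lambda>x. 2 * z x)"
    by (rule Ck_on_bilinear[OF assms(1) bounded_bilinear_mult Ck_on_const k])
  then have fin: "Ck_on k S (\<lambda>x. frechet_derivative w (at x) v * inverse (2 * z x))" for v
    by (intro Ck_on_bilinear[OF assms(1) bounded_bilinear_mult _ Ck_on_inverse[OF assms(1)]])
      (use Suc.prems assms(4) in auto)
  show ?case by (rule Ck_on_SucI[OF assms(1) d _], assumption, rule fin)
qed

lemma smooth_on_mono: "T \<subseteq> S \<Longrightarrow> smooth_on S f \<Longrightarrow> smooth_on T f"
  by (auto simp: smooth_on_def intro: Ck_on_mono)

lemma smooth_on_cong: "open S \<Longrightarrow> (\<And>x. x \<in> S \<Longrightarrow> f x = g x) \<Longrightarrow> smooth_on S f \<Longrightarrow> smooth_on S g"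
  unfolding smooth_on_def using Ck_on_cong by blast

lemma smooth_on_local:
  "(\<And>x. x \<in> S \<Longrightarrow> \<exists>T. open T \<and> x \<in> T \<and> smooth_on T f) \<Longrightarrow> smooth_on S f"
  unfolding smooth_on_def using Ck_on_local by meson

lemma smooth_on_const: "smooth_on S (\<lambda>x. c)"
  by (simp add: smooth_on_def Ck_on_const)

lemma smooth_on_bounded_linear:
  "open S \<Longrightarrow> bounded_linear L \<Longrightarrow> smooth_on S f \<Longrightarrow> smooth_on S (\<lambda>x. L (f x))"
  by (simp add: smooth_on_def Ck_on_bounded_linear)

lemma smooth_on_add:
  "open S \<Longrightarrow> smooth_on S f \<Longrightarrow> smooth_on S g \<Longrightarrow> smooth_on S (\<lambda>x. f x + g x)"
  by (simp add: smooth_on_def Ck_on_add)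

lemma smooth_on_bilinear:
  "open S \<Longrightarrow> bounded_bilinear B \<Longrightarrow> smooth_on S f \<Longrightarrow> smooth_on S g \<Longrightarrow> smooth_on S (\<lambda>x. B (f x) (g x))"
  by (simp add: smooth_on_def Ck_on_bilinear)

lemmas smooth_on_mult = smooth_on_bilinear[OF _ bounded_bilinear_mult]
lemmas smooth_on_scaleR = smooth_on_bilinear[OF _ bounded_bilinear_scaleR]

lemma smooth_on_diff:
  "open S \<Longrightarrow> smooth_on S f \<Longrightarrow> smooth_on S g \<Longrightarrow> smooth_on S (\<lambda>x. f x - g x)"
  using smooth_on_add[of S f "\<lambda>x. - g x"] smooth_on_bounded_linear[OF _ bounded_linear_minus[OF bounded_linear_ident]]
  by fastforce

lemma smooth_on_sum:
  "open S \<Longrightarrow> (\<And>i. i \<in> I \<Longrightarrow> smooth_on S (f i)) \<Longrightarrow> smooth_on S (\<lambda>x. \<Sum>i\<in>I. f i x)"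
  by (induction I rule: infinite_finite_induct) (auto intro: smooth_on_const smooth_on_add)

lemma smooth_on_inverse:
  fixes f :: "'a::real_normed_vector \<Rightarrow> 'b::real_normed_field"
  shows "open S \<Longrightarrow> (\<And>x. x \<in> S \<Longrightarrow> f x \<noteq> 0) \<Longrightarrow> smooth_on S f \<Longrightarrow> smooth_on S (\<lambda>x. inverse (f x))"
  by (simp add: smooth_on_def Ck_on_inverse)

lemma smooth_on_square_root:
  fixes z w :: "'a::real_normed_vector \<Rightarrow> complex"
  shows "open S \<Longrightarrow> continuous_on S z \<Longrightarrow> (\<And>x. x \<in> S \<Longrightarrow> (z x)\<^sup>2 = w x) \<Longrightarrow>
    (\<And>x. x \<in> S \<Longrightarrow> z x \<noteq> 0) \<Longrightarrow> smooth_on S w \<Longrightarrow> smooth_on S z"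
  unfolding smooth_on_def using Ck_on_square_root by blast

lemma smooth_on_vec_nth: "open S \<Longrightarrow> smooth_on S f \<Longrightarrow> smooth_on S (\<lambda>x. f x $ i)"
  by (rule smooth_on_bounded_linear[OF _ bounded_linear_vec_nth])

lemma smooth_on_differentiable: "smooth_on S f \<Longrightarrow> x \<in> S \<Longrightarrow> f differentiable (at x)"
  unfolding smooth_on_def by (meson Ck_on.simps(2))

lemma smooth_on_has_derivative:
  "smooth_on S f \<Longrightarrow> x \<in> S \<Longrightarrow> (f has_derivative frechet_derivative f (at x)) (at x)"
  using smooth_on_differentiable differentiable_has_frechet_derivative by blast

lemma smooth_on_frechet_derivative:
  "smooth_on S f \<Longrightarrow> smooth_on S (\<lambda>x. frechet_derivative f (at x) v)"
  unfolding smooth_on_def by (metis Ck_on.simps(2))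

lemma smooth_on_continuous_on: "smooth_on S f \<Longrightarrow> continuous_on S f"
  unfolding smooth_on_def by (metis Ck_on.simps(1))

lemma smooth_onI_derivative:
  assumes "open S" "\<And>x. x \<in> S \<Longrightarrow> (f has_derivative D x) (at x)" "\<And>v. smooth_on S (\<lambda>x. D x v)"
  shows "smooth_on S f"
  unfolding smooth_on_def
proof
  fix k show "Ck_on k S f"
    by (rule Ck_on_SucD[OF assms(1) Ck_on_SucI[OF assms(1,2)]]) (use assms(3) in \<open>auto simp: smooth_on_def\<close>)
qed


section \<open>Second derivatives and primitives\<close>

text \<open>The mean value theorem along \<open>v\<close> and then along \<open>w\<close>. As the second difference on the left is
  symmetric in \<open>v\<close> and \<open>w\<close>, the mixed second derivatives taken in the two orders have equal
  values at points arbitrarily near \<open>x\<close>, hence at \<open>x\<close> by continuity.\<close>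

lemma second_difference_mean_value:
  fixes f :: "'a::real_normed_vector \<Rightarrow> real"
  assumes f: "\<And>y. y \<in> S \<Longrightarrow> (f has_derivative D y) (at y)"
    and D: "\<And>y. y \<in> S \<Longrightarrow> ((\<lambda>y. D y v) has_derivative D2 y) (at y)"
    and t: "0 < t" "\<And>a b. 0 \<le> a \<Longrightarrow> a \<le> t \<Longrightarrow> 0 \<le> b \<Longrightarrow> b \<le> t \<Longrightarrow> x + a *\<^sub>R v + b *\<^sub>R w \<in> S"
  obtains a b where "0 < a" "a < t" "0 < b" "b < t"
    "f (x + t *\<^sub>R v + t *\<^sub>R w) - f (x + t *\<^sub>R v) - (f (x + t *\<^sub>R w) - f x) = t * (t * D2 (x + a *\<^sub>R v + b *\<^sub>R w) w)"
proof -
  have d1: "((\<lambda>a. f (x + a *\<^sub>R v + b *\<^sub>R w)) has_field_derivative D (x + a *\<^sub>R v + b *\<^sub>R w) v) (at a)"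
    if "0 \<le> a" "a \<le> t" "0 \<le> b" "b \<le> t" for a b
  proof -
    have F: "(f has_derivative D (x + a *\<^sub>R v + b *\<^sub>R w)) (at (x + a *\<^sub>R v + b *\<^sub>R w))"
      using f t(2) that by blast
    have "((\<lambda>a. x + a *\<^sub>R v + b *\<^sub>R w) has_derivative (\<lambda>h. h *\<^sub>R v)) (at a)"
      by (auto intro!: derivative_eq_intros)
    from has_derivative_compose[OF this F]
    show ?thesis
      unfolding has_field_derivative_def
      by (rule has_derivative_eq_rhs)
        (auto simp: linear_simps(5)[OF has_derivative_bounded_linear[OF F]] mult.commute)
  qed
  define h where "h a = f (x + a *\<^sub>R v + t *\<^sub>R w) - f (x + a *\<^sub>R v)" for a
  have "\<exists>a>0. a < t \<and> h t - h 0 = (t - 0) * (D (x + a *\<^sub>R v + t *\<^sub>R w) v - D (x + a *\<^sub>R v + 0 *\<^sub>R w) v)"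
  proof (rule MVT2[OF t(1)])
    fix a assume "0 \<le> a" "a \<le> t"
    then show "(h has_real_derivative D (x + a *\<^sub>R v + t *\<^sub>R w) v - D (x + a *\<^sub>R v + 0 *\<^sub>R w) v) (at a)"
      using DERIV_diff[OF d1[of a t] d1[of a 0]] t(1) by (simp add: h_def[abs_def])
  qed
  then obtain a where a: "0 < a" "a < t"
    "h t - h 0 = t * (D (x + a *\<^sub>R v + t *\<^sub>R w) v - D (x + a *\<^sub>R v + 0 *\<^sub>R w) v)"
    by auto
  have "\<exists>b>0. b < t \<and> D (x + a *\<^sub>R v + t *\<^sub>R w) v - D (x + a *\<^sub>R v + 0 *\<^sub>R w) v
      = (t - 0) * D2 (x + a *\<^sub>R v + b *\<^sub>R w) w"
  proof (rule MVT2[OF t(1)])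
    fix b assume b: "0 \<le> b" "b \<le> t"
    have F: "((\<lambda>y. D y v) has_derivative D2 (x + a *\<^sub>R v + b *\<^sub>R w)) (at (x + a *\<^sub>R v + b *\<^sub>R w))"
      by (intro D t(2)) (use a b in auto)
    have "((\<lambda>b. x + a *\<^sub>R v + b *\<^sub>R w) has_derivative (\<lambda>h. h *\<^sub>R w)) (at b)"
      by (auto intro!: derivative_eq_intros)
    from has_derivative_compose[OF this F]
    show "((\<lambda>b. D (x + a *\<^sub>R v + b *\<^sub>R w) v) has_real_derivative D2 (x + a *\<^sub>R v + b *\<^sub>R w) w) (at b)"
      unfolding has_field_derivative_def
      by (rule has_derivative_eq_rhs)
        (auto simp: linear_simps(5)[OF has_derivative_bounded_linear[OF F]] mult.commute)
  qed
  then obtain b where b: "0 < b" "b < t" "D (x + a *\<^sub>R v + t *\<^sub>R w) v - D (x + a *\<^sub>R v + 0 *\<^sub>R w) v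
      = t * D2 (x + a *\<^sub>R v + b *\<^sub>R w) w" by auto
  show ?thesis
    by (rule that[OF a(1,2) b(1,2)]) (use a(3) b(3) in \<open>simp add: h_def\<close>)
qed

lemma frechet_derivative_commute_real:
  fixes f :: "'a::real_normed_vector \<Rightarrow> real"
  assumes S: "open S" "x \<in> S" and f: "smooth_on S f"
  shows "frechet_derivative (\<lambda>y. frechet_derivative f (at y) v) (at x) w
       = frechet_derivative (\<lambda>y. frechet_derivative f (at y) w) (at x) v"
proof (rule ccontr)
  define D where "D y = frechet_derivative f (at y)" for y
  define D2 where "D2 v y = frechet_derivative (\<lambda>y. D y v) (at y)" for v y
  assume "\<not> ?thesis"
  then have ne: "D2 v x w \<noteq> D2 w x v" by (simp add: D_def D2_def)
  define e where "e = \<bar>D2 v x w - D2 w x v\<bar> / 2"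
  have "e > 0" using ne by (simp add: e_def)
  have f1: "(f has_derivative D y) (at y)" if "y \<in> S" for y
    unfolding D_def using smooth_on_has_derivative f that by blast
  have f2: "((\<lambda>y. D y u) has_derivative D2 u y) (at y)" if "y \<in> S" for y u
    unfolding D2_def D_def using smooth_on_has_derivative smooth_on_frechet_derivative f that by blast
  have "isCont (\<lambda>y. D2 u y u') x" for u u'
    unfolding D2_def D_def
    using smooth_on_continuous_on[OF smooth_on_frechet_derivative[OF smooth_on_frechet_derivative[OF f]]] S
    by (simp add: continuous_on_eq_continuous_at)
  then have "\<exists>d>0. \<forall>y. dist y x < d \<longrightarrow> dist (D2 u y u') (D2 u x u') < e" for u u'
    using \<open>e > 0\<close> unfolding continuous_at_eps_delta by blast
  then obtain d1 d2 where d: "d1 > 0" "\<And>y. dist y x < d1 \<Longrightarrow> dist (D2 v y w) (D2 v x w) < e"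
      "d2 > 0" "\<And>y. dist y x < d2 \<Longrightarrow> dist (D2 w y v) (D2 w x v) < e"
    by meson
  obtain d0 where d0: "d0 > 0" "\<And>y. dist y x < d0 \<Longrightarrow> y \<in> S"
    using S open_dist by blast
  define r where "r = min d0 (min d1 d2)"
  have "r > 0" using d d0 by (simp add: r_def)
  define t where "t = r / (2 * (norm v + norm w + 1))"
  have "norm v + norm w + 1 > 0" by (smt (verit) norm_ge_zero)
  then have t0: "t > 0" using \<open>r > 0\<close> by (simp add: t_def)
  have tr: "t * (norm v + norm w + 1) = r / 2"
    unfolding t_def using \<open>norm v + norm w + 1 > 0\<close> by (simp add: field_simps)
  have near: "dist (x + a *\<^sub>R v + b *\<^sub>R w) x < r" "dist (x + b *\<^sub>R w + a *\<^sub>R v) x < r"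
    if "0 \<le> a" "a \<le> t" "0 \<le> b" "b \<le> t" for a b
  proof -
    have "norm (a *\<^sub>R v + b *\<^sub>R w) \<le> \<bar>a\<bar> * norm v + \<bar>b\<bar> * norm w"
      by (metis norm_scaleR norm_triangle_ineq)
    also have "\<dots> \<le> t * norm v + t * norm w"
      using that by (intro add_mono mult_right_mono) auto
    also have "\<dots> \<le> r / 2" unfolding tr[symmetric] using t0 by (simp add: algebra_simps)
    finally have "norm (a *\<^sub>R v + b *\<^sub>R w) < r" using \<open>r > 0\<close> by simp
    then show "dist (x + a *\<^sub>R v + b *\<^sub>R w) x < r" "dist (x + b *\<^sub>R w + a *\<^sub>R v) x < r"
      by (simp_all add: dist_norm algebra_simps)
  qed
  obtain a b where ab: "0 < a" "a < t" "0 < b" "b < t"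
    "f (x + t *\<^sub>R v + t *\<^sub>R w) - f (x + t *\<^sub>R v) - (f (x + t *\<^sub>R w) - f x) = t * (t * D2 v (x + a *\<^sub>R v + b *\<^sub>R w) w)"
    by (rule second_difference_mean_value[of S f D v "D2 v" t x w, OF f1 f2 t0])
      (use near d0 r_def in auto)
  obtain a' b' where ab': "0 < a'" "a' < t" "0 < b'" "b' < t"
    "f (x + t *\<^sub>R w + t *\<^sub>R v) - f (x + t *\<^sub>R w) - (f (x + t *\<^sub>R v) - f x) = t * (t * D2 w (x + a' *\<^sub>R w + b' *\<^sub>R v) v)"
    by (rule second_difference_mean_value[of S f D w "D2 w" t x v, OF f1 f2 t0])
      (use near d0 r_def in auto)
  have "t * (t * D2 v (x + a *\<^sub>R v + b *\<^sub>R w) w) = t * (t * D2 w (x + a' *\<^sub>R w + b' *\<^sub>R v) v)"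
  proof -
    have "x + t *\<^sub>R v + t *\<^sub>R w = x + t *\<^sub>R w + t *\<^sub>R v" by simp
    from ab(5)[unfolded this] ab'(5) show ?thesis by linarith
  qed
  then have eq: "D2 v (x + a *\<^sub>R v + b *\<^sub>R w) w = D2 w (x + a' *\<^sub>R w + b' *\<^sub>R v) v"
    using t0 by simp
  have "dist (D2 v (x + a *\<^sub>R v + b *\<^sub>R w) w) (D2 v x w) < e"
    by (rule d) (use near(1)[of a b] ab in \<open>simp add: r_def\<close>)
  moreover have "dist (D2 w (x + a' *\<^sub>R w + b' *\<^sub>R v) v) (D2 w x v) < e"
    by (rule d) (use near(2)[of b' a'] ab' in \<open>simp add: r_def\<close>)
  ultimately have "\<bar>D2 v x w - D2 w x v\<bar> < e + e"
    unfolding eq by (simp add: dist_real_def)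
  then show False by (simp add: e_def)
qed

lemma frechet_derivative_inner:
  "f differentiable (at y) \<Longrightarrow>
    frechet_derivative (\<lambda>y. f y \<bullet> i) (at y) v = frechet_derivative f (at y) v \<bullet> i"
  by (rule fun_cong[OF frechet_derivative_eqI[OF bounded_linear.has_derivative[OF
    bounded_linear_inner_left differentiable_has_frechet_derivative]]])

lemma frechet_derivative_cong_open:
  assumes "open S" "x \<in> S" "\<And>y. y \<in> S \<Longrightarrow> f y = g y" "f differentiable (at x)"
  shows "frechet_derivative f (at x) = frechet_derivative g (at x)"
  using has_derivative_cong_open[OF differentiable_has_frechet_derivative[OF assms(4)] assms(1-3)]
    frechet_derivative_eqI[of g] by simp

lemma frechet_derivative_commute:
  fixes f :: "'a::real_normed_vector \<Rightarrow> 'b::euclidean_space"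
  assumes S: "open S" "x \<in> S" and f: "smooth_on S f"
  shows "frechet_derivative (\<lambda>y. frechet_derivative f (at y) v) (at x) w
       = frechet_derivative (\<lambda>y. frechet_derivative f (at y) w) (at x) v"
proof (rule euclidean_eqI)
  fix i :: 'b
  have g: "smooth_on S (\<lambda>y. f y \<bullet> i)"
    by (rule smooth_on_bounded_linear[OF S(1) bounded_linear_inner_left f])
  have 1: "frechet_derivative (\<lambda>y. f y \<bullet> i) (at y) u = frechet_derivative f (at y) u \<bullet> i"
    if "y \<in> S" for y u
    using frechet_derivative_inner smooth_on_differentiable[OF f that] by blast
  have 2: "frechet_derivative (\<lambda>y. frechet_derivative f (at y) u) (at x) u' \<bullet> i
      = frechet_derivative (\<lambda>y. frechet_derivative (\<lambda>y. f y \<bullet> i) (at y) u) (at x) u'" for u u'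
  proof -
    have "frechet_derivative (\<lambda>y. frechet_derivative (\<lambda>y. f y \<bullet> i) (at y) u) (at x)
        = frechet_derivative (\<lambda>y. frechet_derivative f (at y) u \<bullet> i) (at x)"
      by (rule frechet_derivative_cong_open[OF S])
        (use 1 smooth_on_differentiable[OF smooth_on_frechet_derivative[OF g] S(2)] in auto)
    then show ?thesis
      using frechet_derivative_inner[OF smooth_on_differentiable[OF smooth_on_frechet_derivative[OF f] S(2)]]
      by simp
  qed
  show "frechet_derivative (\<lambda>y. frechet_derivative f (at y) v) (at x) w \<bullet> i
       = frechet_derivative (\<lambda>y. frechet_derivative f (at y) w) (at x) v \<bullet> i"
    unfolding 2 by (rule frechet_derivative_commute_real[OF S g])
qed


text \<open>The primitive integrates \<open>p\<close> along the lower edge and then \<open>q\<close> upwards; the derivative in the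
  first variable is found by differentiation under the integral sign.\<close>

lemma primitive_on_box:
  fixes p q :: "real \<Rightarrow> real \<Rightarrow> 'b::euclidean_space"
  assumes le: "a1 \<le> a2" "b1 \<le> b2"
    and cp: "continuous_on ({a1..a2} \<times> {b1..b2}) (\<lambda>(s, t). p s t)"
    and cq: "continuous_on ({a1..a2} \<times> {b1..b2}) (\<lambda>(s, t). q s t)"
    and cr: "continuous_on ({a1..a2} \<times> {b1..b2}) (\<lambda>(s, t). r s t)"
    and dp: "\<And>s t. s \<in> {a1..a2} \<Longrightarrow> t \<in> {b1..b2} \<Longrightarrow> ((\<lambda>t. p s t) has_vector_derivative r s t) (at t)"
    and dq: "\<And>s t. s \<in> {a1..a2} \<Longrightarrow> t \<in> {b1..b2} \<Longrightarrow> ((\<lambda>s. q s t) has_vector_derivative r s t) (at s)"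
  obtains F where "\<And>s t. s \<in> {a1<..<a2} \<Longrightarrow> t \<in> {b1<..<b2} \<Longrightarrow>
     ((\<lambda>(s, t). F s t) has_derivative (\<lambda>(u, v). u *\<^sub>R p s t + v *\<^sub>R q s t)) (at (s, t))"
proof -
  have cont1: "continuous_on {a1..a2} (\<lambda>s. k s t)" if "t \<in> {b1..b2}"
      "continuous_on ({a1..a2} \<times> {b1..b2}) (\<lambda>(s, t). k s t)" for t and k :: "real \<Rightarrow> real \<Rightarrow> 'b"
  proof -
    have "continuous_on {a1..a2} (\<lambda>s. (\<lambda>(s, t). k s t) (s, t))"
      by (rule continuous_on_compose2[OF that(2)]) (use that(1) in \<open>auto intro!: continuous_intros\<close>)
    then show ?thesis by simp
  qed
  have cont2: "continuous_on {b1..b2} (\<lambda>t. k s t)" if "s \<in> {a1..a2}"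
      "continuous_on ({a1..a2} \<times> {b1..b2}) (\<lambda>(s, t). k s t)" for s and k :: "real \<Rightarrow> real \<Rightarrow> 'b"
  proof -
    have "continuous_on {b1..b2} (\<lambda>t. (\<lambda>(s, t). k s t) (s, t))"
      by (rule continuous_on_compose2[OF that(2)]) (use that(1) in \<open>auto intro!: continuous_intros\<close>)
    then show ?thesis by simp
  qed
  define F where "F s t = integral {a1..s} (\<lambda>\<sigma>. p \<sigma> b1) + integral {b1..t} (q s)" for s t
  have Ft: "((\<lambda>t. F s t) has_vector_derivative q s t) (at t within {b1..b2})"
    if "s \<in> {a1..a2}" "t \<in> {b1..b2}" for s t
    unfolding F_def
    using has_vector_derivative_add[OF has_vector_derivative_const
        integral_has_vector_derivative[OF cont2[OF that(1) cq] that(2)]] by simp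
  have Fs: "((\<lambda>s. F s t) has_vector_derivative p s t) (at s within {a1..a2})"
    if s: "s \<in> {a1..a2}" and t: "t \<in> {b1..b2}" for s t
  proof -
    have 1: "((\<lambda>s. integral {a1..s} (\<lambda>\<sigma>. p \<sigma> b1)) has_vector_derivative p s b1) (at s within {a1..a2})"
      by (rule integral_has_vector_derivative[OF cont1[OF _ cp] s]) (use le in auto)
    have "((\<lambda>s. integral (cbox b1 t) (q s)) has_vector_derivative integral (cbox b1 t) (r s)) (at s within {a1..a2})"
    proof (rule leibniz_rule_vector_derivative)
      show "((\<lambda>s. q s t') has_vector_derivative r s t') (at s within {a1..a2})"
        if "s \<in> {a1..a2}" "t' \<in> cbox b1 t" for s t'
        using dq[of s t'] that t has_vector_derivative_at_within by fastforce
      show "q s integrable_on cbox b1 t" if "s \<in> {a1..a2}" for s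
        by (rule integrable_continuous, rule continuous_on_subset[OF cont2[OF that cq]]) (use t in auto)
      show "continuous_on ({a1..a2} \<times> cbox b1 t) (\<lambda>(s, t). r s t)"
        by (rule continuous_on_subset[OF cr]) (use t in auto)
    qed (use s in auto)
    moreover have "integral {b1..t} (r s) = p s t - p s b1"
    proof (rule integral_unique, rule fundamental_theorem_of_calculus[where f="p s"])
      show "(p s has_vector_derivative r s t') (at t' within {b1..t})" if "t' \<in> {b1..t}" for t'
        by (rule has_vector_derivative_at_within, rule dp) (use s t that in auto)
    qed (use t in simp)
    ultimately have "((\<lambda>s. integral {b1..t} (q s)) has_vector_derivative p s t - p s b1) (at s within {a1..a2})"
      by simp
    from has_vector_derivative_add[OF 1 this] show ?thesis
      unfolding F_def by simp
  qed
  have "((\<lambda>(s, t). F s t) has_derivative (\<lambda>(u, v). u *\<^sub>R p s t + v *\<^sub>R q s t)) (at (s, t))"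
    if s: "s \<in> {a1<..<a2}" and t: "t \<in> {b1<..<b2}" for s t
  proof -
    have "((\<lambda>(s, t). F s t) has_derivative (\<lambda>(u, v). u *\<^sub>R p s t + blinfun_apply (blinfun_scaleR_left (q s t)) v))
        (at (s, t) within {a1..a2} \<times> {b1..b2})"
    proof (rule has_derivative_partialsI)
      show "((\<lambda>s. F s t) has_derivative (\<lambda>u. u *\<^sub>R p s t)) (at s within {a1..a2})"
        using Fs[of s t] s t by (simp add: has_vector_derivative_def)
      show "((\<lambda>t. F s t) has_derivative blinfun_apply (blinfun_scaleR_left (q s t))) (at t within {b1..b2})"
        if "s \<in> {a1..a2}" "t \<in> {b1..b2}" for s t
        using Ft[of s t] that by (simp add: has_vector_derivative_def)
      have "continuous_on ({a1..a2} \<times> {b1..b2}) (\<lambda>z. blinfun_scaleR_left (case z of (s, t) \<Rightarrow> q s t))"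
        by (intro bounded_linear.continuous_on[OF bounded_linear_blinfun_scaleR_left] cq)
      then show "continuous (at (s, t) within {a1..a2} \<times> {b1..b2}) (\<lambda>(s, t). blinfun_scaleR_left (q s t))"
        using s t by (simp add: continuous_on_eq_continuous_within case_prod_beta')
    qed (use t in auto)
    moreover have "(s, t) \<in> interior ({a1..a2} \<times> {b1..b2})"
      using s t by (simp add: interior_Times)
    ultimately show ?thesis by (simp only: at_within_interior blinfun_scaleR_left.rep_eq)
  qed
  then show ?thesis using that by blast
qed

lemma real_2_eq: "(x::real^2) = x$1 *\<^sub>R axis 1 1 + x$2 *\<^sub>R axis 2 (1::real)"
  by (simp add: vec_eq_iff forall_2 axis_def)

lemma linear_real_2: "linear L \<Longrightarrow> L (x::real^2) = x$1 *\<^sub>R L (axis 1 1) + x$2 *\<^sub>R L (axis 2 1)"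
  using arg_cong[OF real_2_eq, of L x] by (simp add: linear_add linear_scale)

lemma frechet_derivative_linear: "f differentiable (at x) \<Longrightarrow> linear (frechet_derivative f (at x))"
  by (simp add: linear_frechet_derivative)

text \<open>The Poincare lemma for the one-form \<open>P dx\<^sub>1 + Q dx\<^sub>2\<close>, on small squares.\<close>

lemma closed_form_local_primitive:
  fixes P Q :: "real^2 \<Rightarrow> 'b::euclidean_space"
  assumes S: "open S" "x0 \<in> S" and P: "smooth_on S P" and Q: "smooth_on S Q"
    and closed: "\<And>x. x \<in> S \<Longrightarrow> frechet_derivative P (at x) (axis 2 1) = frechet_derivative Q (at x) (axis 1 1)"
  obtains B f where "open B" "convex B" "x0 \<in> B" "B \<subseteq> S"
    "\<And>x. x \<in> B \<Longrightarrow> (f has_derivative (\<lambda>u. u$1 *\<^sub>R P x + u$2 *\<^sub>R Q x)) (at x)"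
proof -
  obtain e where e: "e > 0" "ball x0 e \<subseteq> S" using S open_contains_ball by blast
  define d where "d = e / 3"
  have "d > 0" using e by (simp add: d_def)
  define a1 a2 b1 b2 where "a1 = x0$1 - d" and "a2 = x0$1 + d" and "b1 = x0$2 - d" and "b2 = x0$2 + d"
  define V :: "real \<Rightarrow> real \<Rightarrow> real^2" where "V s t = s *\<^sub>R axis 1 1 + t *\<^sub>R axis 2 1" for s t
  have V: "V s t \<in> S" if "s \<in> {a1..a2}" "t \<in> {b1..b2}" for s t
  proof -
    have "norm (V s t - x0) \<le> (\<Sum>i\<in>UNIV. \<bar>(V s t - x0)$i\<bar>)" by (rule norm_le_l1_cart)
    also have "\<dots> = \<bar>s - x0$1\<bar> + \<bar>t - x0$2\<bar>" by (simp add: sum_2 V_def axis_def)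
    also have "\<dots> \<le> d + d" using that by (auto simp: a1_def a2_def b1_def b2_def abs_if)
    also have "\<dots> < e" using e by (simp add: d_def)
    finally show ?thesis using e by (auto simp: dist_norm norm_minus_commute)
  qed
  have cV: "continuous_on T (\<lambda>z. V (fst z) (snd z))" for T
    unfolding V_def by (intro continuous_intros)
  have cont: "continuous_on ({a1..a2} \<times> {b1..b2}) (\<lambda>(s, t). K (V s t))"
    if "smooth_on S K" for K :: "real^2 \<Rightarrow> 'b"
    using continuous_on_compose2[OF smooth_on_continuous_on[OF that] cV, of "{a1..a2} \<times> {b1..b2}"] V
    by (auto simp: split_beta image_subset_iff)
  have dV: "((\<lambda>s. V s t) has_derivative (\<lambda>h. h *\<^sub>R axis 1 1)) (at s)"
      "((\<lambda>t. V s t) has_derivative (\<lambda>h. h *\<^sub>R axis 2 1)) (at t)" for s t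
    unfolding V_def by (auto intro!: derivative_eq_intros)
  have d1: "((\<lambda>t. P (V s t)) has_vector_derivative frechet_derivative P (at (V s t)) (axis 2 1)) (at t)"
    and d2: "((\<lambda>s. Q (V s t)) has_vector_derivative frechet_derivative P (at (V s t)) (axis 2 1)) (at s)"
    if "s \<in> {a1..a2}" "t \<in> {b1..b2}" for s t
    using has_derivative_compose[OF dV(2) smooth_on_has_derivative[OF P V[OF that]]]
      has_derivative_compose[OF dV(1) smooth_on_has_derivative[OF Q V[OF that]]]
      linear_scale[OF frechet_derivative_linear[OF smooth_on_differentiable[OF P V[OF that]]]]
      linear_scale[OF frechet_derivative_linear[OF smooth_on_differentiable[OF Q V[OF that]]]]
      closed[OF V[OF that]]
    by (auto simp: has_vector_derivative_def)
  obtain F where F: "\<And>s t. s \<in> {a1<..<a2} \<Longrightarrow> t \<in> {b1<..<b2} \<Longrightarrow>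
     ((\<lambda>(s, t). F s t) has_derivative (\<lambda>(u, v). u *\<^sub>R P (V s t) + v *\<^sub>R Q (V s t))) (at (s, t))"
    by (rule primitive_on_box[OF _ _ cont[OF P] cont[OF Q] cont[OF smooth_on_frechet_derivative[OF P, of "axis 2 1"]] d1 d2])
      (use \<open>d > 0\<close> in \<open>auto simp: a1_def a2_def b1_def b2_def\<close>)
  have box: "{x. a1 < x$1 \<and> x$1 < a2 \<and> b1 < x$2 \<and> x$2 < b2} = box (V a1 b1) (V a2 b2)"
    by (auto simp: mem_box_cart forall_2 V_def axis_def)
  show ?thesis
  proof
    show "open (box (V a1 b1) (V a2 b2))" "convex (box (V a1 b1) (V a2 b2))" by (auto simp: open_box convex_box)
    show "x0 \<in> box (V a1 b1) (V a2 b2)"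
      unfolding box[symmetric] using \<open>d > 0\<close> by (auto simp: a1_def a2_def b1_def b2_def)
    have VV: "V (x$1) (x$2) = x" for x unfolding V_def using real_2_eq by metis
    show "box (V a1 b1) (V a2 b2) \<subseteq> S"
      unfolding box[symmetric] using V VV by (metis (mono_tags, lifting) atLeastAtMost_iff less_imp_le mem_Collect_eq subsetI)
    fix x assume "x \<in> box (V a1 b1) (V a2 b2)"
    then have x: "x$1 \<in> {a1<..<a2}" "x$2 \<in> {b1<..<b2}" unfolding box[symmetric] by auto
    have "((\<lambda>x::real^2. (x$1, x$2)) has_derivative (\<lambda>u. (u$1, u$2))) (at x)"
      by (intro has_derivative_Pair bounded_linear_imp_has_derivative bounded_linear_vec_nth)
    from has_derivative_compose[OF this F[OF x]]
    show "((\<lambda>x. F (x$1) (x$2)) has_derivative (\<lambda>u. u$1 *\<^sub>R P x + u$2 *\<^sub>R Q x)) (at x)"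
      by (simp add: VV)
  qed
qed


section \<open>Monodromy\<close>

text \<open>The sections of a covering with fibres \<open>E p\<close>, described without a topology on its total space:
  through each point over a suitable set \<open>U\<close> there is a section on \<open>U\<close>, and the set where two
  sections agree is open and closed. It is used for the primitives of a closed form, whose fibres
  are \<open>\<real>\<^sup>3\<close>, and for the two spinors of an immersed surface.\<close>

locale local_sections =
  fixes E :: "'m::topological_space \<Rightarrow> 'b set"
    and Sec :: "'m set \<Rightarrow> ('m \<Rightarrow> 'b) \<Rightarrow> bool"
  assumes covering: "\<exists>U. open U \<and> p \<in> U \<and> (\<forall>x\<in>U. \<forall>y\<in>E x. \<exists>f. Sec U f \<and> f x = y)"
    and section_value: "Sec U f \<Longrightarrow> x \<in> U \<Longrightarrow> f x \<in> E x"
    and separation: "Sec U f \<Longrightarrow> Sec V g \<Longrightarrow> x \<in> U \<Longrightarrow> x \<in> V \<Longrightarrow>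
      \<exists>W. open W \<and> x \<in> W \<and> W \<subseteq> U \<inter> V \<and> (\<forall>w\<in>W. f w = g w \<longleftrightarrow> f x = g x)"
begin

text \<open>The map \<open>c\<close> is a lift of \<open>h\<close>: near each point it follows the section through its value.\<close>

definition lift_on :: "'k::topological_space set \<Rightarrow> ('k \<Rightarrow> 'm) \<Rightarrow> ('k \<Rightarrow> 'b) \<Rightarrow> bool" where
  "lift_on K h c \<longleftrightarrow> (\<forall>z\<in>K. c z \<in> E (h z) \<and>
     (\<forall>U f. Sec U f \<and> h z \<in> U \<and> f (h z) = c z \<longrightarrow>
        (\<exists>W. open W \<and> z \<in> W \<and> (\<forall>w\<in>W \<inter> K. h w \<in> U \<and> c w = f (h w)))))"

lemma section_through:
  assumes "y \<in> E x"
  obtains U f where "open U" "x \<in> U" "Sec U f" "f x = y"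
  using covering[of x] assms by blast

lemma lift_on_subset:
  assumes c: "lift_on K h c" and L: "L \<subseteq> K"
  shows "lift_on L h c"
  unfolding lift_on_def
proof (intro ballI conjI allI impI)
  fix z assume z: "z \<in> L"
  then show "c z \<in> E (h z)" using c L unfolding lift_on_def by blast
  fix U f assume "Sec U f \<and> h z \<in> U \<and> f (h z) = c z"
  then obtain W where "open W" "z \<in> W" "\<forall>w\<in>W \<inter> K. h w \<in> U \<and> c w = f (h w)"
    using c L z unfolding lift_on_def by (meson subsetD)
  then show "\<exists>W. open W \<and> z \<in> W \<and> (\<forall>w\<in>W \<inter> L. h w \<in> U \<and> c w = f (h w))"
    using L by (intro exI[of _ W]) auto
qed

lemma lift_on_section:
  assumes "continuous_on K h" "h ` K \<subseteq> U" "Sec U f"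
  shows "lift_on K h (\<lambda>z. f (h z))"
  unfolding lift_on_def
proof (intro ballI conjI allI impI)
  fix z assume z: "z \<in> K"
  then show "f (h z) \<in> E (h z)" using section_value assms by blast
  fix V g assume g: "Sec V g \<and> h z \<in> V \<and> g (h z) = f (h z)"
  have "h z \<in> U" using assms(2) z by blast
  from separation[OF assms(3) conjunct1[OF g] this] g
  obtain W where W: "open W" "h z \<in> W" "W \<subseteq> U \<inter> V" "\<forall>w\<in>W. f w = g w \<longleftrightarrow> f (h z) = g (h z)"
    by (elim impE exE conjE) auto
  obtain T where T: "open T" "T \<inter> K = h -` W \<inter> K"
    using assms(1) W(1) unfolding continuous_on_open_invariant by blast
  show "\<exists>W. open W \<and> z \<in> W \<and> (\<forall>w\<in>W \<inter> K. h w \<in> V \<and> f (h w) = g (h w))"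
  proof (intro exI[of _ T] conjI ballI)
    show "z \<in> T" using T z W by blast
    fix w assume "w \<in> T \<inter> K"
    then have "h w \<in> W" using T(2) by blast
    then show "h w \<in> V" "f (h w) = g (h w)" using W(3,4) g by auto
  qed (rule T)
qed

text \<open>Where two lifts agree they agree nearby, and where they differ they differ nearby.\<close>

lemma lift_on_unique:
  assumes K: "connected K" and c: "lift_on K h c" "lift_on K h c'"
    and h: "continuous_on K h" and z0: "z0 \<in> K" "c z0 = c' z0" and z: "z \<in> K"
  shows "c z = c' z"
proof -
  have loc: "\<exists>W. open W \<and> x \<in> W \<and> (\<forall>w\<in>W \<inter> K. c w = c' w \<longleftrightarrow> c x = c' x)" if x: "x \<in> K" for x
  proof -
    have e: "c x \<in> E (h x)" "c' x \<in> E (h x)" using c x unfolding lift_on_def by blast+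
    obtain U f where f: "h x \<in> U" "Sec U f" "f (h x) = c x" by (rule section_through[OF e(1)])
    obtain V g where g: "h x \<in> V" "Sec V g" "g (h x) = c' x" by (rule section_through[OF e(2)])
    obtain W1 where W1: "open W1" "x \<in> W1" "\<And>w. w \<in> W1 \<inter> K \<Longrightarrow> h w \<in> U \<and> c w = f (h w)"
      using c(1) f x unfolding lift_on_def by meson
    obtain W2 where W2: "open W2" "x \<in> W2" "\<And>w. w \<in> W2 \<inter> K \<Longrightarrow> h w \<in> V \<and> c' w = g (h w)"
      using c(2) g x unfolding lift_on_def by meson
    obtain W3 where W3: "open W3" "h x \<in> W3" "\<And>w. w \<in> W3 \<Longrightarrow> f w = g w \<longleftrightarrow> f (h x) = g (h x)"
      using separation[OF f(2) g(2) f(1) g(1)] by blast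
    obtain T where T: "open T" "T \<inter> K = h -` W3 \<inter> K"
      using h W3(1) unfolding continuous_on_open_invariant by blast
    show ?thesis
    proof (intro exI[of _ "W1 \<inter> W2 \<inter> T"] conjI ballI)
      have "x \<in> T" using T(2) W3(2) x by blast
      then show "x \<in> W1 \<inter> W2 \<inter> T" using W1(2) W2(2) by blast
      fix w assume w: "w \<in> W1 \<inter> W2 \<inter> T \<inter> K"
      then have "h w \<in> W3" using T(2) by blast
      then show "c w = c' w \<longleftrightarrow> c x = c' x"
        using W1(3)[of w] W2(3)[of w] W3(3)[of "h w"] f g w by auto
    qed (use W1 W2 T in auto)
  qed
  have "(c z = c' z) = (c z0 = c' z0)"
  proof (rule connected_local_const[OF K z z0(1)], intro ballI)
    fix a assume "a \<in> K"
    then obtain W where "open W" "a \<in> W" "\<forall>w\<in>W \<inter> K. c w = c' w \<longleftrightarrow> c a = c' a" using loc by blast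
    then show "\<forall>\<^sub>F b in at a within K. (c a = c' a) = (c b = c' b)"
      unfolding eventually_at_topological by blast
  qed
  then show ?thesis using z0 by simp
qed

definition liftable :: "('k::topological_space \<Rightarrow> 'm) \<Rightarrow> 'k set \<Rightarrow> bool" where
  "liftable h K \<longleftrightarrow> (\<forall>z\<in>K. \<forall>y\<in>E (h z). \<exists>c. lift_on K h c \<and> c z = y)"

lemma liftable_section_domain:
  assumes "continuous_on K h" "h ` K \<subseteq> U" "\<forall>x\<in>U. \<forall>y\<in>E x. \<exists>f. Sec U f \<and> f x = y"
  shows "liftable h K"
  unfolding liftable_def
proof (intro ballI)
  fix z y assume "z \<in> K" "y \<in> E (h z)"
  then obtain f where "Sec U f" "f (h z) = y" using assms by blast
  then show "\<exists>c. lift_on K h c \<and> c z = y" using lift_on_section[OF assms(1,2)] by blast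
qed

lemma lift_on_Un:
  assumes c: "lift_on K h c" "lift_on L h c" and cl: "closed K" "closed L"
  shows "lift_on (K \<union> L) h c"
  unfolding lift_on_def
proof (intro ballI conjI allI impI)
  fix z assume z: "z \<in> K \<union> L"
  show "c z \<in> E (h z)" using z c unfolding lift_on_def by blast
  fix U f assume f: "Sec U f \<and> h z \<in> U \<and> f (h z) = c z"
  have "\<exists>W. open W \<and> z \<in> W \<and> (\<forall>w\<in>W \<inter> M. h w \<in> U \<and> c w = f (h w))"
    if "lift_on M h c" "closed M" for M
  proof (cases "z \<in> M")
    case True then show ?thesis using that f unfolding lift_on_def by blast
  next
    case False then show ?thesis using that by (intro exI[of _ "- M"]) auto
  qed
  then obtain W1 W2 where "open W1 \<and> z \<in> W1 \<and> (\<forall>w\<in>W1 \<inter> K. h w \<in> U \<and> c w = f (h w))"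
    "open W2 \<and> z \<in> W2 \<and> (\<forall>w\<in>W2 \<inter> L. h w \<in> U \<and> c w = f (h w))" using c cl by meson
  then show "\<exists>W. open W \<and> z \<in> W \<and> (\<forall>w\<in>W \<inter> (K \<union> L). h w \<in> U \<and> c w = f (h w))"
    by (intro exI[of _ "W1 \<inter> W2"]) auto
qed

lemma lift_on_cong: "lift_on K h c \<Longrightarrow> (\<And>z. z \<in> K \<Longrightarrow> c z = c' z) \<Longrightarrow> lift_on K h c'"
  by (simp add: lift_on_def)

lemma liftable_Un:
  assumes lift: "liftable h K" "liftable h L" and closed: "closed K" "closed L"
    and KL: "connected (K \<inter> L)" "K \<inter> L \<noteq> {}" and h: "continuous_on (K \<union> L) h"
  shows "liftable h (K \<union> L)"
proof -
  note K = lift(1) closed(1) and L = lift(2) closed(2)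
  have main: "\<exists>c. lift_on (K \<union> L) h c \<and> c z = y"
    if z: "z \<in> K" "y \<in> E (h z)" and K: "liftable h K" "closed K" and L: "liftable h L" "closed L"
    and KL: "connected (K \<inter> L)" "K \<inter> L \<noteq> {}" and h: "continuous_on (K \<union> L) h" for z y K L
  proof -
    obtain c where c: "lift_on K h c" "c z = y" using K z unfolding liftable_def by blast
    obtain x where x: "x \<in> K" "x \<in> L" using KL by blast
    have "c x \<in> E (h x)" using c x unfolding lift_on_def by blast
    then obtain c' where c': "lift_on L h c'" "c' x = c x" using L x unfolding liftable_def by blast
    have eq: "c' w = c w" if "w \<in> K \<inter> L" for w
      by (rule lift_on_unique[OF KL(1) lift_on_subset[OF c'(1)] lift_on_subset[OF c(1)]
            continuous_on_subset[OF h] _ c'(2) that]) (use x in auto)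
    define d where "d w = (if w \<in> K then c w else c' w)" for w
    have "lift_on (K \<union> L) h d"
      by (intro lift_on_Un lift_on_cong[OF c(1)] lift_on_cong[OF c'(1)]) (use eq K L in \<open>auto simp: d_def\<close>)
    then show ?thesis using c z by (auto simp: d_def)
  qed
  show ?thesis unfolding liftable_def
  proof (intro ballI)
    fix z y assume zy: "z \<in> K \<union> L" "y \<in> E (h z)"
    then consider "z \<in> K" | "z \<in> L" by blast
    then show "\<exists>c. lift_on (K \<union> L) h c \<and> c z = y"
    proof cases
      case 1 then show ?thesis using main[OF _ zy(2) K L KL h] by blast
    next
      case 2
      have "\<exists>c. lift_on (L \<union> K) h c \<and> c z = y"
        by (rule main[OF 2 zy(2) L K]) (use KL h in \<open>simp_all add: Int_commute Un_commute\<close>)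
      then show ?thesis by (simp add: Un_commute)
    qed
  qed
qed

lemma Icc_times_Un:
  fixes a b c :: real
  assumes "a \<le> b" "b \<le> c"
  shows "{a..c} \<times> T = {a..b} \<times> T \<union> {b..c} \<times> T" "T \<times> {a..c} = T \<times> {a..b} \<union> T \<times> {b..c}"
    "({a..b} \<times> T) \<inter> ({b..c} \<times> T) = {b} \<times> T" "(T \<times> {a..b}) \<inter> (T \<times> {b..c}) = T \<times> {b}"
  using assms by auto

text \<open>Bisection in each variable: small rectangles are mapped into a set \<open>U\<close> as in
  \<open>covering\<close>, and lifts on two rectangles with a common side are glued along it.\<close>

lemma liftable_square:
  fixes h :: "real \<times> real \<Rightarrow> 'm"
  assumes h: "continuous_on ({0..1} \<times> {0..1}) h"
  shows "liftable h ({0..1} \<times> {0..1})"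
proof -
  define Q where "Q a b c d \<longleftrightarrow> 0 \<le> a \<and> a \<le> b \<and> b \<le> 1 \<and> 0 \<le> c \<and> c \<le> d \<and> d \<le> 1 \<longrightarrow> liftable h ({a..b} \<times> {c..d})" for a b c d
  have sub: "continuous_on ({a..b} \<times> {c..d}) h" if "0 \<le> a" "b \<le> 1" "0 \<le> c" "d \<le> 1" for a b c d
    by (rule continuous_on_subset[OF h]) (use that in auto)
  have small: "\<exists>e>0. \<forall>a b c d. a \<le> s \<and> s \<le> b \<and> b - a < e \<and> c \<le> t \<and> t \<le> d \<and> d - c < e \<longrightarrow> Q a b c d"
    if st: "s \<in> {0..1}" "t \<in> {0..1}" for s t
  proof -
    obtain U where U: "open U" "h (s, t) \<in> U" "\<forall>x\<in>U. \<forall>y\<in>E x. \<exists>f. Sec U f \<and> f x = y"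
      using covering by blast
    obtain T where T: "open T" "T \<inter> ({0..1} \<times> {0..1}) = h -` U \<inter> ({0..1} \<times> {0..1})"
      using h U(1) unfolding continuous_on_open_invariant by blast
    have "(s, t) \<in> T" using st U T by blast
    then obtain A B where AB: "open A" "open B" "s \<in> A" "t \<in> B" "A \<times> B \<subseteq> T"
      using T(1) open_prod_elim by (metis mem_Sigma_iff)
    obtain e1 where e1: "e1 > 0" "\<And>x. dist x s < e1 \<Longrightarrow> x \<in> A" using AB open_dist by metis
    obtain e2 where e2: "e2 > 0" "\<And>x. dist x t < e2 \<Longrightarrow> x \<in> B" using AB open_dist by metis
    have "Q a b c d" if "a \<le> s" "s \<le> b" "b - a < min e1 e2" "c \<le> t" "t \<le> d" "d - c < min e1 e2" for a b c d
      unfolding Q_def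
    proof (intro impI)
      assume r: "0 \<le> a \<and> a \<le> b \<and> b \<le> 1 \<and> 0 \<le> c \<and> c \<le> d \<and> d \<le> 1"
      have "h ` ({a..b} \<times> {c..d}) \<subseteq> U"
      proof clarify
        fix x y assume xy: "x \<in> {a..b}" "y \<in> {c..d}"
        then have "dist x s < e1" "dist y t < e2" using that by (auto simp: dist_real_def)
        then have "(x, y) \<in> T" using e1 e2 AB by blast
        then show "h (x, y) \<in> U" using T xy r by auto
      qed
      then show "liftable h ({a..b} \<times> {c..d})"
        using liftable_section_domain[OF sub _ U(3)] r by blast
    qed
    then show ?thesis using e1 e2 by (intro exI[of _ "min e1 e2"]) auto
  qed
  have strip: "\<exists>e>0. \<forall>c d. c \<le> t \<and> t \<le> d \<and> d - c < e \<longrightarrow> Q 0 1 c d" if t: "t \<in> {0..1}" for t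
  proof -
    have "(0::real) \<le> 0 \<and> (1::real) \<le> 1 \<longrightarrow> (\<exists>e>0. \<forall>c d. c \<le> t \<and> t \<le> d \<and> d - c < e \<longrightarrow> Q 0 1 c d)"
      using zero_le_one[where 'a=real]
    proof (induction rule: Bolzano[where P="\<lambda>a b. 0 \<le> a \<and> b \<le> 1 \<longrightarrow> (\<exists>e>0. \<forall>c d. c \<le> t \<and> t \<le> d \<and> d - c < e \<longrightarrow> Q a b c d)"])
      case (trans x y z)
      show ?case
      proof
        assume xz: "0 \<le> x \<and> z \<le> 1"
        obtain e1 where e1: "e1 > 0" "\<And>c d. c \<le> t \<Longrightarrow> t \<le> d \<Longrightarrow> d - c < e1 \<Longrightarrow> Q x y c d"
          using trans xz by auto
        obtain e2 where e2: "e2 > 0" "\<And>c d. c \<le> t \<Longrightarrow> t \<le> d \<Longrightarrow> d - c < e2 \<Longrightarrow> Q y z c d"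
          using trans xz by auto
        have "Q x z c d" if cd: "c \<le> t" "t \<le> d" "d - c < min e1 e2" for c d
          unfolding Q_def
        proof
          assume r: "0 \<le> x \<and> x \<le> z \<and> z \<le> 1 \<and> 0 \<le> c \<and> c \<le> d \<and> d \<le> 1"
          have "liftable h ({x..y} \<times> {c..d})" "liftable h ({y..z} \<times> {c..d})"
            using e1(2)[of c d] e2(2)[of c d] cd r trans(3,4) unfolding Q_def by auto
          then show "liftable h ({x..z} \<times> {c..d})"
            unfolding Icc_times_Un(1)[OF trans(3,4)]
          proof (rule liftable_Un)
            show "continuous_on ({x..y} \<times> {c..d} \<union> {y..z} \<times> {c..d}) h"
              unfolding Icc_times_Un(1)[OF trans(3,4), symmetric] by (rule sub) (use r in auto)
            show "connected (({x..y} \<times> {c..d}) \<inter> ({y..z} \<times> {c..d}))" "({x..y} \<times> {c..d}) \<inter> ({y..z} \<times> {c..d}) \<noteq> {}"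
              unfolding Icc_times_Un(3)[OF trans(3,4)] using r by (auto intro: connected_Times)
          qed (auto intro: closed_Times)
        qed
        then show "\<exists>e>0. \<forall>c d. c \<le> t \<and> t \<le> d \<and> d - c < e \<longrightarrow> Q x z c d"
          using e1 e2 by (intro exI[of _ "min e1 e2"]) auto
      qed
    next
      case (local s)
      then obtain e where e: "e > 0" "\<And>a b c d. a \<le> s \<Longrightarrow> s \<le> b \<Longrightarrow> b - a < e \<Longrightarrow> c \<le> t \<Longrightarrow> t \<le> d \<Longrightarrow> d - c < e \<Longrightarrow> Q a b c d"
        using small[of s t] t by auto
      show ?case using e by (intro exI[of _ e]) blast
    qed
    then show ?thesis by simp
  qed
  have "Q 0 1 0 1"
    using zero_le_one[where 'a=real]
  proof (induction rule: Bolzano[where P="Q 0 1"])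
    case (trans x y z)
    show ?case
      unfolding Q_def
    proof
      assume r: "0 \<le> (0::real) \<and> 0 \<le> (1::real) \<and> 1 \<le> (1::real) \<and> 0 \<le> x \<and> x \<le> z \<and> z \<le> 1"
      have "liftable h ({0..1} \<times> {x..y})" "liftable h ({0..1} \<times> {y..z})"
        using trans r unfolding Q_def by auto
      then show "liftable h ({0..1} \<times> {x..z})"
        unfolding Icc_times_Un(2)[OF trans(3,4)]
      proof (rule liftable_Un)
        show "continuous_on ({0..1} \<times> {x..y} \<union> {0..1} \<times> {y..z}) h"
          unfolding Icc_times_Un(2)[OF trans(3,4), symmetric] by (rule sub) (use r in auto)
        show "connected (({0..1::real} \<times> {x..y}) \<inter> ({0..1} \<times> {y..z}))" "({0..1::real} \<times> {x..y}) \<inter> ({0..1} \<times> {y..z}) \<noteq> {}"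
          unfolding Icc_times_Un(4)[OF trans(3,4)] using r by (auto intro: connected_Times)
      qed (auto intro: closed_Times)
    qed
  next
    case (local t)
    then show ?case using strip[of t] by auto
  qed
  then show ?thesis unfolding Q_def by simp
qed

lemma lift_on_compose:
  assumes c: "lift_on K h c" and \<phi>: "continuous_on L \<phi>" "\<phi> ` L \<subseteq> K"
  shows "lift_on L (\<lambda>x. h (\<phi> x)) (\<lambda>x. c (\<phi> x))"
  unfolding lift_on_def
proof (intro ballI conjI allI impI)
  fix x assume x: "x \<in> L"
  then show "c (\<phi> x) \<in> E (h (\<phi> x))" using c \<phi> unfolding lift_on_def by blast
  fix U f assume f: "Sec U f \<and> h (\<phi> x) \<in> U \<and> f (h (\<phi> x)) = c (\<phi> x)"
  have "\<phi> x \<in> K" using x \<phi> by blast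
  then obtain W where W: "open W" "\<phi> x \<in> W" "\<forall>w\<in>W \<inter> K. h w \<in> U \<and> c w = f (h w)"
    using c f unfolding lift_on_def by meson
  obtain T where T: "open T" "T \<inter> L = \<phi> -` W \<inter> L"
    using \<phi>(1) W(1) unfolding continuous_on_open_invariant by meson
  show "\<exists>T. open T \<and> x \<in> T \<and> (\<forall>w\<in>T \<inter> L. h (\<phi> w) \<in> U \<and> c (\<phi> w) = f (h (\<phi> w)))"
  proof (intro exI[of _ T] conjI ballI)
    show "x \<in> T" using T x W by blast
    fix w assume "w \<in> T \<inter> L"
    then have "\<phi> w \<in> W \<inter> K" using T \<phi> by blast
    then show "h (\<phi> w) \<in> U" "c (\<phi> w) = f (h (\<phi> w))" using W by auto
  qed (rule T)
qed

lemma lift_on_cong_base: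
  "lift_on K h c \<Longrightarrow> (\<And>z. z \<in> K \<Longrightarrow> h z = h' z) \<Longrightarrow> (\<And>z. z \<in> K \<Longrightarrow> c z = c' z) \<Longrightarrow> lift_on K h' c'"
  by (simp add: lift_on_def)

lemma lift_on_const:
  assumes "y \<in> E a"
  shows "lift_on K (\<lambda>z. a) (\<lambda>z. y)"
proof -
  obtain U f where "a \<in> U" "Sec U f" "f a = y" using section_through[OF assms] by blast
  then show ?thesis using lift_on_section[of K "\<lambda>z. a" U f] by auto
qed

lemma path_lift:
  assumes "path \<gamma>" "y \<in> E (\<gamma> 0)"
  obtains c where "lift_on {0..1} \<gamma> c" "c 0 = y"
proof -
  have "continuous_on ({0..1} \<times> {0..1}) (\<lambda>z::real\<times>real. \<gamma> (snd z))"
    by (rule continuous_on_compose2[of "{0..1}" \<gamma>]) (use assms in \<open>auto simp: path_def intro: continuous_intros\<close>)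
  from liftable_square[OF this] assms(2)
  obtain C where C: "lift_on ({0..1} \<times> {0..1}) (\<lambda>z::real\<times>real. \<gamma> (snd z)) C" "C (0, 0) = y"
    unfolding liftable_def by force
  have "lift_on {0..1} (\<lambda>x. \<gamma> (snd (0::real, x))) (\<lambda>x. C (0, x))"
    by (rule lift_on_compose[OF C(1)]) (auto intro!: continuous_intros)
  then show ?thesis using that C by simp
qed

text \<open>The homotopy of the loop to a constant one is free, so that its base point moves. Its lift to the
  square restricts on the two vertical edges to lifts of the same path, the track of the base
  point. They agree at the end, where the loop is constant, and so at the beginning.\<close>

lemma loop_lift_closes:
  assumes sc: "simply_connected (UNIV :: 'm set)" and p: "path p" "p 0 = p 1" and c: "lift_on {0..1} p c"
  shows "c 0 = c 1"
proof -
  define a where "a = p 0"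
  have "path (\<lambda>_::real. a)" by (simp add: path_def)
  then have "homotopic_loops UNIV p (\<lambda>_. a)"
    using sc p unfolding simply_connected_def by (simp add: pathstart_def pathfinish_def)
  then obtain h where h': "continuous_on ({0..1} \<times> {0..1}) h \<and> h \<in> {0..1} \<times> {0..1} \<rightarrow> UNIV \<and>
      (\<forall>x\<in>{0..1}. h (0, x) = p x) \<and> (\<forall>x\<in>{0..1}. h (1, x) = a) \<and>
      (\<forall>t\<in>{0..1::real}. pathfinish (h \<circ> Pair t) = pathstart (h \<circ> Pair t))"
    unfolding homotopic_loops by (rule exE)
  then have h: "continuous_on ({0..1} \<times> {0..1}) h" "\<And>x. x \<in> {0..1} \<Longrightarrow> h (0, x) = p x"
    "\<And>x. x \<in> {0..1} \<Longrightarrow> h (1, x) = a" "\<And>t. t \<in> {0..1} \<Longrightarrow> h (t, 0) = h (t, 1::real)"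
    by (simp_all add: pathstart_def pathfinish_def)
  have "c 0 \<in> E (h (0, 0))" using c h(2)[of 0] unfolding lift_on_def by auto
  then obtain C where C: "lift_on ({0..1} \<times> {0..1}) h C" "C (0, 0) = c 0"
    using liftable_square[OF h(1)] unfolding liftable_def by force
  have left: "lift_on {0..1} p (\<lambda>x. C (0, x))"
    by (rule lift_on_cong_base[OF lift_on_compose[OF C(1), where \<phi>="\<lambda>x. (0, x)" and L="{0..1}"]])
      (use h in \<open>auto intro!: continuous_intros\<close>)
  have "C (0, 1) = c 1"
    by (rule lift_on_unique[OF _ left c _ _ C(2)]) (use p in \<open>auto simp: path_def\<close>)
  moreover have right: "lift_on {0..1} (\<lambda>_. a) (\<lambda>x. C (1, x))"
    by (rule lift_on_cong_base[OF lift_on_compose[OF C(1), where \<phi>="\<lambda>x. (1, x)" and L="{0..1}"]])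
      (use h in \<open>auto intro!: continuous_intros\<close>)
  have a0: "C (1, 0) \<in> E a" using right unfolding lift_on_def by auto
  have "C (1, 1) = C (1, 0)"
    by (rule lift_on_unique[OF _ right lift_on_const[OF a0], of 0 1]) auto
  moreover have bot: "lift_on {0..1} (\<lambda>t. h (t, 0)) (\<lambda>t. C (t, 0))"
    by (rule lift_on_compose[OF C(1)]) (auto intro!: continuous_intros)
  have top: "lift_on {0..1} (\<lambda>t. h (t, 0)) (\<lambda>t. C (t, 1))"
    by (rule lift_on_cong_base[OF lift_on_compose[OF C(1), where \<phi>="\<lambda>t. (t, 1)" and L="{0..1}"]])
      (use h(4) in \<open>auto intro!: continuous_intros\<close>)
  have "continuous_on {0..1} (\<lambda>t. h (t, 0))"
    by (rule continuous_on_compose2[OF h(1)]) (auto intro!: continuous_intros)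
  then have "C (1, 0) = C (1, 1) \<Longrightarrow> C (0, 0) = C (0, 1)"
    using lift_on_unique[OF _ bot top, of 1 0] by simp
  ultimately show ?thesis using C(2) by simp
qed

lemma lift_on_join:
  assumes c: "lift_on {0..1} \<gamma> c" and d: "lift_on {0..1} \<delta> d" and eq: "\<gamma> 1 = \<delta> 0" "c 1 = d 0"
  shows "lift_on {0..1} (\<gamma> +++ \<delta>) (\<lambda>x. if x \<le> 1/2 then c (2 * x) else d (2 * x - 1))"
proof -
  have 1: "lift_on {0..1/2} (\<gamma> +++ \<delta>) (\<lambda>x. if x \<le> 1/2 then c (2 * x) else d (2 * x - 1))"
    by (rule lift_on_cong_base[OF lift_on_compose[OF c, where \<phi>="\<lambda>x. 2 * x" and L="{0..1/2}"]])
      (auto simp: joinpaths_def intro!: continuous_intros)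
  have 2: "lift_on {1/2..1} (\<gamma> +++ \<delta>) (\<lambda>x. if x \<le> 1/2 then c (2 * x) else d (2 * x - 1))"
  proof (rule lift_on_cong_base[OF lift_on_compose[OF d, where \<phi>="\<lambda>x. 2 * x - 1" and L="{1/2..1}"]])
    fix x :: real assume "x \<in> {1/2..1}"
    then have "x \<le> 1/2 \<Longrightarrow> 2 * x = 1" by simp
    then show "\<delta> (2 * x - 1) = (\<gamma> +++ \<delta>) x" "d (2 * x - 1) = (if x \<le> 1/2 then c (2 * x) else d (2 * x - 1))"
      using eq by (auto simp: joinpaths_def)
  qed (auto intro!: continuous_intros)
  have "{0..1} = {0..1/2} \<union> {1/2..1::real}" by auto
  with lift_on_Un[OF 1 2] show ?thesis by simp
qed

lemma lift_on_reverse: "lift_on {0..1} \<gamma> c \<Longrightarrow> lift_on {0..1} (reversepath \<gamma>) (\<lambda>x. c (1 - x))"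
  unfolding reversepath_def by (rule lift_on_compose) (auto intro!: continuous_intros)

definition reaches :: "'m \<Rightarrow> 'b \<Rightarrow> 'm \<Rightarrow> 'b \<Rightarrow> bool" where
  "reaches a y0 x y \<longleftrightarrow>
     (\<exists>\<gamma> c. path \<gamma> \<and> \<gamma> 0 = a \<and> \<gamma> 1 = x \<and> lift_on {0..1} \<gamma> c \<and> c 0 = y0 \<and> c 1 = y)"

lemma reaches_unique:
  assumes sc: "simply_connected (UNIV :: 'm set)" and "reaches a y0 x y" "reaches a y0 x y'"
  shows "y = y'"
proof -
  obtain \<gamma> c where c: "path \<gamma>" "\<gamma> 0 = a" "\<gamma> 1 = x" "lift_on {0..1} \<gamma> c" "c 0 = y0" "c 1 = y"
    using assms unfolding reaches_def by blast
  obtain \<delta> d where d: "path \<delta>" "\<delta> 0 = a" "\<delta> 1 = x" "lift_on {0..1} \<delta> d" "d 0 = y0" "d 1 = y'"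
    using assms unfolding reaches_def by blast
  have "c 1 \<in> E x" using c unfolding lift_on_def by force
  then have "c 1 \<in> E (reversepath \<delta> 0)" using d by (simp add: reversepath_def)
  moreover have "path (reversepath \<delta>)" using d by simp
  ultimately obtain r where r: "lift_on {0..1} (reversepath \<delta>) r" "r 0 = c 1"
    using path_lift[of "reversepath \<delta>" "c 1"] by blast
  have "pathfinish \<gamma> = pathstart (reversepath \<delta>)"
    unfolding pathstart_reversepath using c d by (simp add: pathfinish_def)
  then have "path (\<gamma> +++ reversepath \<delta>)"
    by (rule path_join_imp[OF c(1) \<open>path (reversepath \<delta>)\<close>])
  moreover have "(\<gamma> +++ reversepath \<delta>) 0 = (\<gamma> +++ reversepath \<delta>) 1"
    using c d by (simp add: joinpaths_def reversepath_def)
  moreover have "lift_on {0..1} (\<gamma> +++ reversepath \<delta>) (\<lambda>x. if x \<le> 1/2 then c (2 * x) else r (2 * x - 1))"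
    by (rule lift_on_join[OF c(4) r(1)]) (use c d r in \<open>auto simp: reversepath_def\<close>)
  ultimately have "(\<lambda>x. if x \<le> 1/2 then c (2 * x) else r (2 * x - 1)) 0 = (\<lambda>x. if x \<le> 1/2 then c (2 * x) else r (2 * x - 1)) 1"
    by (rule loop_lift_closes[OF sc])
  then have r1: "r 1 = y0" using c by simp
  have rd: "lift_on {0..1} \<delta> (\<lambda>x. r (1 - x))" using lift_on_reverse[OF r(1)] by simp
  have "d 1 = r (1 - 1)"
    by (rule lift_on_unique[OF _ d(4) rd, of 0 1]) (use d r1 in \<open>auto simp: path_def\<close>)
  then show ?thesis using r c d by simp
qed

lemma simply_connected_path:
  fixes a x :: "'m"
  assumes sc: "simply_connected (UNIV :: 'm set)"
  obtains \<gamma> where "path \<gamma>" "\<gamma> 0 = a" "\<gamma> 1 = x"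
proof -
  have "path (\<lambda>_::real. a)" "path (\<lambda>_::real. x)" by (simp_all add: path_def)
  then have "homotopic_loops UNIV (\<lambda>_. a) (\<lambda>_. x)"
    using sc unfolding simply_connected_def by (simp add: pathstart_def pathfinish_def)
  then obtain h where h: "continuous_on ({0..1} \<times> {0..1}) h" "\<And>s. s \<in> {0..1} \<Longrightarrow> h (0, s) = a"
    "\<And>s. s \<in> {0..1::real} \<Longrightarrow> h (1::real, s) = x"
    unfolding homotopic_loops by auto
  have "path (\<lambda>t. h (t, 0))" unfolding path_def
    by (rule continuous_on_compose2[OF h(1)]) (auto intro!: continuous_intros)
  then show ?thesis using that[of "\<lambda>t. h (t, 0)"] h by simp
qed

text \<open>The value at \<open>x\<close> is the end point of the lift of any path from \<open>a\<close> to \<open>x\<close>.\<close>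

lemma monodromy:
  assumes sc: "simply_connected (UNIV :: 'm set)"
    and lpc: "\<And>x W. open W \<Longrightarrow> (x::'m) \<in> W \<Longrightarrow> \<exists>V. open V \<and> x \<in> V \<and> V \<subseteq> W \<and> path_connected V"
    and y0: "y0 \<in> E a"
  shows "\<exists>\<phi>. (\<forall>x. \<phi> x \<in> E x) \<and> (\<forall>U f x. Sec U f \<and> x \<in> U \<and> f x = \<phi> x \<longrightarrow>
     (\<exists>W. open W \<and> x \<in> W \<and> W \<subseteq> U \<and> (\<forall>w\<in>W. \<phi> w = f w)))"
proof -
  have ex: "\<exists>y. reaches a y0 x y" for x
  proof -
    obtain \<gamma> where \<gamma>: "path \<gamma>" "\<gamma> 0 = a" "\<gamma> 1 = x" using simply_connected_path[OF sc] by blast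
    then obtain c where "lift_on {0..1} \<gamma> c" "c 0 = y0" using path_lift y0 by metis
    then show ?thesis using \<gamma> unfolding reaches_def by blast
  qed
  define \<phi> where "\<phi> x = (SOME y. reaches a y0 x y)" for x
  have \<phi>: "reaches a y0 x (\<phi> x)" for x unfolding \<phi>_def by (rule someI_ex[OF ex])
  show ?thesis
  proof (intro exI[of _ \<phi>] conjI allI impI)
    fix x
    obtain \<gamma> c where c: "path \<gamma>" "\<gamma> 0 = a" "\<gamma> 1 = x" "lift_on {0..1} \<gamma> c" "c 0 = y0" "c 1 = \<phi> x"
      using \<phi>[of x] unfolding reaches_def by blast
    have "c 1 \<in> E (\<gamma> 1)" using c(4) unfolding lift_on_def by simp
    then show "\<phi> x \<in> E x" using c by simp
  next
    fix U f x assume "Sec U f \<and> x \<in> U \<and> f x = \<phi> x"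
    then have f: "Sec U f" "x \<in> U" "f x = \<phi> x" by auto
    obtain W where W: "open W" "x \<in> W" "W \<subseteq> U" using separation[OF f(1) f(1) f(2) f(2)] by auto
    obtain V where V: "open V" "x \<in> V" "V \<subseteq> W" "path_connected V" using lpc[OF W(1,2)] by blast
    have "\<phi> w = f w" if w: "w \<in> V" for w
    proof -
      obtain \<sigma> where \<sigma>: "path \<sigma>" "path_image \<sigma> \<subseteq> V" "\<sigma> 0 = x" "\<sigma> 1 = w"
        using V(4) V(2) w unfolding path_connected_def pathstart_def pathfinish_def by blast
      have s: "lift_on {0..1} \<sigma> (\<lambda>z. f (\<sigma> z))"
        by (rule lift_on_section[OF _ _ f(1)]) (use \<sigma> V W in \<open>auto simp: path_def path_image_def\<close>)
      obtain \<gamma> c where c: "path \<gamma>" "\<gamma> 0 = a" "\<gamma> 1 = x" "lift_on {0..1} \<gamma> c" "c 0 = y0" "c 1 = \<phi> x"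
        using \<phi>[of x] unfolding reaches_def by blast
      have "path (\<gamma> +++ \<sigma>)"
        using c \<sigma> by (intro path_join_imp) (auto simp: pathstart_def pathfinish_def)
      moreover have "lift_on {0..1} (\<gamma> +++ \<sigma>) (\<lambda>x. if x \<le> 1/2 then c (2 * x) else f (\<sigma> (2 * x - 1)))"
        by (rule lift_on_join[OF c(4) s]) (use c \<sigma> f in auto)
      ultimately have "reaches a y0 w (f w)"
        unfolding reaches_def using c \<sigma>
        by (intro exI[of _ "\<gamma> +++ \<sigma>"] exI[of _ "\<lambda>x. if x \<le> 1/2 then c (2 * x) else f (\<sigma> (2 * x - 1))"]) (auto simp: joinpaths_def)
      then show ?thesis using reaches_unique[OF sc \<phi>] by blast
    qed
    then show "\<exists>W. open W \<and> x \<in> W \<and> W \<subseteq> U \<and> (\<forall>w\<in>W. \<phi> w = f w)"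
      using V W by blast
  qed
qed

end


section \<open>Spinors and the Minkowski space\<close>

text \<open>The symmetric bilinear map that identifies \<open>Sym\<^sup>2 \<real>\<^sup>2\<close> with the Minkowski space, \<open>\<real>\<^sup>2\<close> being
  the complex plane.\<close>

definition spin_prod :: "complex \<Rightarrow> complex \<Rightarrow> real^3" where
  "spin_prod z w = vector [Re (z * w), Re (z * cnj w), Im (z * w)]"

text \<open>The determinant of \<open>(z, w)\<close>; it is \<open>|\<psi>|\<^sup>2\<close> for the spinor \<open>\<psi>\<close> with the components \<open>z, w\<close>.\<close>

definition area :: "complex \<Rightarrow> complex \<Rightarrow> real" where
  "area z w = Im (cnj z * w)"

lemma spin_prod_nth:
  "spin_prod z w $ 1 = Re z * Re w - Im z * Im w"
  "spin_prod z w $ 2 = Re z * Re w + Im z * Im w"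
  "spin_prod z w $ 3 = Re z * Im w + Im z * Re w"
  by (simp_all add: spin_prod_def)

lemma area_altdef: "area z w = Re z * Im w - Im z * Re w"
  by (simp add: area_def)

lemma spin_prod_commute: "spin_prod z w = spin_prod w z"
  by (simp add: vec_eq_iff forall_3 spin_prod_nth)

lemma bounded_bilinear_spin_prod: "bounded_bilinear spin_prod"
proof (rule bilinear_conv_bounded_bilinear[THEN iffD1], unfold bilinear_def, intro conjI allI)
  fix x show "linear (spin_prod x)" "linear (\<lambda>y. spin_prod y x)"
    by (rule linearI; simp add: vec_eq_iff forall_3 spin_prod_nth algebra_simps)+
qed

lemma bounded_bilinear_mink: "bounded_bilinear mink"
proof (rule bilinear_conv_bounded_bilinear[THEN iffD1], unfold bilinear_def, intro conjI allI)
  fix x show "linear (mink x)" "linear (\<lambda>y. mink y x)"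
    by (rule linearI; simp add: mink_def algebra_simps)+
qed

lemmas mink_simps = bounded_bilinear.add_left[OF bounded_bilinear_mink] bounded_bilinear.add_right[OF bounded_bilinear_mink]
  bounded_bilinear.diff_left[OF bounded_bilinear_mink] bounded_bilinear.diff_right[OF bounded_bilinear_mink]
  bounded_bilinear.scaleR_left[OF bounded_bilinear_mink] bounded_bilinear.scaleR_right[OF bounded_bilinear_mink]
  bounded_bilinear.zero_left[OF bounded_bilinear_mink] bounded_bilinear.zero_right[OF bounded_bilinear_mink]
  bounded_bilinear.minus_left[OF bounded_bilinear_mink] bounded_bilinear.minus_right[OF bounded_bilinear_mink]

lemmas spin_prod_simps = bounded_bilinear.add_left[OF bounded_bilinear_spin_prod] bounded_bilinear.add_right[OF bounded_bilinear_spin_prod]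
  bounded_bilinear.diff_left[OF bounded_bilinear_spin_prod] bounded_bilinear.diff_right[OF bounded_bilinear_spin_prod]
  bounded_bilinear.scaleR_left[OF bounded_bilinear_spin_prod] bounded_bilinear.scaleR_right[OF bounded_bilinear_spin_prod]
  bounded_bilinear.minus_left[OF bounded_bilinear_spin_prod] bounded_bilinear.minus_right[OF bounded_bilinear_spin_prod]

lemma mink_commute: "mink x y = mink y x"
  by (simp add: mink_def)

lemma mink_spin_prod:
  "mink (spin_prod z z) (spin_prod z z) = 0"
  "mink (spin_prod z z) (spin_prod w w) = -2 * (area z w)\<^sup>2"
  "mink (spin_prod z z) (spin_prod z w) = 0"
  "mink (spin_prod w w) (spin_prod z w) = 0"
  "mink (spin_prod z w) (spin_prod z w) = (area z w)\<^sup>2"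
  by (simp_all add: mink_def spin_prod_nth area_altdef power2_eq_square algebra_simps)

lemma mink_expansion:
  "(area z w)\<^sup>2 *\<^sub>R y = (- mink y (spin_prod w w) / 2) *\<^sub>R spin_prod z z
     + (- mink y (spin_prod z z) / 2) *\<^sub>R spin_prod w w + mink y (spin_prod z w) *\<^sub>R spin_prod z w"
  by (simp add: vec_eq_iff forall_3 mink_def spin_prod_nth area_altdef power2_eq_square field_simps)

lemma area_expansion: "area z w *\<^sub>R u = area u w *\<^sub>R z + area z u *\<^sub>R w"
  by (simp add: complex_eq_iff area_altdef algebra_simps)

text \<open>In the basis \<open>z, w\<close>, the first condition on the right kills the diagonal coefficients of
  \<open>(u, v)\<close> and identifies the other two, whose common value is then read off by the second.\<close>

lemma dirac_iff_form:
  assumes "area z w = 1"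
  shows "u = (- H) *\<^sub>R w \<and> v = (- H) *\<^sub>R z \<longleftrightarrow>
    spin_prod z u = spin_prod w v \<and>
    mink (spin_prod z u) (spin_prod z w) + mink (spin_prod w v) (spin_prod z w) = - 2 * H"
proof -
  obtain a b where u: "u = a *\<^sub>R z + b *\<^sub>R w" using area_expansion[of z w u] assms by auto
  obtain c d where v: "v = c *\<^sub>R z + d *\<^sub>R w" using area_expansion[of z w v] assms by auto
  have zu: "spin_prod z u = a *\<^sub>R spin_prod z z + b *\<^sub>R spin_prod z w"
    and wv: "spin_prod w v = c *\<^sub>R spin_prod z w + d *\<^sub>R spin_prod w w"
    unfolding u v by (simp_all add: spin_prod_simps spin_prod_commute[of w z])
  have m: "mink (spin_prod z u) (spin_prod z w) = b" "mink (spin_prod w v) (spin_prod z w) = c"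
    "mink (spin_prod z u) (spin_prod w w) = - 2 * a" "mink (spin_prod w v) (spin_prod w w) = 0"
    "mink (spin_prod z u) (spin_prod z z) = 0" "mink (spin_prod w v) (spin_prod z z) = - 2 * d"
    unfolding zu wv using assms mink_commute[of "spin_prod w w" "spin_prod z z"]
      mink_commute[of "spin_prod z w" "spin_prod z z"] mink_commute[of "spin_prod z w" "spin_prod w w"]
    by (simp_all add: mink_simps mink_spin_prod)
  show ?thesis
  proof
    assume "u = (- H) *\<^sub>R w \<and> v = (- H) *\<^sub>R z"
    then have "spin_prod z u = (- H) *\<^sub>R spin_prod z w" "spin_prod w v = (- H) *\<^sub>R spin_prod z w"
      by (simp_all add: spin_prod_simps spin_prod_commute[of w z])
    then show "spin_prod z u = spin_prod w v \<and>
      mink (spin_prod z u) (spin_prod z w) + mink (spin_prod w v) (spin_prod z w) = - 2 * H"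
      using assms by (simp add: mink_simps mink_spin_prod)
  next
    assume r: "spin_prod z u = spin_prod w v \<and>
      mink (spin_prod z u) (spin_prod z w) + mink (spin_prod w v) (spin_prod z w) = - 2 * H"
    have "a = 0" "d = 0" "b = c" using m conjunct1[OF r] by auto
    moreover have "b = - H" using m conjunct2[OF r] \<open>b = c\<close> by auto
    ultimately show "u = (- H) *\<^sub>R w \<and> v = (- H) *\<^sub>R z" by (simp add: u v)
  qed
qed

text \<open>With \<open>s, t = \<plusminus>1\<close> these isometries change the time orientation and the orientation of the
  Minkowski space independently.\<close>

definition flip :: "real \<Rightarrow> real \<Rightarrow> real^3 \<Rightarrow> real^3" where
  "flip s t x = vector [x$1, s * x$2, t * x$3]"

lemma flip_nth: "flip s t x $ 1 = x$1" "flip s t x $ 2 = s * x$2" "flip s t x $ 3 = t * x$3"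
  by (simp_all add: flip_def)

lemma bounded_linear_flip: "bounded_linear (flip s t)"
proof -
  have "linear (flip s t)" by (rule linearI; simp add: vec_eq_iff forall_3 flip_nth algebra_simps)
  then show ?thesis by (simp add: linear_conv_bounded_linear)
qed

lemma mink_flip: "s\<^sup>2 = 1 \<Longrightarrow> t\<^sup>2 = 1 \<Longrightarrow> mink (flip s t x) (flip s t y) = mink x y"
proof -
  assume st: "s\<^sup>2 = 1" "t\<^sup>2 = 1"
  have "mink (flip s t x) (flip s t y) = x$1 * y$1 - s\<^sup>2 * (x$2 * y$2) + t\<^sup>2 * (x$3 * y$3)"
    by (simp add: mink_def flip_nth power2_eq_square algebra_simps)
  then show ?thesis by (simp add: st mink_def)
qed

text \<open>The model is the image of \<open>e\<^sub>2 + e\<^sub>3\<close> and \<open>e\<^sub>2 - e\<^sub>3\<close> under an isometric embedding of the tangent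
  plane, together with a unit normal.\<close>

definition null_frame :: "real^3 \<Rightarrow> real^3 \<Rightarrow> real^3 \<Rightarrow> bool" where
  "null_frame n m N \<longleftrightarrow> mink n n = 0 \<and> mink m m = 0 \<and> mink n m = -2 \<and>
     mink N N = 1 \<and> mink N n = 0 \<and> mink N m = 0"

lemma null_frame_flip: "s\<^sup>2 = 1 \<Longrightarrow> t\<^sup>2 = 1 \<Longrightarrow> null_frame n m N \<Longrightarrow> null_frame (flip s t n) (flip s t m) (flip s t N)"
  by (simp add: null_frame_def mink_flip)

definition spins :: "complex \<Rightarrow> complex \<Rightarrow> real^3 \<Rightarrow> real^3 \<Rightarrow> real^3 \<Rightarrow> bool" where
  "spins z w n m N \<longleftrightarrow> n = spin_prod z z \<and> m = spin_prod w w \<and> N = spin_prod z w \<and> area z w = 1"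

lemma power2_eq_imp: "(x::real)\<^sup>2 = y\<^sup>2 \<Longrightarrow> 0 \<le> x \<Longrightarrow> 0 \<le> y \<Longrightarrow> x = y"
  by (metis power2_eq_iff_nonneg)

text \<open>The first null vector determines \<open>z\<close> up to sign, and the normal then determines \<open>w\<close>. What is left
  of a null frame is the second null vector, which is the only one of product \<open>-2\<close> with \<open>n\<close> that
  is orthogonal to \<open>N\<close>, and the orientation, which is the sign of the area.\<close>

lemma null_frame_square_root:
  assumes nf: "null_frame n m N" and n2: "n $ 2 > 0"
    and z: "z\<^sup>2 = Complex (n$1) (n$3)" and w: "z * w = Complex (N$1) (N$3)"
  shows "z \<noteq> 0" "(area z w)\<^sup>2 = 1" "area z w > 0 \<Longrightarrow> spins z w n m N"
proof -
  have zr: "Re z * Re z - Im z * Im z = n$1" "2 * Re z * Im z = n$3"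
    using z by (auto simp: complex_eq_iff power2_eq_square algebra_simps)
  have wr: "Re z * Re w - Im z * Im w = N$1" "Re z * Im w + Im z * Re w = N$3"
    using w by (simp_all add: complex_eq_iff)
  have "(Re z * Re z + Im z * Im z)\<^sup>2 = (n$1)\<^sup>2 + (n$3)\<^sup>2"
    unfolding zr[symmetric] by (simp add: power2_eq_square algebra_simps)
  also have "\<dots> = (n$2)\<^sup>2" using nf by (simp add: null_frame_def mink_def power2_eq_square)
  finally have n: "Re z * Re z + Im z * Im z = n$2"
    by (rule power2_eq_imp) (use n2 in \<open>auto intro: add_nonneg_nonneg\<close>)
  show "z \<noteq> 0" using n n2 by auto
  have nz: "n = spin_prod z z" using n zr by (simp add: vec_eq_iff forall_3 spin_prod_nth mult.commute)
  have "n$2 * N$2 = N$1 * n$1 + N$3 * n$3"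
    using nf by (simp add: null_frame_def mink_def algebra_simps)
  also have "\<dots> = n$2 * (Re z * Re w + Im z * Im w)"
    unfolding n[symmetric] wr[symmetric] zr[symmetric] by (simp add: algebra_simps)
  finally have "N$2 = Re z * Re w + Im z * Im w" using n2 by (simp only: mult_left_cancel[OF less_imp_neq[OF n2, symmetric]])
  then have Nz: "N = spin_prod z w" using wr by (simp add: vec_eq_iff forall_3 spin_prod_nth)
  then show a2: "(area z w)\<^sup>2 = 1" using nf mink_spin_prod(5)[of z w] by (simp add: null_frame_def)
  have mn: "mink m (spin_prod z z) = -2" "mink m (spin_prod z w) = 0"
    using nf mink_commute unfolding null_frame_def nz[symmetric] Nz[symmetric] by metis+
  define a where "a = - mink m (spin_prod w w) / 2"
  have m: "m = a *\<^sub>R n + spin_prod w w"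
    using mink_expansion[of z w m] unfolding a2 mn nz by (simp add: a_def)
  have "0 = mink m m" using nf by (simp add: null_frame_def)
  also have "\<dots> = 2 * a * mink n (spin_prod w w)"
    unfolding m using nf mink_spin_prod(1)[of w] by (simp add: mink_simps null_frame_def mink_commute[of "spin_prod w w" n])
  also have "mink n (spin_prod w w) = -2" unfolding nz mink_spin_prod a2 by simp
  finally have "m = spin_prod w w" using m by simp
  then show "spins z w n m N" if "area z w > 0"
    using that a2 nz Nz by (simp add: spins_def power2_eq_1_iff)
qed

text \<open>The sign \<open>s\<close> makes the null vectors future-directed. If the area of the resulting spinor is
  negative, the reflection by \<open>t = -1\<close> replaces the spinor by its conjugate.\<close>

lemma null_frame_spins:
  assumes nf: "null_frame n m N"
  obtains s t z w where "s\<^sup>2 = 1" "t\<^sup>2 = 1" "spins z w (flip s t n) (flip s t m) (flip s t N)"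
proof -
  have "n $ 2 \<noteq> 0"
  proof
    assume n2: "n $ 2 = 0"
    then have "n$1 * n$1 + n$3 * n$3 = 0" using nf by (simp add: null_frame_def mink_def)
    then have "n$1 = 0" "n$3 = 0" by (auto simp: sum_squares_eq_zero_iff)
    with n2 show False using nf by (simp add: null_frame_def mink_def)
  qed
  define s where "s = sgn (n $ 2)"
  have s: "s\<^sup>2 = 1" "s * n$2 > 0"
    using \<open>n $ 2 \<noteq> 0\<close> by (auto simp: s_def sgn_if)
  define z where "z = csqrt (Complex (n$1) (n$3))"
  have z: "z\<^sup>2 = Complex (n$1) (n$3)" by (simp add: z_def)
  have nf1: "null_frame (flip s 1 n) (flip s 1 m) (flip s 1 N)"
    and nf2: "null_frame (flip s (-1) n) (flip s (-1) m) (flip s (-1) N)"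
    using null_frame_flip[OF s(1) _ nf] by auto
  define w where "w = Complex (N$1) (N$3) / z"
  have "z \<noteq> 0"
  proof
    assume "z = 0"
    then have "n$1 = 0" "n$3 = 0" using z by (simp_all add: complex_eq_iff)
    then show False using nf \<open>n $ 2 \<noteq> 0\<close> by (simp add: null_frame_def mink_def)
  qed
  show ?thesis
  proof (cases "area z w > 0")
    case True
    show ?thesis
      by (rule that[OF s(1) _ null_frame_square_root(3)[OF nf1 _ _ _ True]])
        (use s z \<open>z \<noteq> 0\<close> in \<open>auto simp: flip_nth w_def\<close>)
  next
    case False
    moreover have "(area z w)\<^sup>2 = 1"
      by (rule null_frame_square_root(2)[OF nf1]) (use s z \<open>z \<noteq> 0\<close> in \<open>auto simp: flip_nth w_def\<close>)
    ultimately have "area (cnj z) (cnj w) > 0"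
      by (auto simp: area_altdef power2_eq_1_iff)
    moreover have "z * w = Complex (N$1) (N$3)" using \<open>z \<noteq> 0\<close> by (simp add: w_def)
    then have "(cnj z)\<^sup>2 = Complex (n$1) (- (n$3))" "cnj z * cnj w = Complex (N$1) (- (N$3))"
      unfolding complex_cnj_power[symmetric] complex_cnj_mult[symmetric] z
      by (simp_all add: complex_eq_iff)
    ultimately show ?thesis
      by (intro that[OF s(1) _ null_frame_square_root(3)[OF nf2]]) (use s in \<open>auto simp: flip_nth\<close>)
  qed
qed

lemma spins_nonzero:
  assumes "spins z w n m N"
  shows "z \<noteq> 0 \<and> n $ 2 > 0"
proof
  show "z \<noteq> 0" using assms by (auto simp: spins_def area_altdef)
  then have "0 < Re z * Re z + Im z * Im z"
    by (simp add: complex_eq_iff sum_squares_gt_zero_iff)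
  then show "n $ 2 > 0" using assms by (simp add: spins_def spin_prod_nth)
qed

lemma spins_square: "spins z w n m N \<Longrightarrow> z\<^sup>2 = Complex (n$1) (n$3) \<and> z * w = Complex (N$1) (N$3)"
  by (auto simp: spins_def spin_prod_nth power2_eq_square complex_eq_iff)

lemma spins_minus: "spins z w n m N \<Longrightarrow> spins (- z) (- w) n m N"
  by (simp add: spins_def spin_prod_simps area_altdef)

lemma spins_scale:
  assumes "spins z w n m N" "h \<noteq> 0"
  shows "spins (inverse h *\<^sub>R z) (h *\<^sub>R w) ((inverse h)\<^sup>2 *\<^sub>R n) (h\<^sup>2 *\<^sub>R m) N"
proof -
  have "area (inverse h *\<^sub>R z) (h *\<^sub>R w) = area z w"
    using assms(2) by (simp add: area_altdef field_simps)
  then show ?thesis using assms by (simp add: spins_def spin_prod_simps power2_eq_square)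
qed

text \<open>The signs of the reflection are determined by the frame: another \<open>t\<close> would replace the spinor by
  its conjugate, of area \<open>-1\<close>. Only the sign of the square root remains free.\<close>

lemma spins_unique:
  assumes nf: "null_frame n m N" and st: "s\<^sup>2 = 1" "t\<^sup>2 = 1" "s'\<^sup>2 = 1" "t'\<^sup>2 = 1"
    and a: "spins z w (flip s t n) (flip s t m) (flip s t N)"
    and b: "spins z' w' (flip s' t' n) (flip s' t' m) (flip s' t' N)"
  shows "(z' = z \<and> w' = w) \<or> (z' = - z \<and> w' = - w)"
proof -
  have za: "z \<noteq> 0" "z\<^sup>2 = Complex (n$1) (t * n$3)" "z * w = Complex (N$1) (t * N$3)"
    using spins_nonzero[OF a] spins_square[OF a] by (auto simp: flip_nth)
  have zb: "z' \<noteq> 0" "z'\<^sup>2 = Complex (n$1) (t' * n$3)" "z' * w' = Complex (N$1) (t' * N$3)"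
    using spins_nonzero[OF b] spins_square[OF b] by (auto simp: flip_nth)
  have pm: "z' = z \<and> w' = w \<or> z' = - z \<and> w' = - w" if "z'\<^sup>2 = z\<^sup>2" "z' * w' = z * w" for z' w'
  proof -
    consider "z' = z" | "z' = - z" using \<open>z'\<^sup>2 = z\<^sup>2\<close> by (auto simp: power2_eq_iff)
    then show ?thesis
    proof cases
      case 1 then show ?thesis using that(2) za(1) by simp
    next
      case 2
      then have "z * (- w') = z * w" using that(2) by simp
      then show ?thesis using 2 za(1) by (metis minus_equation_iff mult_left_cancel)
    qed
  qed
  show ?thesis
  proof (cases "t' = t")
    case True then show ?thesis using za zb pm by simp
  next
    case False
    then have t: "t' = - t" using st by (auto simp: power2_eq_1_iff)
    have "(cnj z')\<^sup>2 = z\<^sup>2" "cnj z' * cnj w' = z * w"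
      using za(2,3) arg_cong[OF zb(2), of cnj] arg_cong[OF zb(3), of cnj]
      by (simp_all add: t complex_eq_iff)
    then have "(cnj z' = z \<and> cnj w' = w) \<or> (cnj z' = - z \<and> cnj w' = - w)"
      by (rule pm)
    then have "area (cnj z') (cnj w') = area z w"
      by (elim disjE conjE) (simp_all only: area_def complex_cnj_minus mult_minus_left mult_minus_right minus_minus)
    then have "- area z' w' = area z w" by (simp add: area_altdef)
    then show ?thesis using a b by (simp add: spins_def)
  qed
qed


section \<open>The Levi-Civita connection in a null frame\<close>

definition bil :: "real^2^2 \<Rightarrow> real^2 \<Rightarrow> real^2 \<Rightarrow> real" where
  "bil G u w = (\<Sum>i\<in>UNIV. \<Sum>j\<in>UNIV. G$i$j * u$i * w$j)"

lemma bil_inner: "bil G u w = u \<bullet> (G *v w)"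
  by (simp add: bil_def inner_vec_def matrix_vector_mult_def sum_2 algebra_simps)

lemma bil_simps:
  "bil G (u + u') w = bil G u w + bil G u' w" "bil G u (w + w') = bil G u w + bil G u w'"
  "bil G (u - u') w = bil G u w - bil G u' w" "bil G u (w - w') = bil G u w - bil G u w'"
  "bil G (a *\<^sub>R u) w = a * bil G u w" "bil G u (a *\<^sub>R w) = a * bil G u w"
  "bil (G + G') u w = bil G u w + bil G' u w" "bil (G - G') u w = bil G u w - bil G' u w"
  "bil (a *\<^sub>R G) u w = a * bil G u w"
  by (simp_all add: bil_def sum_2 algebra_simps)

lemma bil_commute:
  assumes "transpose G = G"
  shows "bil G u w = bil G w u"
proof -
  have "G$2$1 = G$1$2" using arg_cong[OF assms, of "\<lambda>M. M$1$2"] by (simp add: transpose_def)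
  then show ?thesis by (simp add: bil_def sum_2 algebra_simps)
qed

definition lorentz_frame :: "real^2^2 \<Rightarrow> real^2 \<Rightarrow> real^2 \<Rightarrow> bool" where
  "lorentz_frame G e2 e3 \<longleftrightarrow> transpose G = G \<and> bil G e2 e2 = -1 \<and> bil G e2 e3 = 0 \<and> bil G e3 e3 = 1"

lemma lorentz_frame_null:
  assumes "lorentz_frame G e2 e3"
  shows "bil G (e2 + e3) (e2 + e3) = 0" "bil G (e2 - e3) (e2 - e3) = 0"
    "bil G (e2 + e3) (e2 - e3) = -2" "bil G (e2 - e3) (e2 + e3) = -2"
  using assms bil_commute[of G e3 e2] by (auto simp: lorentz_frame_def bil_simps)

lemma lorentz_frame_expansion:
  assumes f: "lorentz_frame G e2 e3"
  shows "x = (- bil G x (e2 - e3) / 2) *\<^sub>R (e2 + e3) + (- bil G x (e2 + e3) / 2) *\<^sub>R (e2 - e3)"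
proof -
  define d where "d = e2$1 * e3$2 - e2$2 * e3$1"
  have "det G * d\<^sup>2 = bil G e2 e2 * bil G e3 e3 - bil G e2 e3 * bil G e3 e2"
    by (simp add: d_def det_2 bil_def sum_2 power2_eq_square algebra_simps)
  also have "\<dots> = -1" using f by (simp add: lorentz_frame_def)
  finally have "d \<noteq> 0" by auto
  have "d *\<^sub>R x = (x$1 * e3$2 - x$2 * e3$1) *\<^sub>R e2 + (e2$1 * x$2 - e2$2 * x$1) *\<^sub>R e3"
    by (simp add: d_def vec_eq_iff forall_2 algebra_simps)
  then have "x = inverse d *\<^sub>R ((x$1 * e3$2 - x$2 * e3$1) *\<^sub>R e2 + (e2$1 * x$2 - e2$2 * x$1) *\<^sub>R e3)"
    using \<open>d \<noteq> 0\<close> by (metis scaleR_scaleR left_inverse scaleR_one)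
  then obtain a b where x: "x = a *\<^sub>R e2 + b *\<^sub>R e3" by (simp add: scaleR_add_right)
  have "bil G x (e2 - e3) = - a - b" "bil G x (e2 + e3) = b - a"
    using f bil_commute[of G e3 e2] by (auto simp: x lorentz_frame_def bil_simps)
  then have c: "a = - bil G x (e2 - e3) / 2 + - bil G x (e2 + e3) / 2"
    "b = - bil G x (e2 - e3) / 2 - - bil G x (e2 + e3) / 2" by (simp_all add: field_simps)
  have "x = (- bil G x (e2 - e3) / 2 + - bil G x (e2 + e3) / 2) *\<^sub>R e2
      + (- bil G x (e2 - e3) / 2 - - bil G x (e2 + e3) / 2) *\<^sub>R e3"
    using x unfolding c[symmetric] .
  then show ?thesis by (simp only: scaleR_add_left scaleR_diff_left scaleR_add_right scaleR_diff_right) (simp only: algebra_simps)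
qed

lemma lorentz_frame_nondegenerate:
  assumes "lorentz_frame G e2 e3" "\<And>w. bil G x w = bil G y w"
  shows "x = y"
  using lorentz_frame_expansion[OF assms(1), of x] lorentz_frame_expansion[OF assms(1), of y]
  unfolding assms(2) by (rule trans[OF _ sym])

lemma lorentz_frame_invertible:
  assumes "lorentz_frame G e2 e3"
  shows "invertible G"
proof -
  have "x = 0" if "G *v x = 0" for x
  proof (rule lorentz_frame_nondegenerate[OF assms])
    have "bil G x w = bil G w x" for w using assms bil_commute by (simp add: lorentz_frame_def)
    then show "bil G x w = bil G 0 w" for w using that by (simp add: bil_inner)
  qed
  then show ?thesis by (meson invertible_left_inverse matrix_left_invertible_ker)
qed

lemma bil_matrix_inv:
  assumes "lorentz_frame G e2 e3"
  shows "bil G (matrix_inv G *v x) w = x \<bullet> w"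
proof -
  have "G ** matrix_inv G = mat 1"
    using lorentz_frame_invertible[OF assms] unfolding invertible_def matrix_inv_def
    by (rule someI2_ex) blast
  moreover have "bil G (matrix_inv G *v x) w = bil G w (matrix_inv G *v x)"
    using assms bil_commute by (simp add: lorentz_frame_def)
  ultimately show ?thesis
    by (simp add: bil_inner matrix_vector_mul_assoc inner_commute)
qed

text \<open>The inverse metric is \<open>- (e\<^sub>+ \<otimes> e\<^sub>- + e\<^sub>- \<otimes> e\<^sub>+) / 2\<close>.\<close>

lemma matrix_inv_lorentz_frame:
  assumes "lorentz_frame G e2 e3"
  shows "matrix_inv G $ i $ j = - ((e2 + e3)$i * (e2 - e3)$j + (e2 - e3)$i * (e2 + e3)$j) / 2"
proof -
  have "matrix_inv G $ i $ j = (matrix_inv G *v axis j 1) $ i"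
    by (simp add: matrix_vector_mult_basis column_def)
  also have "matrix_inv G *v axis j 1 =
      (- (axis j 1 \<bullet> (e2 - e3)) / 2) *\<^sub>R (e2 + e3) + (- (axis j 1 \<bullet> (e2 + e3)) / 2) *\<^sub>R (e2 - e3)"
    using lorentz_frame_expansion[OF assms, of "matrix_inv G *v axis j 1"]
    unfolding bil_matrix_inv[OF assms] .
  finally show ?thesis by (simp add: inner_axis' field_simps)
qed

lemma has_derivative_bil:
  assumes "(G has_derivative G') (at x)" "(u has_derivative u') (at x)" "(w has_derivative w') (at x)"
  shows "((\<lambda>x. bil (G x) (u x) (w x)) has_derivative
    (\<lambda>h. bil (G' h) (u x) (w x) + bil (G x) (u' h) (w x) + bil (G x) (u x) (w' h))) (at x)"
proof -
  have c: "((\<lambda>x. f x $ i) has_derivative (\<lambda>h. f' h $ i)) (at x)" if "(f has_derivative f') (at x)"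
    for f :: "'a \<Rightarrow> 'b::real_normed_vector ^ 2" and f' i
    by (rule bounded_linear.has_derivative[OF bounded_linear_vec_nth that])
  show ?thesis unfolding bil_def sum_2
    by (rule derivative_eq_intros c assms refl)+ (simp add: algebra_simps)
qed

text \<open>\<open>koszul G D v Y Y' w\<close> is \<open>\<langle>\<nabla>\<^sub>v Y, w\<rangle>\<close> when \<open>D\<close> and \<open>Y'\<close> are the derivatives at a point of
  the Gram matrix and of the components of \<open>Y\<close>.\<close>

definition koszul :: "real^2^2 \<Rightarrow> (real^2 \<Rightarrow> real^2^2) \<Rightarrow> real^2 \<Rightarrow> real^2 \<Rightarrow> (real^2 \<Rightarrow> real^2) \<Rightarrow> real^2 \<Rightarrow> real" where
  "koszul G D v Y Y' w = bil G (Y' v) w + (bil (D v) Y w + bil (D Y) v w - bil (D w) v Y) / 2"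

text \<open>Since \<open>\<nabla>e\<^sub>2 = \<omega> e\<^sub>3\<close> and \<open>\<nabla>e\<^sub>3 = \<omega> e\<^sub>2\<close>, the null fields satisfy \<open>\<nabla>e\<^sub>\<plusminus> = \<plusminus>\<omega> e\<^sub>\<plusminus>\<close>. As the connection
  is torsion free, the covector fields \<open>E\<^sub>\<plusminus> = \<langle>_, e\<^sub>\<plusminus>\<rangle>\<close> satisfy \<open>dE\<^sub>\<plusminus> = \<plusminus>\<omega> \<and> E\<^sub>\<plusminus>\<close>. The left
  sides are the values of \<open>dE\<^sub>+\<close> and \<open>dE\<^sub>-\<close> at \<open>(e\<^sub>+, e\<^sub>-)\<close>.\<close>

lemma null_frame_torsion_free:
  fixes G :: "real^2^2" and D :: "real^2 \<Rightarrow> real^2^2" and e2 e3 :: "real^2"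
  assumes sym: "transpose G = G" "\<And>v. transpose (D v) = D v"
    and lin: "linear D" "linear d2" "linear d3"
    and on: "bil G e2 e2 = -1" "bil G e2 e3 = 0" "bil G e3 e3 = 1"
    and don: "\<And>v. bil (D v) e2 e2 + 2 * bil G (d2 v) e2 = 0"
      "\<And>v. bil (D v) e2 e3 + bil G (d2 v) e3 + bil G e2 (d3 v) = 0"
      "\<And>v. bil (D v) e3 e3 + 2 * bil G (d3 v) e3 = 0"
  defines "ep \<equiv> e2 + e3" and "em \<equiv> e2 - e3"
  defines "\<omega> \<equiv> \<lambda>v. koszul G D v e2 d2 e3"
  shows "(bil (D ep) em ep + bil G em (d2 ep + d3 ep)) - (bil (D em) ep ep + bil G ep (d2 em + d3 em)) = - 2 * \<omega> ep"
    "(bil (D ep) em em + bil G em (d2 ep - d3 ep)) - (bil (D em) ep em + bil G ep (d2 em - d3 em)) = - 2 * \<omega> em"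
proof -
  note c = bil_commute[OF sym(1)] bil_commute[OF sym(2)]
  note L = linear_add[OF lin(1)] linear_add[OF lin(2)] linear_add[OF lin(3)]
    linear_diff[OF lin(1)] linear_diff[OF lin(2)] linear_diff[OF lin(3)]
  have s: "bil (D v) e3 e2 = bil (D v) e2 e3" "bil G e2 (d2 v) = bil G (d2 v) e2" "bil G e3 (d2 v) = bil G (d2 v) e3"
    "bil G e2 (d3 v) = bil G (d3 v) e2" "bil G e3 (d3 v) = bil G (d3 v) e3" for v
    using c by metis+
  have d: "bil (D v) e2 e2 = - 2 * bil G (d2 v) e2" "bil (D v) e3 e3 = - 2 * bil G (d3 v) e3"
    "bil (D v) e2 e3 = - bil G (d2 v) e3 - bil G (d3 v) e2" for v
    using don[of v] s by simp_all
  show "(bil (D ep) em ep + bil G em (d2 ep + d3 ep)) - (bil (D em) ep ep + bil G ep (d2 em + d3 em)) = - 2 * \<omega> ep"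
    "(bil (D ep) em em + bil G em (d2 ep - d3 ep)) - (bil (D em) ep em + bil G ep (d2 em - d3 em)) = - 2 * \<omega> em"
    unfolding ep_def em_def \<omega>_def koszul_def by (simp_all add: L bil_simps s d field_simps)
qed


lemma bounded_linear_axis: "bounded_linear (axis i :: 'b::euclidean_space \<Rightarrow> 'b^2)"
proof -
  have "linear (axis i :: 'b \<Rightarrow> 'b^2)"
    by (rule linearI) (auto simp: vec_eq_iff axis_def)
  then show ?thesis by (simp add: linear_conv_bounded_linear)
qed

lemma has_derivative_vecI:
  fixes f :: "'a::real_normed_vector \<Rightarrow> 'b::euclidean_space^2"
  assumes "\<And>i. ((\<lambda>x. f x $ i) has_derivative (\<lambda>h. f' h $ i)) (at x)"
  shows "(f has_derivative f') (at x)"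
proof -
  have eq: "v = (\<Sum>i\<in>UNIV. axis i (v $ i))" for v :: "'b^2"
    by (simp add: vec_eq_iff sum_2 axis_def forall_2)
  have "((\<lambda>x. \<Sum>i\<in>UNIV. axis i (f x $ i)) has_derivative (\<lambda>h. \<Sum>i\<in>UNIV. axis i (f' h $ i))) (at x)"
    by (intro has_derivative_sum bounded_linear.has_derivative[OF bounded_linear_axis] assms)
  then show ?thesis unfolding eq[symmetric] .
qed

lemma bil_axis_right: "bil M u (axis l 1) = u$1 * M$1$l + u$2 * M$2$l"
  using exhaust_2[of l] by (auto simp: bil_def sum_2 axis_def)

text \<open>The second derivative of the coordinate change enters the transformation of \<open>Y'\<close> and of
  the derivative of the Gram matrix; by its symmetry the two contributions cancel.\<close>

lemma koszul_transform:
  fixes \<phi> :: "real^2 \<Rightarrow> real^2"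
  assumes S: "open S" "x0 \<in> S" and \<phi>: "smooth_on S \<phi>"
    and Gc: "(Gc has_derivative Dc) (at x0)" and Gd: "(Gd has_derivative Dd) (at (\<phi> x0))"
    and Yc: "(Yc has_derivative Yc') (at x0)" and Yd: "(Yd has_derivative Yd') (at (\<phi> x0))"
    and eqG: "\<And>x u w. x \<in> S \<Longrightarrow>
      bil (Gc x) u w = bil (Gd (\<phi> x)) (frechet_derivative \<phi> (at x) u) (frechet_derivative \<phi> (at x) w)"
    and eqY: "\<And>x. x \<in> S \<Longrightarrow> Yd (\<phi> x) = frechet_derivative \<phi> (at x) (Yc x)"
    and sym: "transpose (Gd (\<phi> x0)) = Gd (\<phi> x0)"
  defines "J \<equiv> frechet_derivative \<phi> (at x0)"
  shows "koszul (Gd (\<phi> x0)) Dd (J v) (J (Yc x0)) Yd' (J w) = koszul (Gc x0) Dc v (Yc x0) Yc' w"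
proof -
  define h where "h i = frechet_derivative (\<lambda>x. frechet_derivative \<phi> (at x) (axis i 1)) (at x0)" for i :: 2
  define K where "K v u = u$1 *\<^sub>R h 1 v + u$2 *\<^sub>R h 2 v" for v u :: "real^2"
  have lin: "linear (frechet_derivative \<phi> (at x))" if "x \<in> S" for x
    by (rule frechet_derivative_linear[OF smooth_on_differentiable[OF \<phi> that]])
  have hd: "((\<lambda>x. frechet_derivative \<phi> (at x) (axis i 1)) has_derivative h i) (at x0)" for i
    unfolding h_def by (rule smooth_on_has_derivative[OF smooth_on_frechet_derivative[OF \<phi>] S(2)])
  have hlin: "linear (h i)" for i using has_derivative_linear[OF hd] .
  have hsym: "h 1 (axis 2 1) = h 2 (axis 1 1)"
    unfolding h_def by (rule frechet_derivative_commute[OF S \<phi>])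
  have Ksym: "K u v = K v u" for u v
    unfolding K_def using linear_real_2[OF hlin, of 1 u] linear_real_2[OF hlin, of 2 u]
      linear_real_2[OF hlin, of 1 v] linear_real_2[OF hlin, of 2 v] hsym
    by (simp add: algebra_simps)
  have jac: "((\<lambda>x. frechet_derivative \<phi> (at x) (a x)) has_derivative (\<lambda>v. K v (a x0) + J (a' v))) (at x0)"
    if a: "(a has_derivative a') (at x0)" for a a'
  proof -
    have c: "((\<lambda>x. a x $ i) has_derivative (\<lambda>h. a' h $ i)) (at x0)" for i
      by (rule bounded_linear.has_derivative[OF bounded_linear_vec_nth a])
    have "((\<lambda>x. a x $ 1 *\<^sub>R frechet_derivative \<phi> (at x) (axis 1 1) + a x $ 2 *\<^sub>R frechet_derivative \<phi> (at x) (axis 2 1))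
       has_derivative (\<lambda>v. K v (a x0) + J (a' v))) (at x0)"
      by (rule derivative_eq_intros hd c refl)+
        (simp add: K_def J_def linear_real_2[OF lin[OF S(2)], of "a' _"] algebra_simps)
    then show ?thesis
      by (rule has_derivative_cong_open[OF _ S]) (simp add: linear_real_2[OF lin, symmetric])
  qed
  have dG: "bil (Dc v) u w = bil (Dd (J v)) (J u) (J w) + bil (Gd (\<phi> x0)) (K v u) (J w) + bil (Gd (\<phi> x0)) (J u) (K v w)"
    for v u w
  proof -
    have k: "((\<lambda>x. frechet_derivative \<phi> (at x) u) has_derivative (\<lambda>v. K v u)) (at x0)" for u
      using jac[OF has_derivative_const[of u]] linear_0[OF lin[OF S(2)]] by (simp add: J_def)
    have "((\<lambda>x. Gd (\<phi> x)) has_derivative (\<lambda>v. Dd (J v))) (at x0)"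
      unfolding J_def by (rule has_derivative_compose[OF smooth_on_has_derivative[OF \<phi> S(2)] Gd])
    from has_derivative_bil[OF this k[of u] k[of w]]
    have 1: "((\<lambda>x. bil (Gc x) u w) has_derivative (\<lambda>v. bil (Dd (J v)) (J u) (J w)
        + bil (Gd (\<phi> x0)) (K v u) (J w) + bil (Gd (\<phi> x0)) (J u) (K v w))) (at x0)"
      unfolding J_def by (rule has_derivative_cong_open[OF _ S]) (simp add: eqG)
    have 2: "((\<lambda>x. bil (Gc x) u w) has_derivative (\<lambda>v. bil (Dc v) u w)) (at x0)"
      using has_derivative_bil[OF Gc has_derivative_const has_derivative_const, of u w]
      by (simp add: bil_def)
    show ?thesis using has_derivative_unique[OF 2 1] by metis
  qed
  have Y': "Yd' (J v) = K v (Yc x0) + J (Yc' v)" for v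
  proof -
    have 1: "((\<lambda>x. Yd (\<phi> x)) has_derivative (\<lambda>v. Yd' (J v))) (at x0)"
      unfolding J_def by (rule has_derivative_compose[OF smooth_on_has_derivative[OF \<phi> S(2)] Yd])
    have 2: "((\<lambda>x. Yd (\<phi> x)) has_derivative (\<lambda>v. K v (Yc x0) + J (Yc' v))) (at x0)"
      by (rule has_derivative_cong_open[OF jac[OF Yc] S]) (simp add: eqY)
    show ?thesis using has_derivative_unique[OF 1 2] by metis
  qed
  have g0: "bil (Gc x0) u w = bil (Gd (\<phi> x0)) (J u) (J w)" for u w
    unfolding J_def by (rule eqG[OF S(2)])
  note c = bil_commute[OF sym]
  show ?thesis
    unfolding koszul_def Y' dG g0 bil_simps
    using Ksym[of v "Yc x0"] Ksym[of w "Yc x0"] Ksym[of v w]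
      c[of "J (Yc x0)" "K v w"] c[of "J v" "K w (Yc x0)"]
    by (simp add: field_simps)
qed

section \<open>Charts, tangent vectors and the metric\<close>

locale lorentz_surface =
  fixes A :: "'m::topological_space chart set" and g :: "'m metric"
  assumes atlas: "smooth_atlas A" and metric: "lorentzian_metric A g"
begin

definition around :: "'m chart \<Rightarrow> 'm \<Rightarrow> bool" where
  "around c p \<longleftrightarrow> c \<in> A \<and> p \<in> cdom c"

lemma chart_homeomorphism: "c \<in> A \<Longrightarrow> homeomorphism (cdom c) (crd c ` cdom c) (crd c) (icrd c)"
  and chart_open_domain: "c \<in> A \<Longrightarrow> open (cdom c)"
  and chart_open_range: "c \<in> A \<Longrightarrow> open (crd c ` cdom c)"
  and chart_transition: "c \<in> A \<Longrightarrow> d \<in> A \<Longrightarrow> smooth_on (crd c ` (cdom c \<inter> cdom d)) (crd d \<circ> icrd c)"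
  using atlas unfolding smooth_atlas_def by blast+

lemma exists_chart: "\<exists>c. around c p"
  using atlas unfolding smooth_atlas_def around_def by (metis UNIV_I UN_E)

lemma around_chart_at: "around (chart_at A p) p"
  using someI_ex[OF exists_chart[of p]] unfolding chart_at_def around_def .

lemma icrd_crd [simp]: "around c p \<Longrightarrow> icrd c (crd c p) = p"
  using chart_homeomorphism homeomorphism_apply1 unfolding around_def by blast

lemma open_chart_image: "c \<in> A \<Longrightarrow> open U \<Longrightarrow> open (crd c ` (U \<inter> cdom c))"
proof -
  assume c: "c \<in> A" "open U"
  have "openin (top_of_set (cdom c)) (U \<inter> cdom c)" using c(2) by (auto simp: openin_open)
  from homeomorphism_imp_open_map[OF chart_homeomorphism[OF c(1)] this]
  show ?thesis using openin_open_trans chart_open_range[OF c(1)] by blast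
qed

lemma chart_image:
  assumes c: "c \<in> A" and x: "x \<in> crd c ` (U \<inter> cdom c)"
  shows "around c (icrd c x) \<and> icrd c x \<in> U \<and> crd c (icrd c x) = x"
proof -
  obtain y where y: "y \<in> U" "y \<in> cdom c" "x = crd c y" using x by blast
  then have "around c y" using c by (simp add: around_def)
  with y show ?thesis by simp
qed

lemma chart_image': "c \<in> A \<Longrightarrow> x \<in> crd c ` cdom c \<Longrightarrow> around c (icrd c x) \<and> crd c (icrd c x) = x"
  using chart_image[of c x UNIV] by simp

lemma crd_in: "around c p \<Longrightarrow> p \<in> U \<Longrightarrow> crd c p \<in> crd c ` (U \<inter> cdom c)"
  unfolding around_def by blast

definition jac :: "'m chart \<Rightarrow> 'm chart \<Rightarrow> 'm \<Rightarrow> real^2 \<Rightarrow> real^2" where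
  "jac c d p = frechet_derivative (crd d \<circ> icrd c) (at (crd c p))"

lemma transition_derivative:
  "around c p \<Longrightarrow> around d p \<Longrightarrow> ((\<lambda>x. crd d (icrd c x)) has_derivative jac c d p) (at (crd c p))"
  unfolding jac_def using smooth_on_has_derivative[OF chart_transition, of c d "crd c p"]
  unfolding around_def by (auto simp: o_def)

lemma linear_jac: "around c p \<Longrightarrow> around d p \<Longrightarrow> linear (jac c d p)"
  using has_derivative_linear[OF transition_derivative] .

lemma has_derivative_chart_change:
  assumes c: "around c p" and d: "around d p" and f: "((\<lambda>x. f (icrd c x)) has_derivative D) (at (crd c p))"
  shows "((\<lambda>x. f (icrd d x)) has_derivative (\<lambda>u. D (jac d c p u))) (at (crd d p))"
proof -
  have 1: "((\<lambda>x. f (icrd c (crd c (icrd d x)))) has_derivative (\<lambda>u. D (jac d c p u))) (at (crd d p))"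
    using has_derivative_compose[OF transition_derivative[OF d c], of "\<lambda>x. f (icrd c x)" D] f d by simp
  have 2: "open (crd d ` (cdom c \<inter> cdom d))"
    using c d open_chart_image chart_open_domain unfolding around_def by blast
  have 3: "f (icrd c (crd c (icrd d x))) = f (icrd d x)" if "x \<in> crd d ` (cdom c \<inter> cdom d)" for x
  proof -
    have "around c (icrd d x)" using chart_image[OF _ that] c d by (auto simp: around_def)
    then show ?thesis by simp
  qed
  show ?thesis
    by (rule has_derivative_cong_open[OF 1 2 crd_in[OF d]]) (use c 3 in \<open>auto simp: around_def\<close>)
qed

lemma jac_comp:
  assumes "around c p" "around d p" "around e p"
  shows "jac d e p (jac c d p u) = jac c e p u"
  using has_derivative_unique[OF has_derivative_chart_change[OF assms(2,1) transition_derivative[OF assms(2,3)]]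
      transition_derivative[OF assms(1,3)]] by metis

lemma jac_refl: "around c p \<Longrightarrow> jac c c p u = u"
proof -
  assume c: "around c p"
  have "((\<lambda>x. x) has_derivative (\<lambda>u. u)) (at (crd c p))" by (rule has_derivative_ident)
  then have "((\<lambda>x. crd c (icrd c x)) has_derivative (\<lambda>u. u)) (at (crd c p))"
    by (rule has_derivative_cong_open[where S="crd c ` cdom c"])
      (use c chart_open_range chart_image' in \<open>auto simp: around_def\<close>)
  then show ?thesis using has_derivative_unique[OF transition_derivative[OF c c]] by metis
qed

text \<open>The tangent vector with the components \<open>u\<close> in the chart \<open>c\<close>.\<close>

definition tvec :: "'m chart \<Rightarrow> 'm \<Rightarrow> real^2 \<Rightarrow> 'm tangent" where
  "tvec c p u = (\<lambda>d. if around d p then jac c d p u else 0)"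

lemma coord_vec_eq: "coord_vec A c p i = tvec c p (axis i 1)"
  by (simp add: coord_vec_def tvec_def around_def jac_def fun_eq_iff)

lemma tvec_self [simp]: "around c p \<Longrightarrow> tvec c p u c = u"
  by (simp add: tvec_def jac_refl)

lemma tangent_space_eq: "tangent_space A p =
    {v. (\<forall>c d. around c p \<and> around d p \<longrightarrow> v d = jac c d p (v c)) \<and> (\<forall>c. \<not> around c p \<longrightarrow> v c = 0)}"
  unfolding tangent_space_def jac_def around_def by blast

lemma tvec_tangent [simp]: "around c p \<Longrightarrow> tvec c p u \<in> tangent_space A p"
  by (auto simp: tangent_space_eq tvec_def jac_comp)

lemma tangent_jac: "v \<in> tangent_space A p \<Longrightarrow> around c p \<Longrightarrow> around d p \<Longrightarrow> v d = jac c d p (v c)"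
  unfolding tangent_space_eq by blast

lemma tangent_eq_tvec:
  assumes v: "v \<in> tangent_space A p" and c: "around c p"
  shows "v = tvec c p (v c)"
proof
  fix d show "v d = tvec c p (v c) d"
  proof (cases "around d p")
    case True then show ?thesis using tangent_jac[OF v c True] by (simp add: tvec_def)
  next
    case False
    then have "v d = 0" using v unfolding tangent_space_eq by blast
    then show ?thesis using False by (simp add: tvec_def)
  qed
qed

lemma lincomb_tvec: "around c p \<Longrightarrow> lincomb a (tvec c p u) b (tvec c p w) = tvec c p (a *\<^sub>R u + b *\<^sub>R w)"
  by (auto simp: lincomb_def tvec_def fun_eq_iff linear_add[OF linear_jac] linear_scale[OF linear_jac])

lemma metric_lincomb:
  assumes "v \<in> tangent_space A p" "w \<in> tangent_space A p" "u \<in> tangent_space A p"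
  shows "g p (lincomb a v b w) u = a * g p v u + b * g p w u"
  using metric assms unfolding lorentzian_metric_def by blast

lemma metric_commute:
  "v \<in> tangent_space A p \<Longrightarrow> w \<in> tangent_space A p \<Longrightarrow> g p v w = g p w v"
  using metric unfolding lorentzian_metric_def by blast

lemma metric_bil:
  assumes c: "around c p" and v: "v \<in> tangent_space A p" and w: "w \<in> tangent_space A p"
  shows "g p v w = bil (gram A g c p) (v c) (w c)"
proof -
  let ?e = "\<lambda>i. tvec c p (axis i 1)"
  have e: "u = lincomb (u c $ 1) (?e 1) (u c $ 2) (?e 2)" if "u \<in> tangent_space A p" for u
    unfolding lincomb_tvec[OF c] real_2_eq[symmetric] by (rule tangent_eq_tvec[OF that c])
  have "g p v w = v c $ 1 * g p (?e 1) w + v c $ 2 * g p (?e 2) w"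
    by (subst e[OF v]) (simp add: metric_lincomb c w)
  moreover have "g p (?e i) w = w c $ 1 * g p (?e i) (?e 1) + w c $ 2 * g p (?e i) (?e 2)" for i
  proof -
    have "g p (?e i) w = g p w (?e i)" using metric_commute c w by simp
    also have "\<dots> = w c $ 1 * g p (?e 1) (?e i) + w c $ 2 * g p (?e 2) (?e i)"
      by (subst e[OF w]) (simp add: metric_lincomb c)
    finally show ?thesis using metric_commute c by simp
  qed
  ultimately show ?thesis
    by (simp add: bil_def sum_2 gram_def coord_vec_eq algebra_simps)
qed

lemma gram_sym: "around c p \<Longrightarrow> transpose (gram A g c p) = gram A g c p"
  by (simp add: transpose_def gram_def vec_eq_iff coord_vec_eq metric_commute)

lemma lorentz_frame_gram:
  assumes "around c p" "v \<in> tangent_space A p" "w \<in> tangent_space A p" "g p v v = -1" "g p v w = 0" "g p w w = 1"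
  shows "lorentz_frame (gram A g c p) (v c) (w c)"
  using assms by (simp add: lorentz_frame_def gram_sym flip: metric_bil)

lemma exists_lorentz_frame: "around c p \<Longrightarrow> \<exists>e2 e3. lorentz_frame (gram A g c p) e2 e3"
  using metric lorentz_frame_gram unfolding lorentzian_metric_def by meson

lemma bil_gram_jac:
  assumes c: "around c p" and d: "around d p"
  shows "bil (gram A g c p) u w = bil (gram A g d p) (jac c d p u) (jac c d p w)"
  using metric_bil[OF c tvec_tangent[OF c] tvec_tangent[OF c], of u w]
    metric_bil[OF d tvec_tangent[OF c] tvec_tangent[OF c], of u w] c d
  by (simp add: tvec_def jac_refl)

lemma differential_chart:
  assumes c: "around c p" and f: "((\<lambda>x. f (icrd c x)) has_derivative D) (at (crd c p))"
    and v: "v \<in> tangent_space A p"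
  shows "differential A f p v = D (v c)"
proof -
  let ?d = "chart_at A p"
  have d: "around ?d p" by (rule around_chart_at)
  have "frechet_derivative (f \<circ> icrd ?d) (at (crd ?d p)) = (\<lambda>u. D (jac ?d c p u))"
    using frechet_derivative_eqI[OF has_derivative_chart_change[OF c d f]] by (simp add: o_def)
  then show ?thesis using tangent_jac[OF v d c] by (simp add: differential_def Let_def)
qed

definition dgram :: "'m chart \<Rightarrow> 'm \<Rightarrow> real^2 \<Rightarrow> real^2^2" where
  "dgram c p v = (\<chi> i j. frechet_derivative (\<lambda>x. gram A g c (icrd c x) $ i $ j) (at (crd c p)) v)"

lemma smooth_gram: "c \<in> A \<Longrightarrow> smooth_on (crd c ` cdom c) (\<lambda>x. gram A g c (icrd c x) $ i $ j)"
  using metric unfolding lorentzian_metric_def by blast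

lemma gram_derivative:
  assumes "around c p"
  shows "((\<lambda>x. gram A g c (icrd c x)) has_derivative dgram c p) (at (crd c p))"
  by (intro has_derivative_vecI)
    (use assms smooth_on_has_derivative[OF smooth_gram] in \<open>auto simp: dgram_def around_def\<close>)

lemma linear_dgram: "around c p \<Longrightarrow> linear (dgram c p)"
  using has_derivative_linear[OF gram_derivative] .

lemma dgram_sym: "around c p \<Longrightarrow> transpose (dgram c p v) = dgram c p v"
proof -
  assume c: "around c p"
  have 1: "((\<lambda>x. gram A g c (icrd c x) $ i $ j) has_derivative (\<lambda>v. dgram c p v $ i $ j)) (at (crd c p))" for i j
    by (intro bounded_linear.has_derivative[OF bounded_linear_vec_nth] gram_derivative c)
  have "gram A g c (icrd c x) $ i $ j = gram A g c (icrd c x) $ j $ i" if "x \<in> crd c ` cdom c" for x i j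
    using arg_cong[OF gram_sym[of c "icrd c x"], of "\<lambda>M. M $ i $ j"] that c chart_image'[of c x]
    by (simp add: transpose_def around_def)
  then have "((\<lambda>x. gram A g c (icrd c x) $ i $ j) has_derivative (\<lambda>v. dgram c p v $ j $ i)) (at (crd c p))" for i j
    by (intro has_derivative_cong_open[OF 1 chart_open_range]) (use c in \<open>auto simp: around_def\<close>)
  from has_derivative_unique[OF this 1] have "dgram c p v $ j $ i = dgram c p v $ i $ j" for i j by metis
  then show ?thesis by (simp add: transpose_def vec_eq_iff)
qed

text \<open>The Christoffel symbols are the part of the Koszul expression that comes from the metric, with the
  last index raised.\<close>

lemma levi_civita_koszul:
  assumes c: "around c p" and Y: "((\<lambda>x. Y (icrd c x) c) has_derivative Y') (at (crd c p))"
  shows "bil (gram A g c p) (levi_civita A g p v Y c) w = koszul (gram A g c p) (dgram c p) (v c) (Y p c) Y' w"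
proof -
  let ?G = "gram A g c p" and ?D = "dgram c p"
  obtain e2 e3 where f: "lorentz_frame ?G e2 e3" using exists_lorentz_frame[OF c] by blast
  define k where "k = (\<chi> l. (bil (?D (v c)) (Y p c) (axis l 1) + bil (?D (Y p c)) (v c) (axis l 1)
      - bil (?D (axis l 1)) (v c) (Y p c)) / 2)"
  have D: "?D u $ i $ j = u$1 * ?D (axis 1 1) $ i $ j + u$2 * ?D (axis 2 1) $ i $ j" for u i j
    using arg_cong[OF linear_real_2[OF linear_dgram[OF c], of u], of "\<lambda>M. M $ i $ j"] by simp
  have Dd: "frechet_derivative (\<lambda>x. gram A g c (icrd c x) $ i $ j) (at (crd c p)) (axis l 1) = ?D (axis l 1) $ i $ j" for i j l
    by (simp add: dgram_def)
  have ax: "axis 1 (1::real) $ (1::2) = 1" "axis 1 (1::real) $ (2::2) = 0"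
    "axis 2 (1::real) $ (1::2) = 0" "axis 2 (1::real) $ (2::2) = 1" by (simp_all add: axis_def)
  have s: "?D u $ 2 $ 1 = ?D u $ 1 $ 2" for u
    using arg_cong[OF dgram_sym[OF c, of u], of "\<lambda>M. M $ 1 $ 2"] by (simp add: transpose_def)
  have "levi_civita A g p v Y c = Y' (v c) + matrix_inv ?G *v k"
    unfolding levi_civita_def frechet_derivative_eqI[OF Y]
    using c D[of "v c"] D[of "Y p c"] s[of "axis 1 1"] s[of "axis 2 1"]
    by (simp add: around_def christoffel_def Let_def Dd vec_eq_iff matrix_vector_mult_def sum_2
        k_def bil_axis_right bil_def[of "?D (axis _ 1)"] field_simps)
  moreover have "k \<bullet> w = (bil (?D (v c)) (Y p c) w + bil (?D (Y p c)) (v c) w - bil (?D w) (v c) (Y p c)) / 2"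
    using D[of w] by (simp add: inner_vec_def sum_2 k_def bil_def ax field_simps)
  ultimately show ?thesis
    by (simp add: bil_simps bil_matrix_inv[OF f] koszul_def)
qed

text \<open>This is what gives \<open>g p (levi_civita A g p v Y) w\<close> a meaning, the metric being bilinear only on
  the tangent spaces. By nondegeneracy it is enough that the Koszul expressions in two charts
  correspond.\<close>

lemma levi_civita_tangent:
  assumes U: "open U" "p \<in> U" and Y: "smooth_vector_field_on A U Y" and v: "v \<in> tangent_space A p"
  shows "levi_civita A g p v Y \<in> tangent_space A p"
proof -
  have "levi_civita A g p v Y d = jac c d p (levi_civita A g p v Y c)" if c: "around c p" and d: "around d p" for c d
  proof -
    let ?L = "levi_civita A g p v Y"
    let ?S = "crd c ` (U \<inter> cdom d \<inter> cdom c)"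
    have dY: "((\<lambda>x. Y (icrd e x) e) has_derivative frechet_derivative (\<lambda>x. Y (icrd e x) e) (at (crd e p))) (at (crd e p))"
      if "around e p" for e
      using that Y crd_in[OF that U(2)] smooth_on_has_derivative unfolding smooth_vector_field_on_def around_def by blast
    have S: "open ?S" "crd c p \<in> ?S"
      using c d U by (auto intro!: open_chart_image open_Int chart_open_domain simp: around_def)
    have T: "around c (icrd c x) \<and> around d (icrd c x) \<and> crd c (icrd c x) = x \<and> icrd c x \<in> U" if "x \<in> ?S" for x
      using that c d chart_image[of c x "U \<inter> cdom d"] unfolding around_def by auto
    have J: "frechet_derivative (crd d \<circ> icrd c) (at x) = jac c d (icrd c x)" if "x \<in> ?S" for x
      using T[OF that] by (simp add: jac_def)
    have sm: "smooth_on ?S (crd d \<circ> icrd c)"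
      by (rule smooth_on_mono[OF _ chart_transition]) (use c d in \<open>auto simp: around_def\<close>)
    have x0: "(crd d \<circ> icrd c) (crd c p) = crd d p" using c by simp
    have "koszul (gram A g d (icrd d ((crd d \<circ> icrd c) (crd c p)))) (dgram d p)
         (jac c d (icrd c (crd c p)) (v c)) (jac c d (icrd c (crd c p)) (Y (icrd c (crd c p)) c))
         (frechet_derivative (\<lambda>x. Y (icrd d x) d) (at (crd d p))) (jac c d (icrd c (crd c p)) w)
       = koszul (gram A g c (icrd c (crd c p))) (dgram c p) (v c) (Y (icrd c (crd c p)) c)
         (frechet_derivative (\<lambda>x. Y (icrd c x) c) (at (crd c p))) w" for w
      unfolding J[OF S(2), symmetric]
    proof (rule koszul_transform[OF S sm gram_derivative[OF c] _ dY[OF c]])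
      show "((\<lambda>x. gram A g d (icrd d x)) has_derivative dgram d p) (at ((crd d \<circ> icrd c) (crd c p)))"
        unfolding x0 by (rule gram_derivative[OF d])
      show "((\<lambda>x. Y (icrd d x) d) has_derivative frechet_derivative (\<lambda>x. Y (icrd d x) d) (at (crd d p)))
          (at ((crd d \<circ> icrd c) (crd c p)))"
        unfolding x0 by (rule dY[OF d])
      show "bil (gram A g c (icrd c x)) u w = bil (gram A g d (icrd d ((crd d \<circ> icrd c) x)))
          (frechet_derivative (crd d \<circ> icrd c) (at x) u) (frechet_derivative (crd d \<circ> icrd c) (at x) w)" if "x \<in> ?S" for x u w
        using T[OF that] bil_gram_jac[of c "icrd c x" d u w] by (simp add: J[OF that])
      show "Y (icrd d ((crd d \<circ> icrd c) x)) d = frechet_derivative (crd d \<circ> icrd c) (at x) (Y (icrd c x) c)" if "x \<in> ?S" for x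
        using T[OF that] tangent_jac[of "Y (icrd c x)" "icrd c x" c d] Y
        by (simp add: J[OF that] smooth_vector_field_on_def)
      show "transpose (gram A g d (icrd d ((crd d \<circ> icrd c) (crd c p)))) = gram A g d (icrd d ((crd d \<circ> icrd c) (crd c p)))"
        using c d by (simp add: gram_sym)
    qed
    then have k: "bil (gram A g d p) (?L d) (jac c d p w) = bil (gram A g c p) (?L c) w" for w
      using c d levi_civita_koszul[where Y=Y, OF c dY[OF c]] levi_civita_koszul[where Y=Y, OF d dY[OF d]]
        tangent_jac[OF v c d] tangent_jac[of "Y p" p c d] Y U by (simp add: smooth_vector_field_on_def)
    obtain e2 e3 where f: "lorentz_frame (gram A g d p) e2 e3" using exists_lorentz_frame[OF d] by blast
    show ?thesis
    proof (rule lorentz_frame_nondegenerate[OF f])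
      fix w
      have w: "w = jac c d p (jac d c p w)" using jac_comp[OF d c d, of w] jac_refl[OF d] by simp
      show "bil (gram A g d p) (?L d) w = bil (gram A g d p) (jac c d p (?L c)) w"
        using k[of "jac d c p w"] bil_gram_jac[OF c d, of "?L c" "jac d c p w"] w by simp
    qed
  qed
  moreover have "levi_civita A g p v Y c = 0" if "\<not> around c p" for c
    using that by (auto simp: levi_civita_def around_def)
  ultimately show ?thesis by (auto simp: tangent_space_eq)
qed

end


section \<open>The one-form of a spinor field in a chart\<close>

text \<open>The coordinate expressions of the metric, of an orthonormal frame and of a spinor in this frame,
  with their derivatives at \<open>x0\<close>. The one-form \<open>form\<close> below takes the null fields \<open>e\<^sub>2 + e\<^sub>3\<close> and
  \<open>e\<^sub>2 - e\<^sub>3\<close> to the squares of the two components, and \<open>dform v u\<close> is the derivative of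
  \<open>form x u\<close> in the direction \<open>v\<close>.\<close>

locale spinor_chart =
  fixes O1 :: "(real^2) set" and x0 :: "real^2"
    and G :: "real^2 \<Rightarrow> real^2^2" and e2 e3 :: "real^2 \<Rightarrow> real^2" and z1 z2 :: "real^2 \<Rightarrow> complex"
    and D :: "real^2 \<Rightarrow> real^2^2" and d2 d3 :: "real^2 \<Rightarrow> real^2" and a1 a2 :: "real^2 \<Rightarrow> complex"
  assumes dom: "open O1" "x0 \<in> O1"
    and frame: "\<And>x. x \<in> O1 \<Longrightarrow> lorentz_frame (G x) (e2 x) (e3 x)"
    and dG: "(G has_derivative D) (at x0)" and D_sym: "\<And>v. transpose (D v) = D v"
    and de2: "(e2 has_derivative d2) (at x0)" and de3: "(e3 has_derivative d3) (at x0)"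
    and dz1: "(z1 has_derivative a1) (at x0)" and dz2: "(z2 has_derivative a2) (at x0)"
begin

definition form :: "real^2 \<Rightarrow> real^2 \<Rightarrow> real^3" where
  "form x u = (-1/2) *\<^sub>R (bil (G x) u (e2 x - e3 x) *\<^sub>R spin_prod (z1 x) (z1 x)
     + bil (G x) u (e2 x + e3 x) *\<^sub>R spin_prod (z2 x) (z2 x))"

definition dform :: "real^2 \<Rightarrow> real^2 \<Rightarrow> real^3" where
  "dform v u = (-1/2) *\<^sub>R
     ((bil (D v) u (e2 x0 - e3 x0) + bil (G x0) u (d2 v - d3 v)) *\<^sub>R spin_prod (z1 x0) (z1 x0)
      + (2 * bil (G x0) u (e2 x0 - e3 x0)) *\<^sub>R spin_prod (z1 x0) (a1 v)
      + ((bil (D v) u (e2 x0 + e3 x0) + bil (G x0) u (d2 v + d3 v)) *\<^sub>R spin_prod (z2 x0) (z2 x0)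
      + (2 * bil (G x0) u (e2 x0 + e3 x0)) *\<^sub>R spin_prod (z2 x0) (a2 v)))"

text \<open>The connection form \<open>v \<mapsto> \<langle>\<nabla>\<^sub>v e\<^sub>2, e\<^sub>3\<rangle>\<close>.\<close>

definition om :: "real^2 \<Rightarrow> real" where
  "om v = koszul (G x0) D v (e2 x0) d2 (e3 x0)"

abbreviation "ep \<equiv> e2 x0 + e3 x0"
abbreviation "em \<equiv> e2 x0 - e3 x0"

text \<open>The covariant derivatives of the first component along \<open>e\<^sub>2 - e\<^sub>3\<close> and of the second along
  \<open>e\<^sub>2 + e\<^sub>3\<close>, the two that occur in the Dirac operator.\<close>

definition nabla_minus :: complex where
  "nabla_minus = a1 em - (om em / 2) *\<^sub>R z1 x0"

definition nabla_plus :: complex where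
  "nabla_plus = a2 ep + (om ep / 2) *\<^sub>R z2 x0"

lemma bil_derivative:
  assumes "(w has_derivative w') (at x0)"
  shows "((\<lambda>x. bil (G x) u (w x)) has_derivative (\<lambda>v. bil (D v) u (w x0) + bil (G x0) u (w' v))) (at x0)"
  using has_derivative_bil[OF dG has_derivative_const[of u] assms] by (simp add: bil_def)

lemma square_derivative:
  assumes "(z has_derivative a) (at x0)"
  shows "((\<lambda>x. spin_prod (z x) (z x)) has_derivative (\<lambda>v. 2 *\<^sub>R spin_prod (z x0) (a v))) (at x0)"
  using bounded_bilinear.FDERIV[OF bounded_bilinear_spin_prod assms assms]
  by (rule has_derivative_eq_rhs) (simp add: spin_prod_commute[of "a _"] scaleR_2)

lemma form_derivative: "((\<lambda>x. form x u) has_derivative (\<lambda>v. dform v u)) (at x0)"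
  unfolding form_def dform_def
  by (rule derivative_eq_intros bil_derivative square_derivative de2 de3 dz1 dz2 refl)+
    (simp add: algebra_simps)

lemma bilinear_dform: "linear (\<lambda>v. dform v u)" "linear (\<lambda>u. dform v u)"
proof -
  show "linear (\<lambda>v. dform v u)" using has_derivative_linear[OF form_derivative] .
  show "linear (\<lambda>u. dform v u)"
    by (rule linearI) (simp_all add: dform_def bil_simps algebra_simps)
qed

lemma orthonormal_derivative:
  shows "bil (D v) (e2 x0) (e2 x0) + 2 * bil (G x0) (d2 v) (e2 x0) = 0"
    "bil (D v) (e2 x0) (e3 x0) + bil (G x0) (d2 v) (e3 x0) + bil (G x0) (e2 x0) (d3 v) = 0"
    "bil (D v) (e3 x0) (e3 x0) + 2 * bil (G x0) (d3 v) (e3 x0) = 0"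
proof -
  have zero: "bil (D v) (u x0) (w x0) + bil (G x0) (u' v) (w x0) + bil (G x0) (u x0) (w' v) = 0"
    if "(u has_derivative u') (at x0)" "(w has_derivative w') (at x0)" "\<And>x. x \<in> O1 \<Longrightarrow> bil (G x) (u x) (w x) = k"
    for u u' w w' k
  proof -
    have "((\<lambda>x. bil (G x) (u x) (w x)) has_derivative (\<lambda>v. 0)) (at x0)"
      by (rule has_derivative_cong_open[OF has_derivative_const[of k] dom]) (simp add: that(3))
    from has_derivative_unique[OF has_derivative_bil[OF dG that(1,2)] this] show ?thesis by metis
  qed
  have c: "bil (G x0) u w = bil (G x0) w u" for u w
    using bil_commute frame[OF dom(2)] by (simp add: lorentz_frame_def)
  show "bil (D v) (e2 x0) (e2 x0) + 2 * bil (G x0) (d2 v) (e2 x0) = 0"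
    using zero[OF de2 de2, of "-1"] frame c[of "e2 x0" "d2 v"] by (simp add: lorentz_frame_def)
  show "bil (D v) (e3 x0) (e3 x0) + 2 * bil (G x0) (d3 v) (e3 x0) = 0"
    using zero[OF de3 de3, of "1"] frame c[of "e3 x0" "d3 v"] by (simp add: lorentz_frame_def)
  show "bil (D v) (e2 x0) (e3 x0) + bil (G x0) (d2 v) (e3 x0) + bil (G x0) (e2 x0) (d3 v) = 0"
    using zero[OF de2 de3, of "0"] frame by (simp add: lorentz_frame_def)
qed

text \<open>The connection form enters through the exterior derivatives of the two covector fields, by
  \<open>null_frame_torsion_free\<close>; it completes the derivatives of the components to covariant ones.\<close>

lemma curl_dform:
  "dform ep em - dform em ep = 2 *\<^sub>R spin_prod (z2 x0) nabla_plus - 2 *\<^sub>R spin_prod (z1 x0) nabla_minus"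
proof -
  let ?G = "G x0"
  have f: "lorentz_frame ?G (e2 x0) (e3 x0)" by (rule frame[OF dom(2)])
  note n = lorentz_frame_null[OF f]
  have s: "transpose ?G = ?G" "bil ?G (e2 x0) (e2 x0) = -1" "bil ?G (e2 x0) (e3 x0) = 0" "bil ?G (e3 x0) (e3 x0) = 1"
    using f by (simp_all add: lorentz_frame_def)
  note t = null_frame_torsion_free[OF s(1) D_sym has_derivative_linear[OF dG] has_derivative_linear[OF de2]
      has_derivative_linear[OF de3] s(2-4) orthonormal_derivative, folded om_def]
  define p q where "p = bil (D ep) em ep + bil ?G em (d2 ep + d3 ep)" and "q = bil (D em) ep ep + bil ?G ep (d2 em + d3 em)"
  define r k where "r = bil (D ep) em em + bil ?G em (d2 ep - d3 ep)" and "k = bil (D em) ep em + bil ?G ep (d2 em - d3 em)"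
  have pq: "p = q - 2 * om ep" and rk: "r = k - 2 * om em"
    using t unfolding p_def q_def r_def k_def by linarith+
  have 1: "dform ep em = (-1/2) *\<^sub>R (r *\<^sub>R spin_prod (z1 x0) (z1 x0) + p *\<^sub>R spin_prod (z2 x0) (z2 x0)
      - 4 *\<^sub>R spin_prod (z2 x0) (a2 ep))"
    unfolding dform_def p_def[symmetric] r_def[symmetric] n by (simp add: algebra_simps)
  have 2: "dform em ep = (-1/2) *\<^sub>R (k *\<^sub>R spin_prod (z1 x0) (z1 x0) + q *\<^sub>R spin_prod (z2 x0) (z2 x0)
      - 4 *\<^sub>R spin_prod (z1 x0) (a1 em))"
    unfolding dform_def q_def[symmetric] k_def[symmetric] n by (simp add: algebra_simps)
  show ?thesis
    unfolding 1 2 pq rk nabla_plus_def nabla_minus_def spin_prod_simps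
    by (simp add: vec_eq_iff algebra_simps)
qed

lemma normal_dform:
  defines "N \<equiv> spin_prod (z1 x0) (z2 x0)"
  shows "mink (dform em ep) N = 2 * mink (spin_prod (z1 x0) nabla_minus) N"
    "mink (dform ep em) N = 2 * mink (spin_prod (z2 x0) nabla_plus) N"
  using lorentz_frame_null[OF frame[OF dom(2)]] mink_spin_prod(3,4)[where z="z1 x0" and w="z2 x0"]
  unfolding dform_def nabla_plus_def nabla_minus_def N_def
  by (simp_all add: mink_simps spin_prod_simps field_simps)

lemma dirac_iff_dform:
  assumes "area (z1 x0) (z2 x0) = 1"
  shows "nabla_minus = (- H) *\<^sub>R z2 x0 \<and> nabla_plus = (- H) *\<^sub>R z1 x0 \<longleftrightarrow>
    dform ep em = dform em ep \<and>
    mink (dform ep em) (spin_prod (z1 x0) (z2 x0)) + mink (dform em ep) (spin_prod (z1 x0) (z2 x0)) = - 4 * H"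
proof -
  have "dform ep em = dform em ep \<longleftrightarrow> spin_prod (z1 x0) nabla_minus = spin_prod (z2 x0) nabla_plus"
    using curl_dform by (auto simp: algebra_simps)
  then show ?thesis
    unfolding dirac_iff_form[OF assms] normal_dform by auto
qed

text \<open>In dimension two an alternating form vanishes if it does on one basis.\<close>

lemma dform_symmetric:
  assumes "dform ep em = dform em ep"
  shows "dform u v = dform v u"
proof -
  obtain a b where u: "u = a *\<^sub>R ep + b *\<^sub>R em" using lorentz_frame_expansion[OF frame[OF dom(2)], of u] by blast
  obtain c d where v: "v = c *\<^sub>R ep + d *\<^sub>R em" using lorentz_frame_expansion[OF frame[OF dom(2)], of v] by blast
  note l = linear_add[OF bilinear_dform(1)] linear_add[OF bilinear_dform(2)]
    linear_scale[OF bilinear_dform(1)] linear_scale[OF bilinear_dform(2)]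
  have "dform (a *\<^sub>R p + b *\<^sub>R m) (c *\<^sub>R p + d *\<^sub>R m) = dform (c *\<^sub>R p + d *\<^sub>R m) (a *\<^sub>R p + b *\<^sub>R m)"
    if "dform p m = dform m p" for p m
    unfolding l that by (simp add: algebra_simps)
  then show ?thesis unfolding u v using assms .
qed

end

section \<open>Mean curvature of an immersion\<close>

text \<open>Up to a reflection the frame comes from a spinor, for which this is \<open>mink_expansion\<close>.\<close>

lemma null_frame_expansion:
  assumes nf: "null_frame n m N"
  shows "y = (- mink y m / 2) *\<^sub>R n + (- mink y n / 2) *\<^sub>R m + mink y N *\<^sub>R N"
proof -
  obtain s t z w where st: "s\<^sup>2 = 1" "t\<^sup>2 = 1" and sp: "spins z w (flip s t n) (flip s t m) (flip s t N)"
    using null_frame_spins[OF nf] by blast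
  have inv: "flip s t (flip s t x) = x" for x
    using st by (simp add: vec_eq_iff forall_3 flip_nth power2_eq_square flip: mult.assoc)
  have "flip s t y = (- mink y m / 2) *\<^sub>R flip s t n + (- mink y n / 2) *\<^sub>R flip s t m + mink y N *\<^sub>R flip s t N"
  proof -
    have e: "spin_prod z z = flip s t n" "spin_prod w w = flip s t m" "spin_prod z w = flip s t N" "area z w = 1"
      using sp by (simp_all add: spins_def)
    show ?thesis using mink_expansion[of z w "flip s t y"] unfolding e mink_flip[OF st] by simp
  qed
  from arg_cong[OF this, of "flip s t"] show ?thesis
    by (simp add: linear_simps[OF bounded_linear_flip] inv)
qed

context lorentz_surface
begin

lemma immersion_in_chart:
  assumes F: "isometric_immersion A g F" and c: "around c p"
  defines "f \<equiv> F \<circ> icrd c"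
  shows "smooth_on (crd c ` cdom c) f"
    "(f has_derivative frechet_derivative f (at (crd c p))) (at (crd c p))"
    "v \<in> tangent_space A p \<Longrightarrow> differential A F p v = frechet_derivative f (at (crd c p)) (v c)"
    "mink (frechet_derivative f (at (crd c p)) u) (frechet_derivative f (at (crd c p)) w) = bil (gram A g c p) u w"
proof -
  show 1: "smooth_on (crd c ` cdom c) f"
    using F c unfolding isometric_immersion_def smooth_map_on_def f_def around_def by simp
  show 2: "(f has_derivative frechet_derivative f (at (crd c p))) (at (crd c p))"
    by (rule smooth_on_has_derivative[OF 1]) (use c in \<open>auto simp: around_def\<close>)
  have 3: "differential A F p v = frechet_derivative f (at (crd c p)) (v c)" if "v \<in> tangent_space A p" for v
    by (rule differential_chart[OF c _ that]) (use 2 in \<open>simp add: f_def o_def\<close>)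
  then show "v \<in> tangent_space A p \<Longrightarrow> differential A F p v = frechet_derivative f (at (crd c p)) (v c)" .
  have "g p (tvec c p u) (tvec c p w) = mink (differential A F p (tvec c p u)) (differential A F p (tvec c p w))"
    using F c unfolding isometric_immersion_def by simp
  then show "mink (frechet_derivative f (at (crd c p)) u) (frechet_derivative f (at (crd c p)) w) = bil (gram A g c p) u w"
    using c by (simp add: 3 metric_bil)
qed

lemma normal_in_chart:
  assumes F: "isometric_immersion A g F" and N: "unit_normal_field A F N" and c: "around c p"
  shows "mink (N p) (N p) = 1" "mink (N p) (frechet_derivative (F \<circ> icrd c) (at (crd c p)) u) = 0"
proof -
  show "mink (N p) (N p) = 1" using N unfolding unit_normal_field_def by blast
  have "mink (N p) (differential A F p (tvec c p u)) = 0" using N c unfolding unit_normal_field_def by simp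
  then show "mink (N p) (frechet_derivative (F \<circ> icrd c) (at (crd c p)) u) = 0"
    using immersion_in_chart(3)[OF F c] c by simp
qed

lemma null_frame_immersion:
  assumes F: "isometric_immersion A g F" and N: "unit_normal_field A F N" and c: "around c p"
    and e: "lorentz_frame (gram A g c p) e2 e3"
  defines "D \<equiv> frechet_derivative (F \<circ> icrd c) (at (crd c p))"
  shows "null_frame (D (e2 + e3)) (D (e2 - e3)) (N p)"
  unfolding null_frame_def D_def immersion_in_chart(4)[OF F c] lorentz_frame_null[OF e]
  using normal_in_chart[OF F N c] by simp

lemma normal_part_eq:
  assumes F: "isometric_immersion A g F" and N: "unit_normal_field A F N"
  shows "normal_part A F p y = mink y (N p) *\<^sub>R N p"
proof -
  let ?c = "chart_at A p"
  have c: "around ?c p" by (rule around_chart_at)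
  obtain e2 e3 where e: "lorentz_frame (gram A g ?c p) e2 e3" using exists_lorentz_frame[OF c] by blast
  define D where "D = frechet_derivative (F \<circ> icrd ?c) (at (crd ?c p))"
  have nf: "null_frame (D (e2 + e3)) (D (e2 - e3)) (N p)"
    unfolding D_def by (rule null_frame_immersion[OF F N c e])
  have dF: "differential A F p v = D (v ?c)" if "v \<in> tangent_space A p" for v
    unfolding D_def by (rule immersion_in_chart(3)[OF F c that])
  have ND: "mink (N p) (D u) = 0" for u unfolding D_def by (rule normal_in_chart[OF F N c])
  have lin: "linear D" unfolding D_def by (rule has_derivative_linear[OF immersion_in_chart(2)[OF F c]])
  have im: "differential A F p ` tangent_space A p = range D"
  proof
    show "range D \<subseteq> differential A F p ` tangent_space A p"
    proof clarify
      fix u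
      have "D u = differential A F p (tvec ?c p u)" using c by (simp add: dF)
      then show "D u \<in> differential A F p ` tangent_space A p" using c by simp
    qed
  qed (use dF in auto)
  show ?thesis
    unfolding normal_part_def im
  proof (rule the_equality)
    have 1: "mink (mink y (N p) *\<^sub>R N p) (differential A F p v) = 0" if "v \<in> tangent_space A p" for v
      by (simp add: dF[OF that] mink_simps ND)
    have "y - mink y (N p) *\<^sub>R N p = (- mink y (D (e2 - e3)) / 2) *\<^sub>R D (e2 + e3) + (- mink y (D (e2 + e3)) / 2) *\<^sub>R D (e2 - e3)"
      by (subst (1) null_frame_expansion[OF nf, of y]) simp
    also have "\<dots> = D ((- mink y (D (e2 - e3)) / 2) *\<^sub>R (e2 + e3) + (- mink y (D (e2 + e3)) / 2) *\<^sub>R (e2 - e3))"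
      by (simp only: linear_add[OF lin] linear_scale[OF lin])
    finally show "(\<forall>v\<in>tangent_space A p. mink (mink y (N p) *\<^sub>R N p) (differential A F p v) = 0) \<and>
        y - mink y (N p) *\<^sub>R N p \<in> range D" using 1 by blast
    fix n assume n: "(\<forall>v\<in>tangent_space A p. mink n (differential A F p v) = 0) \<and> y - n \<in> range D"
    have nD: "mink n (D u) = 0" for u
      using n[THEN conjunct1, rule_format, of "tvec ?c p u"] c by (simp add: dF)
    obtain u where "y - n = D u" using n by blast
    then have "mink (N p) (y - n) = 0" using ND by simp
    then have "mink n (N p) = mink y (N p)" by (simp add: mink_simps mink_commute)
    then show "n = mink y (N p) *\<^sub>R N p"
      using null_frame_expansion[OF nf, of n] by (simp add: nD)
  qed
qed

text \<open>The inverse metric is \<open>- (e\<^sub>+ \<otimes> e\<^sub>- + e\<^sub>- \<otimes> e\<^sub>+) / 2\<close>, so half the trace of the second fundamental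
  form is its value at \<open>(e\<^sub>+, e\<^sub>-)\<close> times \<open>-1/2\<close>.\<close>

lemma mean_curvature_null_frame:
  fixes p :: 'm
  assumes F: "isometric_immersion A g F" and N: "unit_normal_field A F N"
  defines "c \<equiv> chart_at A p"
  assumes e: "lorentz_frame (gram A g c p) e2 e3"
  defines "K \<equiv> \<lambda>v u. frechet_derivative (\<lambda>x. frechet_derivative (F \<circ> icrd c) (at x) u) (at (crd c p)) v"
  shows "mean_curvature_vector A g F p =
    (- (mink (K (e2 + e3) (e2 - e3)) (N p) + mink (K (e2 - e3) (e2 + e3)) (N p)) / 4) *\<^sub>R N p"
proof -
  have c: "around c p" unfolding c_def by (rule around_chart_at)
  have sm: "smooth_on (crd c ` cdom c) (F \<circ> icrd c)" by (rule immersion_in_chart(1)[OF F c])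
  have lin1: "linear (\<lambda>v. K v u)" for u
    unfolding K_def
    by (rule frechet_derivative_linear[OF smooth_on_differentiable[OF smooth_on_frechet_derivative[OF sm]]])
      (use c in \<open>auto simp: around_def\<close>)
  have sym: "K v u = K u v" for v u
    unfolding K_def
    by (rule frechet_derivative_commute[OF _ _ sm]) (use c chart_open_range in \<open>auto simp: around_def\<close>)
  have "K v = (\<lambda>u. K u v)" for v by (rule ext) (rule sym)
  then have lin: "linear (K v)" for v using lin1[of v] by (rule ssubst[where P=linear])
  define B where "B i j = mink (K (axis i 1) (axis j 1)) (N p)" for i j :: 2
  have Kexp: "mink (K v u) (N p) = v$1 * u$1 * B 1 1 + v$1 * u$2 * B 1 2 + v$2 * u$1 * B 2 1 + v$2 * u$2 * B 2 2" for v u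
    using linear_real_2[OF lin1, of v u] linear_real_2[OF lin, of "axis 1 1" u] linear_real_2[OF lin, of "axis 2 1" u]
    by (simp add: mink_simps B_def algebra_simps)
  have sff: "second_fundamental_form A F p (coord_vec A c p i) (coord_vec A c p j) = B i j *\<^sub>R N p" for i j
    unfolding second_fundamental_form_def Let_def c_def[symmetric] coord_vec_eq tvec_self[OF c]
    unfolding normal_part_eq[OF F N] B_def K_def ..
  have "mean_curvature_vector A g F p
      = ((1/2) * (\<Sum>i\<in>UNIV. \<Sum>j\<in>UNIV. matrix_inv (gram A g c p) $ i $ j * B i j)) *\<^sub>R N p"
    unfolding mean_curvature_vector_def Let_def c_def[symmetric] sff
    by (simp add: sum_2 algebra_simps)
  also have "(\<Sum>i\<in>UNIV. \<Sum>j\<in>UNIV. matrix_inv (gram A g c p) $ i $ j * B i j)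
      = - (mink (K (e2 + e3) (e2 - e3)) (N p) + mink (K (e2 - e3) (e2 + e3)) (N p)) / 2"
    unfolding Kexp matrix_inv_lorentz_frame[OF e] by (simp add: sum_2 field_simps)
  finally show ?thesis by simp
qed

end


section \<open>Spin structures\<close>

lemma (in spinor_chart) linear_om: "linear om"
  unfolding om_def
  by (rule linearI; simp add: koszul_def bil_simps linear_add[OF has_derivative_linear[OF dG]]
    linear_scale[OF has_derivative_linear[OF dG]] linear_add[OF has_derivative_linear[OF de2]]
    linear_scale[OF has_derivative_linear[OF de2]] field_simps)

text \<open>Here \<open>X - a E\<^sub>2E\<^sub>3y\<close> and \<open>Y - b E\<^sub>2E\<^sub>3y\<close> stand for the covariant derivatives along \<open>e\<^sub>2\<close> and \<open>e\<^sub>3\<close>.\<close>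

lemma dirac_components:
  "- (E2 *v (X - a *\<^sub>R (E2 *v (E3 *v y)))) + E3 *v (Y - b *\<^sub>R (E2 *v (E3 *v y))) = H *\<^sub>R y \<longleftrightarrow>
   (X$1 - Y$1) - (a - b) *\<^sub>R y$1 = (- H) *\<^sub>R y$2 \<and> (X$2 + Y$2) + (a + b) *\<^sub>R y$2 = (- H) *\<^sub>R y$1"
  by (auto simp: vec_eq_iff forall_2 E2_def E3_def matrix_vector_mult_def sum_2 algebra_simps complex_eq_iff)

lemma rho_nth: "(rho (inverse h) *v y) $ 1 = inverse h *\<^sub>R y$1" "(rho (inverse h) *v y) $ 2 = h *\<^sub>R y$2"
  by (simp_all add: rho_def matrix_vector_mult_def sum_2 scaleR_conv_of_real)

lemma smooth_vector_field_lincomb: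
  assumes "c \<in> A \<Longrightarrow> open (crd c ` (U \<inter> cdom c))" "smooth_on (crd c ` (U \<inter> cdom c)) (\<lambda>x. X (icrd c x) c)"
    "smooth_on (crd c ` (U \<inter> cdom c)) (\<lambda>x. Y (icrd c x) c)" "c \<in> A"
  shows "smooth_on (crd c ` (U \<inter> cdom c)) (\<lambda>x. lincomb a (X (icrd c x)) b (Y (icrd c x)) c)"
  unfolding lincomb_def
  by (intro smooth_on_add smooth_on_bounded_linear[OF _ bounded_linear_scaleR_right] assms)

locale spin_surface = lorentz_surface A g for A :: "'m::topological_space chart set" and g +
  fixes T S :: "'m \<Rightarrow> 'm tangent set" and \<Phi> :: "'q::topological_space \<Rightarrow> 'm frame" and act :: "'q \<Rightarrow> real \<Rightarrow> 'q"
  assumes spin: "spin_structure A g T S \<Phi> act"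
begin

abbreviation "pr \<equiv> proj \<Phi>"

lemma act_mult: "h \<noteq> 0 \<Longrightarrow> k \<noteq> 0 \<Longrightarrow> act q (h * k) = act (act q h) k"
  and frame_of_act: "h \<noteq> 0 \<Longrightarrow> \<Phi> (act q h) = frame_act (\<Phi> q) h"
  and range_frames: "\<Phi> q \<in> oriented_frames A g T S"
  using spin unfolding spin_structure_def by (auto simp: Spin11_def)

lemma proj_act [simp]: "h \<noteq> 0 \<Longrightarrow> pr (act q h) = pr q"
  by (simp add: proj_def frame_of_act frame_act_def Let_def split: prod.split)

lemma frames_act:
  assumes "h \<noteq> 0"
  shows "frame2 \<Phi> (act q h) = lincomb ((h\<^sup>2 + inverse h ^ 2) / 2) (frame2 \<Phi> q) (- ((h\<^sup>2 - inverse h ^ 2) / 2)) (frame3 \<Phi> q)"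
    "frame3 \<Phi> (act q h) = lincomb (- ((h\<^sup>2 - inverse h ^ 2) / 2)) (frame2 \<Phi> q) ((h\<^sup>2 + inverse h ^ 2) / 2) (frame3 \<Phi> q)"
  using assms by (simp_all add: frame2_def frame3_def frame_of_act frame_act_def Let_def split: prod.split)

lemma null_frames_act:
  assumes "h \<noteq> 0"
  shows "frame2 \<Phi> (act q h) c + frame3 \<Phi> (act q h) c = (inverse h)\<^sup>2 *\<^sub>R (frame2 \<Phi> q c + frame3 \<Phi> q c)"
    "frame2 \<Phi> (act q h) c - frame3 \<Phi> (act q h) c = h\<^sup>2 *\<^sub>R (frame2 \<Phi> q c - frame3 \<Phi> q c)"
  unfolding frames_act[OF assms] lincomb_def by (simp_all add: vec_eq_iff field_simps)

lemma orthonormal: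
  "g (pr q) (frame2 \<Phi> q) (frame2 \<Phi> q) = -1" "g (pr q) (frame2 \<Phi> q) (frame3 \<Phi> q) = 0"
  "g (pr q) (frame3 \<Phi> q) (frame3 \<Phi> q) = 1"
  using range_frames[of q] by (auto simp: oriented_frames_def proj_def frame2_def frame3_def)

lemma trivialization:
  obtains U s t where "p \<in> U" "spinorial_frame A \<Phi> U s"
    "homeomorphism (U \<times> Spin11) {q. pr q \<in> U} (\<lambda>(x, h). act (s x) h) t"
  using spin unfolding spin_structure_def by blast

lemma trivialization_fibre:
  assumes s: "spinorial_frame A \<Phi> U s"
    and t: "homeomorphism (U \<times> Spin11) {q. pr q \<in> U} (\<lambda>(x, h). act (s x) h) t" and q: "pr q \<in> U"
  shows "snd (t q) \<noteq> 0" "act (s (pr q)) (snd (t q)) = q"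
proof -
  have "t q \<in> U \<times> Spin11" using homeomorphism_image2[OF t] q by blast
  then obtain x h where xh: "t q = (x, h)" "x \<in> U" "h \<noteq> 0" by (auto simp: Spin11_def)
  have e: "act (s x) h = q" using homeomorphism_apply2[OF t, of q] q xh by simp
  have "pr (s x) = x" using s xh unfolding spinorial_frame_def by blast
  then have "pr q = x" using proj_act[OF xh(3), of "s x"] e by simp
  then show "snd (t q) \<noteq> 0" "act (s (pr q)) (snd (t q)) = q" using xh e by simp_all
qed

lemma trivialization_act:
  assumes s: "spinorial_frame A \<Phi> U s"
    and t: "homeomorphism (U \<times> Spin11) {q. pr q \<in> U} (\<lambda>(x, h). act (s x) h) t" and x: "x \<in> U" "h \<noteq> 0"
  shows "t (act (s x) h) = (x, h)"
  using homeomorphism_apply1[OF t, of "(x, h)"] x by (simp add: Spin11_def)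

lemma fibre_transitive:
  assumes "pr q = pr q'"
  obtains h where "h \<noteq> 0" "q' = act q h"
proof -
  obtain U s t where s: "pr q \<in> U" "spinorial_frame A \<Phi> U s"
    and t: "homeomorphism (U \<times> Spin11) {q. pr q \<in> U} (\<lambda>(x, h). act (s x) h) t"
    using trivialization by blast
  obtain h where h: "h \<noteq> 0" "act (s (pr q)) h = q" using trivialization_fibre[OF s(2) t s(1)] by blast
  obtain k where k: "k \<noteq> 0" "act (s (pr q)) k = q'" using trivialization_fibre[OF s(2) t, of q'] s(1) assms by metis
  have "q' = act q (inverse h * k)"
    using act_mult[of h "inverse h * k" "s (pr q)"] h k by (simp flip: mult.assoc)
  then show ?thesis using that[of "inverse h * k"] h k by simp
qed

lemma section_through_frame:
  obtains U s where "pr q \<in> U" "spinorial_frame A \<Phi> U s" "s (pr q) = q"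
proof -
  obtain U s t where s: "pr q \<in> U" "spinorial_frame A \<Phi> U s"
    and t: "homeomorphism (U \<times> Spin11) {q. pr q \<in> U} (\<lambda>(x, h). act (s x) h) t"
    using trivialization by blast
  obtain h where h: "h \<noteq> 0" "act (s (pr q)) h = q" using trivialization_fibre[OF s(2) t s(1)] by blast
  have U: "open U" using s unfolding spinorial_frame_def by blast
  have "continuous_on U (\<lambda>x. (\<lambda>(x, h). act (s x) h) (x, h))"
    by (rule continuous_on_compose2[OF homeomorphism_cont1[OF t]])
      (use h in \<open>auto simp: Spin11_def intro!: continuous_intros\<close>)
  then have "continuous_on U (\<lambda>x. act (s x) h)" by simp
  moreover have "smooth_vector_field_on A U (\<lambda>p. lincomb a (frame2 \<Phi> (s p)) b (frame3 \<Phi> (s p)))" for a b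
  proof -
    have 2: "smooth_vector_field_on A U (\<lambda>p. frame2 \<Phi> (s p))" "smooth_vector_field_on A U (\<lambda>p. frame3 \<Phi> (s p))"
      using s unfolding spinorial_frame_def by blast+
    have "lincomb a (frame2 \<Phi> (s p)) b (frame3 \<Phi> (s p)) \<in> tangent_space A p" if "p \<in> U" for p
    proof -
      obtain c where c: "around c p" using exists_chart by blast
      have "frame2 \<Phi> (s p) = tvec c p (frame2 \<Phi> (s p) c)" "frame3 \<Phi> (s p) = tvec c p (frame3 \<Phi> (s p) c)"
        using 2 that c unfolding smooth_vector_field_on_def by (auto intro!: tangent_eq_tvec)
      then have "lincomb a (frame2 \<Phi> (s p)) b (frame3 \<Phi> (s p))
          = tvec c p (a *\<^sub>R frame2 \<Phi> (s p) c + b *\<^sub>R frame3 \<Phi> (s p) c)"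
        using lincomb_tvec[OF c] by metis
      then show ?thesis using c by simp
    qed
    then show ?thesis
      unfolding smooth_vector_field_on_def
    proof (intro conjI ballI)
      fix c assume "c \<in> A"
      then show "smooth_on (crd c ` (U \<inter> cdom c)) (\<lambda>x. lincomb a (frame2 \<Phi> (s (icrd c x))) b (frame3 \<Phi> (s (icrd c x))) c)"
        using 2 open_chart_image[OF _ U] unfolding smooth_vector_field_on_def
        by (intro smooth_vector_field_lincomb[where A=A]) blast+
    qed
  qed
  ultimately have "spinorial_frame A \<Phi> U (\<lambda>x. act (s x) h)"
    using s h(1) U unfolding spinorial_frame_def frames_act[OF h(1)] by simp
  then show ?thesis using that s h by blast
qed

lemma frame_over: "\<exists>q. pr q = p"
proof -
  obtain U s t where "p \<in> U" "spinorial_frame A \<Phi> U s"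
    "homeomorphism (U \<times> Spin11) {q. pr q \<in> U} (\<lambda>(x, h). act (s x) h) t"
    using trivialization by blast
  then show ?thesis unfolding spinorial_frame_def by blast
qed

lemma frame_tangent: "frame2 \<Phi> q \<in> tangent_space A (pr q)" "frame3 \<Phi> q \<in> tangent_space A (pr q)"
proof -
  obtain U s where s: "pr q \<in> U" "spinorial_frame A \<Phi> U s" "s (pr q) = q" using section_through_frame by blast
  then have "frame2 \<Phi> (s (pr q)) \<in> tangent_space A (pr q)" "frame3 \<Phi> (s (pr q)) \<in> tangent_space A (pr q)"
    unfolding spinorial_frame_def smooth_vector_field_on_def by blast+
  then show "frame2 \<Phi> q \<in> tangent_space A (pr q)" "frame3 \<Phi> q \<in> tangent_space A (pr q)" using s by simp_all
qed

lemma lorentz_frame_chart: "around c (pr q) \<Longrightarrow> lorentz_frame (gram A g c (pr q)) (frame2 \<Phi> q c) (frame3 \<Phi> q c)"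
  by (rule lorentz_frame_gram) (simp_all add: frame_tangent orthonormal)

text \<open>The one-form of \<open>\<psi>\<close> in a chart, computed in the frame \<open>q\<close>. The powers of \<open>h\<close> by which a change of
  frame multiplies the null fields and the squares of the components cancel (\<open>xi_covec\<close>).\<close>

definition covec :: "('q \<Rightarrow> complex^2) \<Rightarrow> 'm chart \<Rightarrow> 'q \<Rightarrow> real^2 \<Rightarrow> real^3" where
  "covec \<psi> c q u = (-1/2) *\<^sub>R
     (bil (gram A g c (pr q)) u (frame2 \<Phi> q c - frame3 \<Phi> q c) *\<^sub>R spin_prod (\<psi> q $ 1) (\<psi> q $ 1)
      + bil (gram A g c (pr q)) u (frame2 \<Phi> q c + frame3 \<Phi> q c) *\<^sub>R spin_prod (\<psi> q $ 2) (\<psi> q $ 2))"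

definition some_frame :: "'m \<Rightarrow> 'q" where
  "some_frame p = (SOME q. pr q = p)"

lemma pr_some_frame [simp]: "pr (some_frame p) = p"
  unfolding some_frame_def by (rule someI_ex[OF frame_over])

definition xi :: "('q \<Rightarrow> complex^2) \<Rightarrow> 'm chart \<Rightarrow> 'm \<Rightarrow> real^2 \<Rightarrow> real^3" where
  "xi \<psi> c p u = covec \<psi> c (some_frame p) u"

definition normal :: "('q \<Rightarrow> complex^2) \<Rightarrow> 'm \<Rightarrow> real^3" where
  "normal \<psi> p = spin_prod (\<psi> (some_frame p) $ 1) (\<psi> (some_frame p) $ 2)"

definition equivariant :: "('q \<Rightarrow> complex^2) \<Rightarrow> bool" where
  "equivariant \<psi> \<longleftrightarrow> (\<forall>q. \<forall>h\<in>Spin11. \<psi> (act q h) = rho (inverse h) *v \<psi> q)"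

lemma equivariant_nth:
  "equivariant \<psi> \<Longrightarrow> h \<noteq> 0 \<Longrightarrow> \<psi> (act q h) $ 1 = inverse h *\<^sub>R \<psi> q $ 1"
  "equivariant \<psi> \<Longrightarrow> h \<noteq> 0 \<Longrightarrow> \<psi> (act q h) $ 2 = h *\<^sub>R \<psi> q $ 2"
  unfolding equivariant_def Spin11_def by (simp_all add: rho_nth)

lemma xi_covec:
  assumes "equivariant \<psi>"
  shows "xi \<psi> c (pr q) u = covec \<psi> c q u"
proof -
  obtain h where h: "h \<noteq> 0" "some_frame (pr q) = act q h"
    using fibre_transitive[of q "some_frame (pr q)"] by auto
  have r: "h * h * X * (inverse h * inverse h) = X" "inverse h * inverse h * X * (h * h) = X" for X
    using h(1) by (simp_all add: field_simps)
  show ?thesis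
    unfolding xi_def h(2) covec_def null_frames_act[OF h(1)] equivariant_nth[OF assms h(1)] proj_act[OF h(1)]
    by (simp add: bil_simps spin_prod_simps power2_eq_square r)
qed

lemma normal_eq:
  assumes "equivariant \<psi>"
  shows "normal \<psi> (pr q) = spin_prod (\<psi> q $ 1) (\<psi> q $ 2)"
proof -
  obtain h where h: "h \<noteq> 0" "some_frame (pr q) = act q h"
    using fibre_transitive[of q "some_frame (pr q)"] by auto
  show ?thesis
    unfolding normal_def h(2) equivariant_nth[OF assms h(1)] using h(1) by (simp add: spin_prod_simps)
qed

lemma xi_jac:
  assumes c: "around c p" and d: "around d p"
  shows "xi \<psi> d p (jac c d p u) = xi \<psi> c p u"
proof -
  let ?q = "some_frame p"
  note t = tangent_jac[OF frame_tangent(1)[of ?q], unfolded pr_some_frame, OF c d]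
    tangent_jac[OF frame_tangent(2)[of ?q], unfolded pr_some_frame, OF c d]
  show ?thesis
    unfolding xi_def covec_def pr_some_frame t
    using bil_gram_jac[OF c d, of u] linear_add[OF linear_jac[OF c d]] linear_diff[OF linear_jac[OF c d]]
    by simp
qed

lemma spinor_chart_frame:
  assumes s: "spinorial_frame A \<Phi> U s" and p: "p \<in> U" and c: "around c p" and z: "smooth_map_on A U z"
  shows "spinor_chart (crd c ` (U \<inter> cdom c)) (crd c p) (\<lambda>x. gram A g c (icrd c x))
     (\<lambda>x. frame2 \<Phi> (s (icrd c x)) c) (\<lambda>x. frame3 \<Phi> (s (icrd c x)) c)
     (\<lambda>x. z (icrd c x) $ 1) (\<lambda>x. z (icrd c x) $ 2) (dgram c p)
     (frechet_derivative (\<lambda>x. frame2 \<Phi> (s (icrd c x)) c) (at (crd c p)))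
     (frechet_derivative (\<lambda>x. frame3 \<Phi> (s (icrd c x)) c) (at (crd c p)))
     (\<lambda>v. frechet_derivative (\<lambda>x. z (icrd c x)) (at (crd c p)) v $ 1)
     (\<lambda>v. frechet_derivative (\<lambda>x. z (icrd c x)) (at (crd c p)) v $ 2)"
proof
  have cA: "c \<in> A" using c by (simp add: around_def)
  have U: "open U" "\<And>x. x \<in> U \<Longrightarrow> pr (s x) = x"
    "smooth_vector_field_on A U (\<lambda>p. frame2 \<Phi> (s p))" "smooth_vector_field_on A U (\<lambda>p. frame3 \<Phi> (s p))"
    using s unfolding spinorial_frame_def by blast+
  show "open (crd c ` (U \<inter> cdom c))" by (rule open_chart_image[OF cA U(1)])
  show x0: "crd c p \<in> crd c ` (U \<inter> cdom c)" by (rule crd_in[OF c p])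
  show "lorentz_frame (gram A g c (icrd c x)) (frame2 \<Phi> (s (icrd c x)) c) (frame3 \<Phi> (s (icrd c x)) c)"
    if "x \<in> crd c ` (U \<inter> cdom c)" for x
    using lorentz_frame_chart[of c "s (icrd c x)"] chart_image[OF cA that] U(2) by simp
  show "((\<lambda>x. gram A g c (icrd c x)) has_derivative dgram c p) (at (crd c p))" by (rule gram_derivative[OF c])
  show "transpose (dgram c p v) = dgram c p v" for v by (rule dgram_sym[OF c])
  show "((\<lambda>x. frame2 \<Phi> (s (icrd c x)) c) has_derivative frechet_derivative (\<lambda>x. frame2 \<Phi> (s (icrd c x)) c) (at (crd c p))) (at (crd c p))"
    "((\<lambda>x. frame3 \<Phi> (s (icrd c x)) c) has_derivative frechet_derivative (\<lambda>x. frame3 \<Phi> (s (icrd c x)) c) (at (crd c p))) (at (crd c p))"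
    using U(3,4) cA x0 unfolding smooth_vector_field_on_def by (auto intro: smooth_on_has_derivative)
  have "((\<lambda>x. z (icrd c x)) has_derivative frechet_derivative (\<lambda>x. z (icrd c x)) (at (crd c p))) (at (crd c p))"
    using z cA x0 unfolding smooth_map_on_def by (auto intro: smooth_on_has_derivative simp: o_def)
  then show "((\<lambda>x. z (icrd c x) $ 1) has_derivative (\<lambda>v. frechet_derivative (\<lambda>x. z (icrd c x)) (at (crd c p)) v $ 1)) (at (crd c p))"
    "((\<lambda>x. z (icrd c x) $ 2) has_derivative (\<lambda>v. frechet_derivative (\<lambda>x. z (icrd c x)) (at (crd c p)) v $ 2)) (at (crd c p))"
    by (auto intro: bounded_linear.has_derivative[OF bounded_linear_vec_nth])
qed

lemma xi_local:
  assumes e: "equivariant \<psi>" and s: "spinorial_frame A \<Phi> U s" and c: "c \<in> A" and x: "x \<in> crd c ` (U \<inter> cdom c)"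
  shows "xi \<psi> c (icrd c x) u = covec \<psi> c (s (icrd c x)) u" "pr (s (icrd c x)) = icrd c x"
proof -
  show 1: "pr (s (icrd c x)) = icrd c x"
    using s chart_image[OF c x] unfolding spinorial_frame_def by blast
  show "xi \<psi> c (icrd c x) u = covec \<psi> c (s (icrd c x)) u"
    using xi_covec[OF e, of c "s (icrd c x)" u] by (simp add: 1)
qed

text \<open>The Dirac operator at \<open>q\<close> is computed in some spinorial frame through \<open>q\<close>. Since the one-form does
  not depend on frames, its derivatives at the base point can be computed in the same one.\<close>

lemma dirac_iff_xi:
  assumes \<psi>: "spinor_field A \<Phi> act \<psi>" and ar: "area (\<psi> q $ 1) (\<psi> q $ 2) = 1" and c: "around c (pr q)"
  defines "x0 \<equiv> crd c (pr q)"
  defines "K \<equiv> \<lambda>v u. frechet_derivative (\<lambda>x. xi \<psi> c (icrd c x) u) (at x0) v"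
  defines "ep \<equiv> frame2 \<Phi> q c + frame3 \<Phi> q c" and "em \<equiv> frame2 \<Phi> q c - frame3 \<Phi> q c"
  shows "dirac A g \<Phi> \<psi> q = H *\<^sub>R \<psi> q \<longleftrightarrow>
      K ep em = K em ep \<and> mink (K ep em) (normal \<psi> (pr q)) + mink (K em ep) (normal \<psi> (pr q)) = - 4 * H"
    "K ep em = K em ep \<Longrightarrow> K u v = K v u"
proof -
  have eq: "equivariant \<psi>" using \<psi> unfolding spinor_field_def equivariant_def by blast
  let ?p = "pr q"
  have cA: "c \<in> A" using c by (simp add: around_def)
  define s where "s = (SOME s. \<exists>U. ?p \<in> U \<and> spinorial_frame A \<Phi> U s \<and> s ?p = q)"
  have "\<exists>s U. ?p \<in> U \<and> spinorial_frame A \<Phi> U s \<and> s ?p = q" using section_through_frame by metis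
  then have "\<exists>U. ?p \<in> U \<and> spinorial_frame A \<Phi> U s \<and> s ?p = q" unfolding s_def by (rule someI_ex)
  then obtain U where p: "?p \<in> U" and s: "spinorial_frame A \<Phi> U s" and sp: "s ?p = q" by blast
  have sm: "smooth_map_on A U (\<lambda>x. \<psi> (s x))" using \<psi> s unfolding spinor_field_def by blast
  interpret sc: spinor_chart "crd c ` (U \<inter> cdom c)" "crd c ?p" "\<lambda>x. gram A g c (icrd c x)"
     "\<lambda>x. frame2 \<Phi> (s (icrd c x)) c" "\<lambda>x. frame3 \<Phi> (s (icrd c x)) c"
     "\<lambda>x. \<psi> (s (icrd c x)) $ 1" "\<lambda>x. \<psi> (s (icrd c x)) $ 2" "dgram c ?p"
     "frechet_derivative (\<lambda>x. frame2 \<Phi> (s (icrd c x)) c) (at (crd c ?p))"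
     "frechet_derivative (\<lambda>x. frame3 \<Phi> (s (icrd c x)) c) (at (crd c ?p))"
     "\<lambda>v. frechet_derivative (\<lambda>x. \<psi> (s (icrd c x))) (at (crd c ?p)) v $ 1"
     "\<lambda>v. frechet_derivative (\<lambda>x. \<psi> (s (icrd c x))) (at (crd c ?p)) v $ 2"
    by (rule spinor_chart_frame[OF s p c sm])
  have "((\<lambda>x. xi \<psi> c (icrd c x) u) has_derivative (\<lambda>v. sc.dform v u)) (at (crd c ?p))" for u
    by (rule has_derivative_cong_open[OF sc.form_derivative sc.dom])
      (simp add: sc.form_def xi_local[OF eq s cA] covec_def)
  then have K: "K v u = sc.dform v u" for v u
    unfolding K_def x0_def using frechet_derivative_eqI by metis
  have ee: "ep = frame2 \<Phi> (s (icrd c (crd c ?p))) c + frame3 \<Phi> (s (icrd c (crd c ?p))) c"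
    "em = frame2 \<Phi> (s (icrd c (crd c ?p))) c - frame3 \<Phi> (s (icrd c (crd c ?p))) c"
    using c sp by (simp_all add: ep_def em_def)
  have dz: "((\<lambda>x. \<psi> (s (icrd c x))) has_derivative frechet_derivative (\<lambda>x. \<psi> (s (icrd c x))) (at (crd c ?p))) (at (crd c ?p))"
    using sm cA crd_in[OF c p] unfolding smooth_map_on_def by (auto intro: smooth_on_has_derivative simp: o_def)
  let ?Z = "frechet_derivative (\<lambda>x. \<psi> (s (icrd c x))) (at (crd c ?p))"
  have linZ: "linear ?Z" using has_derivative_linear[OF dz] .
  have nab: "spin_nabla A g \<Phi> \<psi> v q = ?Z (v c) - (sc.om (v c) / 2) *\<^sub>R (E2 *v (E3 *v \<psi> q))"
    if v: "v \<in> tangent_space A ?p" for v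
  proof -
    have 1: "differential A (\<lambda>x. \<psi> (s x)) ?p v = ?Z (v c)" by (rule differential_chart[OF c dz v])
    have U: "open U" "smooth_vector_field_on A U (\<lambda>p. frame2 \<Phi> (s p))" using s unfolding spinorial_frame_def by blast+
    have "levi_civita A g ?p v (\<lambda>x. frame2 \<Phi> (s x)) \<in> tangent_space A ?p"
      by (rule levi_civita_tangent[OF U(1) p U(2) v])
    then have "g ?p (levi_civita A g ?p v (\<lambda>x. frame2 \<Phi> (s x))) (frame3 \<Phi> q)
        = bil (gram A g c ?p) (levi_civita A g ?p v (\<lambda>x. frame2 \<Phi> (s x)) c) (frame3 \<Phi> q c)"
      by (rule metric_bil[OF c _ frame_tangent(2)])
    also have "\<dots> = sc.om (v c)"
      using levi_civita_koszul[where Y="\<lambda>x. frame2 \<Phi> (s x)", OF c sc.de2, of v "frame3 \<Phi> q c"] c sp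
      by (simp add: sc.om_def)
    finally show ?thesis unfolding spin_nabla_def Let_def s_def[symmetric] 1 by simp
  qed
  let ?e2 = "frame2 \<Phi> q c" and ?e3 = "frame3 \<Phi> q c"
  have "dirac A g \<Phi> \<psi> q = H *\<^sub>R \<psi> q \<longleftrightarrow>
      (?Z ?e2 $ 1 - ?Z ?e3 $ 1) - (sc.om ?e2 / 2 - sc.om ?e3 / 2) *\<^sub>R \<psi> q $ 1 = (- H) *\<^sub>R \<psi> q $ 2 \<and>
      (?Z ?e2 $ 2 + ?Z ?e3 $ 2) + (sc.om ?e2 / 2 + sc.om ?e3 / 2) *\<^sub>R \<psi> q $ 2 = (- H) *\<^sub>R \<psi> q $ 1"
    unfolding dirac_def nab[OF frame_tangent(1)] nab[OF frame_tangent(2)] by (rule dirac_components)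
  also have "(?Z ?e2 $ 1 - ?Z ?e3 $ 1) - (sc.om ?e2 / 2 - sc.om ?e3 / 2) *\<^sub>R \<psi> q $ 1 = sc.nabla_minus"
    using c sp by (simp add: sc.nabla_minus_def linear_diff[OF linZ] linear_diff[OF sc.linear_om] diff_divide_distrib)
  also have "(?Z ?e2 $ 2 + ?Z ?e3 $ 2) + (sc.om ?e2 / 2 + sc.om ?e3 / 2) *\<^sub>R \<psi> q $ 2 = sc.nabla_plus"
    using c sp by (simp add: sc.nabla_plus_def linear_add[OF linZ] linear_add[OF sc.linear_om] add_divide_distrib)
  finally show "dirac A g \<Phi> \<psi> q = H *\<^sub>R \<psi> q \<longleftrightarrow>
      K ep em = K em ep \<and> mink (K ep em) (normal \<psi> (pr q)) + mink (K em ep) (normal \<psi> (pr q)) = - 4 * H"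
    using sc.dirac_iff_dform[of H] ar c sp unfolding K ee normal_eq[OF eq] by simp
  show "K u v = K v u" if "K ep em = K em ep"
    using sc.dform_symmetric[of u v] that unfolding K ee by simp
qed

end


section \<open>From a spinor field to an immersion\<close>

lemma smooth_on_bil:
  assumes "open S" "\<And>i j. smooth_on S (\<lambda>x. G x $ i $ j)" "smooth_on S u" "smooth_on S w"
  shows "smooth_on S (\<lambda>x. bil (G x) (u x) (w x))"
  unfolding bil_def by (intro smooth_on_sum smooth_on_mult smooth_on_vec_nth assms finite)

context lorentz_surface
begin

lemma open_icrd_image:
  assumes c: "c \<in> A" and B: "open B" "B \<subseteq> crd c ` cdom c"
  shows "open (icrd c ` B)"
proof -
  have "openin (top_of_set (crd c ` cdom c)) B" using B by (auto simp: openin_open)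
  from homeomorphism_imp_open_map[OF homeomorphism_symD[OF chart_homeomorphism[OF c]] this]
  show ?thesis using openin_open_trans chart_open_domain[OF c] by blast
qed

lemma chart_disc:
  assumes c: "around c p" and W: "open W" "p \<in> W"
  obtains e where "e > 0" "ball (crd c p) e \<subseteq> crd c ` (W \<inter> cdom c)" "open (icrd c ` ball (crd c p) e)"
    "p \<in> icrd c ` ball (crd c p) e" "icrd c ` ball (crd c p) e \<subseteq> W" "path_connected (icrd c ` ball (crd c p) e)"
proof -
  have cA: "c \<in> A" using c by (simp add: around_def)
  obtain e where e: "e > 0" "ball (crd c p) e \<subseteq> crd c ` (W \<inter> cdom c)"
    using open_chart_image[OF cA W(1)] crd_in[OF c W(2)] open_contains_ball by blast
  then have sub: "ball (crd c p) e \<subseteq> crd c ` cdom c" by blast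
  show ?thesis
  proof
    show "open (icrd c ` ball (crd c p) e)" by (rule open_icrd_image[OF cA open_ball sub])
    have "icrd c (crd c p) \<in> icrd c ` ball (crd c p) e" using e by (intro imageI) simp
    then show "p \<in> icrd c ` ball (crd c p) e" using c by simp
    show "icrd c ` ball (crd c p) e \<subseteq> W" using chart_image[OF cA] e(2) by blast
    show "path_connected (icrd c ` ball (crd c p) e)"
      by (rule path_connected_continuous_image[OF continuous_on_subset[OF homeomorphism_cont2[OF chart_homeomorphism[OF cA]] sub]])
        (rule convex_imp_path_connected[OF convex_ball])
  qed (use e in auto)
qed

lemma locally_path_connected_surface:
  fixes x :: 'm
  assumes "open W" "x \<in> W"
  shows "\<exists>V. open V \<and> x \<in> V \<and> V \<subseteq> W \<and> path_connected V"
proof -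
  obtain c where "around c x" using exists_chart by blast
  then show ?thesis using chart_disc assms by metis
qed

end

locale dirac_spinor = spin_surface A g T S \<Phi> act for A :: "'m::topological_space chart set" and g T S
    and \<Phi> :: "'q::topological_space \<Rightarrow> 'm frame" and act +
  fixes \<psi> :: "'q \<Rightarrow> complex^2" and H :: "'m \<Rightarrow> real"
  assumes spinor: "spinor_field A \<Phi> act \<psi>" and dirac: "\<And>q. dirac A g \<Phi> \<psi> q = H (proj \<Phi> q) *\<^sub>R \<psi> q"
    and norm: "\<And>q. spinor_inner (\<psi> q) (\<psi> q) = 1"
begin

lemma equi: "equivariant \<psi>"
  using spinor unfolding spinor_field_def equivariant_def by blast

lemma area_one: "area (\<psi> q $ 1) (\<psi> q $ 2) = 1"
  using norm[of q] by (simp add: spinor_inner_def Let_def area_altdef field_simps)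

lemma smooth_section:
  assumes s: "spinorial_frame A \<Phi> U s" and c: "c \<in> A"
  shows "smooth_on (crd c ` (U \<inter> cdom c)) (\<lambda>x. \<psi> (s (icrd c x)))"
    "smooth_on (crd c ` (U \<inter> cdom c)) (\<lambda>x. frame2 \<Phi> (s (icrd c x)) c)"
    "smooth_on (crd c ` (U \<inter> cdom c)) (\<lambda>x. frame3 \<Phi> (s (icrd c x)) c)"
    "open (crd c ` (U \<inter> cdom c))"
proof -
  have "smooth_map_on A U (\<lambda>x. \<psi> (s x))" using spinor s unfolding spinor_field_def by blast
  then show "smooth_on (crd c ` (U \<inter> cdom c)) (\<lambda>x. \<psi> (s (icrd c x)))"
    using c unfolding smooth_map_on_def by (simp add: o_def)
  show "smooth_on (crd c ` (U \<inter> cdom c)) (\<lambda>x. frame2 \<Phi> (s (icrd c x)) c)"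
    "smooth_on (crd c ` (U \<inter> cdom c)) (\<lambda>x. frame3 \<Phi> (s (icrd c x)) c)"
    "open (crd c ` (U \<inter> cdom c))"
    using s c open_chart_image[OF c] unfolding spinorial_frame_def smooth_vector_field_on_def by blast+
qed

lemma chart_section:
  assumes c: "c \<in> A" and x: "x \<in> crd c ` cdom c"
  obtains U s where "spinorial_frame A \<Phi> U s" "x \<in> crd c ` (U \<inter> cdom c)"
proof -
  obtain U s where s: "icrd c x \<in> U" "spinorial_frame A \<Phi> U s"
    using section_through_frame frame_over by metis
  moreover have "crd c (icrd c x) = x" "icrd c x \<in> cdom c" using chart_image'[OF c x] by (auto simp: around_def)
  then have "x \<in> crd c ` (U \<inter> cdom c)" using s by (metis IntI imageI)
  ultimately show ?thesis using that by blast
qed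

lemma smooth_xi:
  assumes c: "c \<in> A"
  shows "smooth_on (crd c ` cdom c) (\<lambda>x. xi \<psi> c (icrd c x) u)"
proof (rule smooth_on_local)
  fix x assume x: "x \<in> crd c ` cdom c"
  obtain U s where s: "spinorial_frame A \<Phi> U s" and xU: "x \<in> crd c ` (U \<inter> cdom c)"
    using chart_section[OF c x] by blast
  let ?T = "crd c ` (U \<inter> cdom c)"
  note sm = smooth_section[OF s c]
  have gm: "smooth_on ?T (\<lambda>x. gram A g c (icrd c x) $ i $ j)" for i j
    by (rule smooth_on_mono[OF _ smooth_gram[OF c]]) blast
  have "smooth_on ?T (\<lambda>x. (-1/2) *\<^sub>R
     (bil (gram A g c (icrd c x)) u (frame2 \<Phi> (s (icrd c x)) c - frame3 \<Phi> (s (icrd c x)) c)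
        *\<^sub>R spin_prod (\<psi> (s (icrd c x)) $ 1) (\<psi> (s (icrd c x)) $ 1)
      + bil (gram A g c (icrd c x)) u (frame2 \<Phi> (s (icrd c x)) c + frame3 \<Phi> (s (icrd c x)) c)
        *\<^sub>R spin_prod (\<psi> (s (icrd c x)) $ 2) (\<psi> (s (icrd c x)) $ 2)))"
    by (intro smooth_on_scaleR smooth_on_const smooth_on_add smooth_on_diff smooth_on_bil
      smooth_on_bilinear[OF _ bounded_bilinear_spin_prod] smooth_on_vec_nth sm gm)
  then have "smooth_on ?T (\<lambda>x. xi \<psi> c (icrd c x) u)"
    by (rule smooth_on_cong[OF sm(4), rotated]) (simp add: xi_local[OF equi s c] covec_def)
  then show "\<exists>T. open T \<and> x \<in> T \<and> smooth_on T (\<lambda>x. xi \<psi> c (icrd c x) u)" using sm(4) xU by blast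
qed

lemma smooth_normal:
  assumes c: "c \<in> A"
  shows "smooth_on (crd c ` cdom c) (\<lambda>x. normal \<psi> (icrd c x))"
proof (rule smooth_on_local)
  fix x assume x: "x \<in> crd c ` cdom c"
  obtain U s where s: "spinorial_frame A \<Phi> U s" and xU: "x \<in> crd c ` (U \<inter> cdom c)"
    using chart_section[OF c x] by blast
  let ?T = "crd c ` (U \<inter> cdom c)"
  note sm = smooth_section[OF s c]
  have "smooth_on ?T (\<lambda>x. spin_prod (\<psi> (s (icrd c x)) $ 1) (\<psi> (s (icrd c x)) $ 2))"
    by (intro smooth_on_bilinear[OF _ bounded_bilinear_spin_prod] smooth_on_vec_nth sm)
  then have "smooth_on ?T (\<lambda>x. normal \<psi> (icrd c x))"
  proof (rule smooth_on_cong[OF sm(4), rotated])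
    fix y assume "y \<in> ?T"
    then show "spin_prod (\<psi> (s (icrd c y)) $ 1) (\<psi> (s (icrd c y)) $ 2) = normal \<psi> (icrd c y)"
      using normal_eq[OF equi, of "s (icrd c y)"] xi_local(2)[OF equi s c] by simp
  qed
  then show "\<exists>T. open T \<and> x \<in> T \<and> smooth_on T (\<lambda>x. normal \<psi> (icrd c x))" using sm(4) xU by blast
qed

lemma linear_xi: "linear (xi \<psi> c p)"
  unfolding xi_def covec_def by (rule linearI) (simp_all add: bil_simps algebra_simps)

text \<open>The form takes the null basis of the tangent plane to two null vectors with the same product.\<close>

lemma xi_isometric:
  assumes c: "around c p"
  shows "mink (xi \<psi> c p u) (xi \<psi> c p w) = bil (gram A g c p) u w" "mink (normal \<psi> p) (xi \<psi> c p u) = 0"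
    "mink (normal \<psi> p) (normal \<psi> p) = 1"
proof -
  let ?q = "some_frame p"
  let ?G = "gram A g c p" and ?ep = "frame2 \<Phi> ?q c + frame3 \<Phi> ?q c" and ?em = "frame2 \<Phi> ?q c - frame3 \<Phi> ?q c"
  have f: "lorentz_frame ?G (frame2 \<Phi> ?q c) (frame3 \<Phi> ?q c)" using lorentz_frame_chart[of c ?q] c by simp
  have comm: "bil ?G a b = bil ?G b a" for a b using bil_commute[OF gram_sym[OF c]] .
  have m: "mink (spin_prod (\<psi> ?q $ 1) (\<psi> ?q $ 1)) (spin_prod (\<psi> ?q $ 2) (\<psi> ?q $ 2)) = -2"
    "mink (spin_prod (\<psi> ?q $ 2) (\<psi> ?q $ 2)) (spin_prod (\<psi> ?q $ 1) (\<psi> ?q $ 1)) = -2"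
    using mink_spin_prod(2)[of "\<psi> ?q $ 1" "\<psi> ?q $ 2"] area_one[of ?q] mink_commute by simp_all
  have gen: "bil ?G (a *\<^sub>R x + b *\<^sub>R y) w = a * bil ?G w x + b * bil ?G w y" for a b x y
    by (simp add: bil_simps comm[of x w] comm[of y w])
  have "bil ?G u w = bil ?G ((- bil ?G u ?em / 2) *\<^sub>R ?ep + (- bil ?G u ?ep / 2) *\<^sub>R ?em) w"
    using lorentz_frame_expansion[OF f, of u] by simp
  also have "\<dots> = - (bil ?G u ?em * bil ?G w ?ep + bil ?G u ?ep * bil ?G w ?em) / 2"
    unfolding gen by (simp add: field_simps)
  also have "\<dots> = mink (xi \<psi> c p u) (xi \<psi> c p w)"
    unfolding xi_def covec_def pr_some_frame by (simp add: mink_simps mink_spin_prod(1) m field_simps)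
  finally show "mink (xi \<psi> c p u) (xi \<psi> c p w) = bil ?G u w" by simp
  show "mink (normal \<psi> p) (xi \<psi> c p u) = 0"
    unfolding xi_def covec_def normal_def
    using mink_spin_prod(3,4)[where z="\<psi> ?q $ 1" and w="\<psi> ?q $ 2"]
    by (simp add: mink_simps mink_commute[of "spin_prod (\<psi> ?q $ 1) (\<psi> ?q $ 2)"])
  show "mink (normal \<psi> p) (normal \<psi> p) = 1"
    unfolding normal_def mink_spin_prod area_one by simp
qed

lemma xi_closed:
  assumes c: "c \<in> A" and x: "x \<in> crd c ` cdom c"
  shows "frechet_derivative (\<lambda>x. xi \<psi> c (icrd c x) u) (at x) v = frechet_derivative (\<lambda>x. xi \<psi> c (icrd c x) v) (at x) u"
proof -
  obtain q where q: "pr q = icrd c x" using frame_over by blast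
  have ax: "around c (pr q)" "crd c (pr q) = x" using chart_image'[OF c x] q by simp_all
  show ?thesis
    using dirac_iff_xi[OF spinor area_one ax(1), unfolded ax(2)] dirac[of q] by blast
qed

definition primitive :: "'m set \<Rightarrow> ('m \<Rightarrow> real^3) \<Rightarrow> bool" where
  "primitive U f \<longleftrightarrow> open U \<and>
     (\<forall>p\<in>U. \<forall>c. around c p \<longrightarrow> ((\<lambda>x. f (icrd c x)) has_derivative xi \<psi> c p) (at (crd c p)))"

lemma primitiveI:
  assumes "open U" "\<And>p. p \<in> U \<Longrightarrow> \<exists>c. around c p \<and> ((\<lambda>x. f (icrd c x)) has_derivative xi \<psi> c p) (at (crd c p))"
  shows "primitive U f"
  unfolding primitive_def
proof (intro conjI ballI allI impI)
  show "open U" by (rule assms(1))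
  fix p d assume p: "p \<in> U" and d: "around d p"
  obtain c where c: "around c p" "((\<lambda>x. f (icrd c x)) has_derivative xi \<psi> c p) (at (crd c p))" using assms(2)[OF p] by blast
  have "xi \<psi> c p (jac d c p u) = xi \<psi> d p u" for u by (rule xi_jac[OF d c(1)])
  with has_derivative_chart_change[OF c(1) d c(2)]
  show "((\<lambda>x. f (icrd d x)) has_derivative xi \<psi> d p) (at (crd d p))" by simp
qed

lemma primitive_add:
  assumes f: "primitive U f"
  shows "primitive U (\<lambda>x. f x + k)"
  unfolding primitive_def
proof (intro conjI ballI allI impI)
  show "open U" using f unfolding primitive_def by blast
  fix p c assume "p \<in> U" "around c p"
  then have "((\<lambda>x. f (icrd c x)) has_derivative xi \<psi> c p) (at (crd c p))"
    using f unfolding primitive_def by blast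
  from has_derivative_add[OF this has_derivative_const[of k]]
  show "((\<lambda>x. f (icrd c x) + k) has_derivative xi \<psi> c p) (at (crd c p))" by simp
qed

lemma primitive_covering:
  "\<exists>U. open U \<and> p \<in> U \<and> (\<forall>x\<in>U. \<forall>y\<in>UNIV. \<exists>f. primitive U f \<and> f x = y)"
proof -
  obtain c where c: "around c p" using exists_chart by blast
  then have cA: "c \<in> A" by (simp add: around_def)
  let ?R = "crd c ` cdom c"
  obtain B f where B: "open B" "convex B" "crd c p \<in> B" "B \<subseteq> ?R"
    and f: "\<And>x. x \<in> B \<Longrightarrow> (f has_derivative (\<lambda>u. u$1 *\<^sub>R xi \<psi> c (icrd c x) (axis 1 1) + u$2 *\<^sub>R xi \<psi> c (icrd c x) (axis 2 1))) (at x)"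
    by (rule closed_form_local_primitive[OF chart_open_range[OF cA] _ smooth_xi[OF cA, of "axis 1 1"] smooth_xi[OF cA, of "axis 2 1"]
          xi_closed[OF cA]]) (use c in \<open>auto simp: around_def\<close>)
  let ?U = "icrd c ` B"
  have U: "open ?U" "p \<in> ?U"
    using open_icrd_image[OF cA B(1,4)] imageI[OF B(3), of "icrd c"] c by simp_all
  have "primitive ?U (\<lambda>y. f (crd c y))"
  proof (rule primitiveI[OF U(1)])
    fix y assume "y \<in> ?U"
    then obtain x where x: "x \<in> B" "y = icrd c x" by blast
    have y: "around c y" "crd c y = x" using chart_image'[OF cA, of x] x B(4) by auto
    have "(f has_derivative xi \<psi> c y) (at (crd c y))"
      using f[OF x(1)] x(2) y by (simp add: linear_real_2[OF linear_xi, symmetric])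
    then have "((\<lambda>x. f (crd c (icrd c x))) has_derivative xi \<psi> c y) (at (crd c y))"
      by (rule has_derivative_cong_open[OF _ B(1)]) (use x y B(4) chart_image'[OF cA] in auto)
    then show "\<exists>c'. around c' y \<and> ((\<lambda>x. f (crd c (icrd c' x))) has_derivative xi \<psi> c' y) (at (crd c' y))"
      using y by blast
  qed
  note pf = primitive_add[OF this]
  have "\<exists>h. primitive ?U h \<and> h x = y" for x y
    by (rule exI[of _ "\<lambda>z. f (crd c z) + (y - f (crd c x))"]) (use pf in simp)
  then show ?thesis using U by blast
qed

lemma primitive_separation:
  assumes f: "primitive U f" and h: "primitive V h" and x: "x \<in> U" "x \<in> V"
  shows "\<exists>W. open W \<and> x \<in> W \<and> W \<subseteq> U \<inter> V \<and> (\<forall>w\<in>W. f w = h w \<longleftrightarrow> f x = h x)"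
proof -
  obtain c where c: "around c x" using exists_chart by blast
  then have cA: "c \<in> A" by (simp add: around_def)
  have UV: "open (U \<inter> V)" "x \<in> U \<inter> V" using f h x unfolding primitive_def by auto
  obtain e where e: "e > 0" "ball (crd c x) e \<subseteq> crd c ` (U \<inter> V \<inter> cdom c)"
    "open (icrd c ` ball (crd c x) e)" "x \<in> icrd c ` ball (crd c x) e" "icrd c ` ball (crd c x) e \<subseteq> U \<inter> V"
    by (rule chart_disc[OF c UV])
  let ?B = "ball (crd c x) e"
  have der: "((\<lambda>y. f (icrd c y) - h (icrd c y)) has_derivative (\<lambda>v. 0)) (at y within ?B)" if y: "y \<in> ?B" for y
  proof -
    have iy: "around c (icrd c y)" "crd c (icrd c y) = y" "icrd c y \<in> U" "icrd c y \<in> V"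
      using chart_image[OF cA, of y "U \<inter> V"] y e(2) by auto
    have d: "((\<lambda>y. k (icrd c y)) has_derivative xi \<psi> c (icrd c y)) (at y)"
      if "primitive X k" "icrd c y \<in> X" for X k
      using that(1)[unfolded primitive_def, THEN conjunct2, rule_format, OF that(2) iy(1)] unfolding iy(2) .
    have "((\<lambda>y. f (icrd c y) - h (icrd c y)) has_derivative (\<lambda>v. xi \<psi> c (icrd c y) v - xi \<psi> c (icrd c y) v)) (at y)"
      by (rule has_derivative_diff[OF d[OF f iy(3)] d[OF h iy(4)]])
    then show ?thesis by (simp add: has_derivative_at_withinI)
  qed
  have const: "f (icrd c y) - h (icrd c y) = f (icrd c (crd c x)) - h (icrd c (crd c x))" if "y \<in> ?B" for y
    by (rule has_derivative_zero_unique[OF convex_ball der that]) (use e in auto)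
  have "f w = h w \<longleftrightarrow> f x = h x" if w: "w \<in> icrd c ` ?B" for w
  proof -
    obtain y where "y \<in> ?B" "w = icrd c y" using w by blast
    then have "f w - h w = f x - h x" using const[of y] c by simp
    then show ?thesis by (metis eq_iff_diff_eq_0)
  qed
  then show ?thesis using e by blast
qed

lemma global_primitive:
  assumes "simply_connected (UNIV :: 'm set)"
  obtains F where "\<And>p c. around c p \<Longrightarrow> ((\<lambda>x. F (icrd c x)) has_derivative xi \<psi> c p) (at (crd c p))"
proof -
  interpret local_sections "\<lambda>_::'m. UNIV :: (real^3) set" primitive
    by unfold_locales (rule primitive_covering, simp, rule primitive_separation)
  have "\<exists>F. (\<forall>x. F x \<in> (UNIV :: (real^3) set)) \<and> (\<forall>U f x. primitive U f \<and> x \<in> U \<and> f x = F x \<longrightarrow>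
      (\<exists>W. open W \<and> x \<in> W \<and> W \<subseteq> U \<and> (\<forall>w\<in>W. F w = f w)))"
    by (rule monodromy[OF assms locally_path_connected_surface UNIV_I])
  then obtain F where F: "\<forall>U f x. primitive U f \<and> x \<in> U \<and> f x = F x \<longrightarrow>
      (\<exists>W. open W \<and> x \<in> W \<and> W \<subseteq> U \<and> (\<forall>w\<in>W. F w = f w))"
    by (elim exE conjE)
  have "((\<lambda>x. F (icrd c x)) has_derivative xi \<psi> c p) (at (crd c p))" if c: "around c p" for p c
  proof -
    have cA: "c \<in> A" using c by (simp add: around_def)
    obtain U f where U: "p \<in> U" "primitive U f" "f p = F p" using primitive_covering[of p] by blast
    obtain W where W: "open W" "p \<in> W" "\<forall>w\<in>W. F w = f w" using F[rule_format, of U f p] U by auto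
    have "((\<lambda>x. f (icrd c x)) has_derivative xi \<psi> c p) (at (crd c p))" using U c unfolding primitive_def by blast
    then show ?thesis
      by (rule has_derivative_cong_open[OF _ open_chart_image[OF cA W(1)] crd_in[OF c W(2)]])
        (use W(3) chart_image[OF cA] in auto)
  qed
  then show ?thesis using that by blast
qed

lemma immersion_of_spinor:
  assumes "simply_connected (UNIV :: 'm set)"
  shows "\<exists>F N. isometric_immersion A g F \<and> unit_normal_field A F N \<and>
            (\<forall>p. mean_curvature_vector A g F p = H p *\<^sub>R N p)"
proof -
  obtain F where F: "\<And>p c. around c p \<Longrightarrow> ((\<lambda>x. F (icrd c x)) has_derivative xi \<psi> c p) (at (crd c p))"
    using global_primitive[OF assms] by blast
  have fd: "frechet_derivative (F \<circ> icrd c) (at x) = xi \<psi> c (icrd c x)" if "c \<in> A" "x \<in> crd c ` cdom c" for c x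
    using frechet_derivative_eqI[OF F, of c "icrd c x"] chart_image'[OF that] by (simp add: o_def)
  have dF: "differential A F p v = xi \<psi> c p (v c)" if "around c p" "v \<in> tangent_space A p" for c p v
    by (rule differential_chart[OF that(1) F[OF that(1)] that(2)])
  have iso: "mink (differential A F p v) (differential A F p w) = g p v w"
    if "v \<in> tangent_space A p" "w \<in> tangent_space A p" for p v w
  proof -
    obtain c where c: "around c p" using exists_chart by blast
    show ?thesis using that c by (simp add: dF[OF c] xi_isometric metric_bil)
  qed
  have "smooth_map_on A UNIV F"
    unfolding smooth_map_on_def
  proof
    fix c assume c: "c \<in> A"
    have "smooth_on (crd c ` cdom c) (F \<circ> icrd c)"
    proof (rule smooth_onI_derivative[OF chart_open_range[OF c] _ smooth_xi[OF c]])
      fix x assume "x \<in> crd c ` cdom c"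
      then show "((F \<circ> icrd c) has_derivative xi \<psi> c (icrd c x)) (at x)"
        using F[of c "icrd c x"] chart_image'[OF c] by (simp add: o_def)
    qed
    then show "smooth_on (crd c ` (UNIV \<inter> cdom c)) (F \<circ> icrd c)" by simp
  qed
  moreover have "inj_on (differential A F p) (tangent_space A p)" for p
  proof (rule inj_onI)
    fix v w assume v: "v \<in> tangent_space A p" and w: "w \<in> tangent_space A p" and eq: "differential A F p v = differential A F p w"
    obtain c where c: "around c p" using exists_chart by blast
    obtain e2 e3 where e: "lorentz_frame (gram A g c p) e2 e3" using exists_lorentz_frame[OF c] by blast
    have "xi \<psi> c p (v c) = xi \<psi> c p (w c)" using eq dF[OF c] v w by simp
    then have "bil (gram A g c p) (v c) u = bil (gram A g c p) (w c) u" for u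
      using xi_isometric(1)[OF c] by metis
    then have "v c = w c" by (rule lorentz_frame_nondegenerate[OF e])
    then show "v = w" using tangent_eq_tvec[OF v c] tangent_eq_tvec[OF w c] by simp
  qed
  ultimately have im: "isometric_immersion A g F" using iso unfolding isometric_immersion_def by blast
  have nor: "unit_normal_field A F (normal \<psi>)"
    unfolding unit_normal_field_def smooth_map_on_def
  proof (intro conjI allI ballI)
    fix c assume "c \<in> A"
    then show "smooth_on (crd c ` (UNIV \<inter> cdom c)) (normal \<psi> \<circ> icrd c)"
      using smooth_normal[of c] by (simp add: o_def)
  next
    fix p
    obtain c where c: "around c p" using exists_chart by blast
    show "mink (normal \<psi> p) (normal \<psi> p) = 1" by (rule xi_isometric(3)[OF c])
    fix v assume "v \<in> tangent_space A p"
    then show "mink (normal \<psi> p) (differential A F p v) = 0" using dF[OF c] xi_isometric(2)[OF c] by simp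
  qed
  have "mean_curvature_vector A g F p = H p *\<^sub>R normal \<psi> p" for p
  proof -
    let ?c = "chart_at A p"
    have c: "around ?c p" by (rule around_chart_at)
    then have cA: "?c \<in> A" by (simp add: around_def)
    obtain q where q: "pr q = p" using frame_over by blast
    let ?ep = "frame2 \<Phi> q ?c + frame3 \<Phi> q ?c" and ?em = "frame2 \<Phi> q ?c - frame3 \<Phi> q ?c"
    have e: "lorentz_frame (gram A g ?c p) (frame2 \<Phi> q ?c) (frame3 \<Phi> q ?c)"
      using lorentz_frame_chart[of ?c q] c q by simp
    have K: "frechet_derivative (\<lambda>x. frechet_derivative (F \<circ> icrd ?c) (at x) u) (at (crd ?c p))
        = frechet_derivative (\<lambda>x. xi \<psi> ?c (icrd ?c x) u) (at (crd ?c p))" for u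
    proof (rule frechet_derivative_cong_open[OF chart_open_range[OF cA], symmetric])
      show x0: "crd ?c p \<in> crd ?c ` cdom ?c" using c by (simp add: around_def)
      show "xi \<psi> ?c (icrd ?c y) u = frechet_derivative (F \<circ> icrd ?c) (at y) u" if "y \<in> crd ?c ` cdom ?c" for y
        using fd[OF cA that] by simp
      show "(\<lambda>x. xi \<psi> ?c (icrd ?c x) u) differentiable at (crd ?c p)"
        by (rule smooth_on_differentiable[OF smooth_xi[OF cA] x0])
    qed
    have "mink (frechet_derivative (\<lambda>x. xi \<psi> ?c (icrd ?c x) ?em) (at (crd ?c p)) ?ep) (normal \<psi> p)
       + mink (frechet_derivative (\<lambda>x. xi \<psi> ?c (icrd ?c x) ?ep) (at (crd ?c p)) ?em) (normal \<psi> p) = - 4 * H p"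
    proof -
      have "dirac A g \<Phi> \<psi> q = H p *\<^sub>R \<psi> q" using dirac[of q] q by simp
      from dirac_iff_xi(1)[OF spinor area_one, of ?c q, unfolded q, OF c, THEN iffD1, OF this]
      show ?thesis by blast
    qed
    then show ?thesis
      using mean_curvature_null_frame[OF im nor e] unfolding K by simp
  qed
  then show ?thesis using im nor by blast
qed

end


section \<open>From an immersion to a spinor field\<close>

context lorentz_surface
begin

lemma smooth_map_continuous:
  assumes f: "smooth_map_on A U f" and U: "open U"
  shows "continuous_on U f"
proof -
  have "continuous_on (U \<inter> cdom c) f" if cA: "c \<in> A" for c
  proof -
    have "continuous_on (crd c ` (U \<inter> cdom c)) (f \<circ> icrd c)"
      using f cA unfolding smooth_map_on_def by (blast intro: smooth_on_continuous_on)
    moreover have "continuous_on (U \<inter> cdom c) (crd c)"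
      using homeomorphism_cont1[OF chart_homeomorphism[OF cA]] continuous_on_subset by blast
    ultimately have "continuous_on (U \<inter> cdom c) (\<lambda>x. (f \<circ> icrd c) (crd c x))"
      by (rule continuous_on_compose2) blast
    then show ?thesis
      by (rule continuous_on_eq) (use cA in \<open>simp add: around_def\<close>)
  qed
  then have "continuous_on (\<Union>c\<in>A. U \<inter> cdom c) f"
    by (intro continuous_on_open_UN) (use U chart_open_domain in auto)
  moreover have "(\<Union>c\<in>A. U \<inter> cdom c) = U" using exists_chart unfolding around_def by blast
  ultimately show ?thesis by simp
qed

lemma smooth_map_on_local:
  assumes "\<And>p. p \<in> U \<Longrightarrow> \<exists>W. open W \<and> p \<in> W \<and> W \<subseteq> U \<and> smooth_map_on A W f"
  shows "smooth_map_on A U f"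
  unfolding smooth_map_on_def
proof (intro ballI smooth_on_local)
  fix c x assume c: "c \<in> A" and x: "x \<in> crd c ` (U \<inter> cdom c)"
  have ix: "around c (icrd c x)" "icrd c x \<in> U" "crd c (icrd c x) = x" using chart_image[OF c x] by auto
  then obtain W where W: "open W" "icrd c x \<in> W" "smooth_map_on A W f" using assms by blast
  show "\<exists>T. open T \<and> x \<in> T \<and> smooth_on T (f \<circ> icrd c)"
    using open_chart_image[OF c W(1)] crd_in[OF ix(1) W(2)] ix(3) W(3) c
    unfolding smooth_map_on_def by auto
qed

end

locale immersed_surface = spin_surface A g T S \<Phi> act for A :: "'m::topological_space chart set" and g T S
    and \<Phi> :: "'q::topological_space \<Rightarrow> 'm frame" and act +
  fixes F N :: "'m \<Rightarrow> real^3" and H :: "'m \<Rightarrow> real"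
  assumes immersion: "isometric_immersion A g F" and unit_normal: "unit_normal_field A F N"
    and mean_curvature: "\<And>p. mean_curvature_vector A g F p = H p *\<^sub>R N p"
begin

definition dF :: "'m chart \<Rightarrow> 'm \<Rightarrow> real^2 \<Rightarrow> real^3" where
  "dF c p = frechet_derivative (F \<circ> icrd c) (at (crd c p))"

text \<open>The images of the null vectors \<open>e\<^sub>2 + e\<^sub>3\<close> and \<open>e\<^sub>2 - e\<^sub>3\<close> of the frame \<open>q\<close>.\<close>

definition null_plus :: "'q \<Rightarrow> real^3" where
  "null_plus q = differential A F (pr q) (frame2 \<Phi> q) + differential A F (pr q) (frame3 \<Phi> q)"

definition null_minus :: "'q \<Rightarrow> real^3" where
  "null_minus q = differential A F (pr q) (frame2 \<Phi> q) - differential A F (pr q) (frame3 \<Phi> q)"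

lemma linear_dF: "around c p \<Longrightarrow> linear (dF c p)"
  unfolding dF_def by (rule has_derivative_linear[OF immersion_in_chart(2)[OF immersion]])

lemma null_in_chart:
  assumes c: "around c (pr q)"
  shows "null_plus q = dF c (pr q) (frame2 \<Phi> q c + frame3 \<Phi> q c)"
    "null_minus q = dF c (pr q) (frame2 \<Phi> q c - frame3 \<Phi> q c)"
  unfolding null_plus_def null_minus_def linear_add[OF linear_dF[OF c]] linear_diff[OF linear_dF[OF c]]
  using immersion_in_chart(3)[OF immersion c] frame_tangent by (simp_all add: dF_def)

lemma null_frame_image: "null_frame (null_plus q) (null_minus q) (N (pr q))"
proof -
  obtain c where c: "around c (pr q)" using exists_chart by blast
  show ?thesis
    unfolding null_in_chart[OF c] dF_def
    by (rule null_frame_immersion[OF immersion unit_normal c lorentz_frame_chart[OF c]])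
qed

lemma null_act:
  assumes h: "h \<noteq> 0"
  shows "null_plus (act q h) = (inverse h)\<^sup>2 *\<^sub>R null_plus q" "null_minus (act q h) = h\<^sup>2 *\<^sub>R null_minus q"
proof -
  obtain c where c: "around c (pr q)" using exists_chart by blast
  then have c': "around c (pr (act q h))" using h by simp
  show "null_plus (act q h) = (inverse h)\<^sup>2 *\<^sub>R null_plus q" "null_minus (act q h) = h\<^sup>2 *\<^sub>R null_minus q"
    unfolding null_in_chart[OF c'] null_in_chart[OF c] null_frames_act[OF h] proj_act[OF h]
    by (simp_all add: linear_scale[OF linear_dF[OF c]])
qed

lemma smooth_null:
  assumes s: "spinorial_frame A \<Phi> U s"
  shows "smooth_map_on A U (\<lambda>x. null_plus (s x))" "smooth_map_on A U (\<lambda>x. null_minus (s x))" "smooth_map_on A U N"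
proof -
  have U: "open U" "\<And>x. x \<in> U \<Longrightarrow> pr (s x) = x" using s unfolding spinorial_frame_def by blast+
  have sm: "smooth_on (crd c ` (U \<inter> cdom c)) (\<lambda>x. dF c (icrd c x) (e x))"
    if c: "c \<in> A" and e: "smooth_on (crd c ` (U \<inter> cdom c)) e" for c e
  proof -
    let ?T = "crd c ` (U \<inter> cdom c)"
    have T: "open ?T" by (rule open_chart_image[OF c U(1)])
    have F: "smooth_on ?T (F \<circ> icrd c)"
      by (rule smooth_on_mono[of _ "crd c ` (UNIV \<inter> cdom c)"])
        (use immersion c in \<open>auto simp: isometric_immersion_def smooth_map_on_def\<close>)
    have "smooth_on ?T (\<lambda>x. e x $ 1 *\<^sub>R frechet_derivative (F \<circ> icrd c) (at x) (axis 1 1)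
        + e x $ 2 *\<^sub>R frechet_derivative (F \<circ> icrd c) (at x) (axis 2 1))"
      by (intro smooth_on_add smooth_on_scaleR smooth_on_vec_nth smooth_on_frechet_derivative T e F)
    then show ?thesis
    proof (rule smooth_on_cong[OF T, rotated])
      fix x assume "x \<in> ?T"
      then have x: "around c (icrd c x)" "crd c (icrd c x) = x" using chart_image[OF c] by auto
      show "e x $ 1 *\<^sub>R frechet_derivative (F \<circ> icrd c) (at x) (axis 1 1)
        + e x $ 2 *\<^sub>R frechet_derivative (F \<circ> icrd c) (at x) (axis 2 1) = dF c (icrd c x) (e x)"
        using linear_real_2[OF linear_dF[OF x(1)], of "e x"] x(2) by (simp add: dF_def)
    qed
  qed
  have e: "smooth_on (crd c ` (U \<inter> cdom c)) (\<lambda>x. frame2 \<Phi> (s (icrd c x)) c)"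
    "smooth_on (crd c ` (U \<inter> cdom c)) (\<lambda>x. frame3 \<Phi> (s (icrd c x)) c)" if "c \<in> A" for c
    using s that unfolding spinorial_frame_def smooth_vector_field_on_def by blast+
  have T: "open (crd c ` (U \<inter> cdom c))" if "c \<in> A" for c by (rule open_chart_image[OF that U(1)])
  have ch: "around c (pr (s (icrd c x)))" "pr (s (icrd c x)) = icrd c x" if "c \<in> A" "x \<in> crd c ` (U \<inter> cdom c)" for c x
    using chart_image[OF that] U(2) by auto
  show "smooth_map_on A U (\<lambda>x. null_plus (s x))"
    unfolding smooth_map_on_def o_def
  proof
    fix c assume c: "c \<in> A"
    show "smooth_on (crd c ` (U \<inter> cdom c)) (\<lambda>x. null_plus (s (icrd c x)))"
      by (rule smooth_on_cong[OF T[OF c] _ sm[OF c smooth_on_add[OF T[OF c] e[OF c]]]])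
        (simp add: null_in_chart[OF ch(1)[OF c]] ch(2)[OF c])
  qed
  show "smooth_map_on A U (\<lambda>x. null_minus (s x))"
    unfolding smooth_map_on_def o_def
  proof
    fix c assume c: "c \<in> A"
    show "smooth_on (crd c ` (U \<inter> cdom c)) (\<lambda>x. null_minus (s (icrd c x)))"
      by (rule smooth_on_cong[OF T[OF c] _ sm[OF c smooth_on_diff[OF T[OF c] e[OF c]]]])
        (simp add: null_in_chart[OF ch(1)[OF c]] ch(2)[OF c])
  qed
  show "smooth_map_on A U N"
    using unit_normal unfolding unit_normal_field_def smooth_map_on_def
    by (auto intro: smooth_on_mono[rotated])
qed

text \<open>The value \<open>y\<close> of a spinor field in the frame \<open>q\<close> represents the immersion, reflected by \<open>\<sigma>\<close> and \<open>\<tau>\<close>.\<close>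

definition lifts :: "real \<Rightarrow> real \<Rightarrow> 'q \<Rightarrow> complex^2 \<Rightarrow> bool" where
  "lifts \<sigma> \<tau> q y \<longleftrightarrow> \<sigma>\<^sup>2 = 1 \<and> \<tau>\<^sup>2 = 1 \<and>
     spins (y $ 1) (y $ 2) (flip \<sigma> \<tau> (null_plus q)) (flip \<sigma> \<tau> (null_minus q)) (flip \<sigma> \<tau> (N (pr q)))"

lemma lifts_minus: "lifts \<sigma> \<tau> q y \<Longrightarrow> lifts \<sigma> \<tau> q (- y)"
  by (simp add: lifts_def spins_minus)

lemma lifts_act:
  assumes "lifts \<sigma> \<tau> q y" "h \<noteq> 0"
  shows "lifts \<sigma> \<tau> (act q h) (rho (inverse h) *v y)"
  using assms spins_scale[of "y $ 1" "y $ 2" _ _ _ h]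
  unfolding lifts_def null_act[OF assms(2)] proj_act[OF assms(2)] rho_nth
  by (simp add: linear_simps(5)[OF bounded_linear_flip])

lemma lifts_unique:
  assumes "lifts \<sigma> \<tau> q y" "lifts \<sigma>' \<tau>' q y'"
  shows "y' = y \<or> y' = - y"
  using spins_unique[OF null_frame_image[of q], of \<sigma> \<tau> \<sigma>' \<tau>' "y $ 1" "y $ 2" "y' $ 1" "y' $ 2"] assms
  by (auto simp: lifts_def vec_eq_iff forall_2)

lemma lifts_nonzero: "lifts \<sigma> \<tau> q y \<Longrightarrow> y $ 1 \<noteq> 0"
  using spins_nonzero unfolding lifts_def by blast

text \<open>The square of the first component is the complex number formed by the first and third coordinates
  of the null vector. Divided by its value at \<open>p\<close> it is near \<open>1\<close>, where the principal branch of the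
  root is continuous. The reflection that is right at \<open>p\<close> remains right nearby, since time direction and area
  keep their signs.\<close>

lemma local_lift:
  obtains U V s t \<zeta> \<sigma> \<tau> where "open U" "p \<in> U" "spinorial_frame A \<Phi> V s" "U \<subseteq> V"
    "homeomorphism (V \<times> Spin11) {q. pr q \<in> V} (\<lambda>(x, h). act (s x) h) t"
    "continuous_on U \<zeta>" "\<forall>x\<in>U. lifts \<sigma> \<tau> (s x) (\<zeta> x)"
proof -
  obtain V s t where p: "p \<in> V" and s: "spinorial_frame A \<Phi> V s"
    and t: "homeomorphism (V \<times> Spin11) {q. pr q \<in> V} (\<lambda>(x, h). act (s x) h) t"
    using trivialization by blast
  have V: "open V" "\<And>x. x \<in> V \<Longrightarrow> pr (s x) = x" using s unfolding spinorial_frame_def by blast+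
  obtain \<sigma> \<tau> z0 w0 where st: "\<sigma>\<^sup>2 = 1" "\<tau>\<^sup>2 = 1"
    and sp0: "spins z0 w0 (flip \<sigma> \<tau> (null_plus (s p))) (flip \<sigma> \<tau> (null_minus (s p))) (flip \<sigma> \<tau> (N (pr (s p))))"
    using null_frame_spins[OF null_frame_image] by blast
  define n where "n x = flip \<sigma> \<tau> (null_plus (s x))" for x
  define M where "M x = flip \<sigma> \<tau> (N x)" for x
  have cn: "continuous_on V n" "continuous_on V M"
    unfolding n_def M_def
    by (intro bounded_linear.continuous_on[OF bounded_linear_flip] smooth_map_continuous[OF _ V(1)] smooth_null[OF s])+
  have z0: "z0 \<noteq> 0" "n p $ 2 > 0" "z0\<^sup>2 = Complex (n p $ 1) (n p $ 3)" "z0 * w0 = Complex (M p $ 1) (M p $ 3)"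
    "area z0 w0 = 1"
    using spins_nonzero[OF sp0] spins_square[OF sp0] sp0 V(2)[OF p] by (auto simp: n_def M_def spins_def)
  define r where "r x = Complex (n x $ 1) (n x $ 3) / z0\<^sup>2" for x
  have cr: "continuous_on V r" unfolding r_def
    by (intro continuous_intros cn continuous_on_component) (use z0 in auto)
  define V1 where "V1 = {x \<in> V. n x $ 2 > 0 \<and> Re (r x) > 0}"
  have "V1 = V \<inter> (\<lambda>x. n x $ 2) -` {0<..} \<inter> (V \<inter> (\<lambda>x. Re (r x)) -` {0<..})"
    by (auto simp: V1_def)
  moreover have "open (V \<inter> (\<lambda>x. n x $ 2) -` {0<..})" "open (V \<inter> (\<lambda>x. Re (r x)) -` {0<..})"
    by (intro continuous_open_preimage V(1) open_greaterThan continuous_intros cn cr)+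
  ultimately have V1: "open V1" "V1 \<subseteq> V" by (auto simp: V1_def)
  have rp: "r p = 1" using z0(1) unfolding r_def z0(3)[symmetric] by simp
  have "p \<in> V1" using p z0 rp by (simp add: V1_def)
  define z where "z x = z0 * csqrt (r x)" for x
  have z2: "(z x)\<^sup>2 = Complex (n x $ 1) (n x $ 3)" for x
    using z0(1) by (simp add: z_def power_mult_distrib r_def)
  have zn: "z x \<noteq> 0" if "x \<in> V1" for x
    using that z0(1) by (auto simp: z_def V1_def)
  have "continuous_on V1 (\<lambda>x. csqrt (r x))"
    by (rule continuous_on_compose2[OF continuous_on_csqrt continuous_on_subset[OF cr V1(2)]])
      (auto simp: V1_def complex_nonpos_Reals_iff)
  then have cz: "continuous_on V1 z" unfolding z_def by (intro continuous_intros)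
  define w where "w x = Complex (M x $ 1) (M x $ 3) / z x" for x
  have cw: "continuous_on V1 w" unfolding w_def
    by (intro continuous_intros continuous_on_subset[OF cn(2) V1(2)] cz) (use zn in auto)
  define V2 where "V2 = V1 \<inter> (\<lambda>x. area (z x) (w x)) -` {0<..}"
  have "open V2" unfolding V2_def area_def
    by (intro continuous_open_preimage V1(1) open_greaterThan continuous_intros cz cw)
  have "p \<in> V2"
  proof -
    have "z p = z0" using rp by (simp add: z_def)
    moreover from this have "w p = w0" using z0 by (simp add: w_def flip: z0(4))
    ultimately show ?thesis using z0(5) \<open>p \<in> V1\<close> by (simp add: V2_def)
  qed
  define \<zeta> :: "'m \<Rightarrow> complex^2" where "\<zeta> x = (\<chi> i. if i = 1 then z x else w x)" for x
  have lft: "lifts \<sigma> \<tau> (s x) (\<zeta> x)" if x: "x \<in> V2" for x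
  proof -
    have x1: "x \<in> V1" "x \<in> V" using x V1(2) by (auto simp: V2_def)
    have "spins (z x) (w x) (n x) (flip \<sigma> \<tau> (null_minus (s x))) (M x)"
    proof (rule null_frame_square_root(3))
      show "null_frame (n x) (flip \<sigma> \<tau> (null_minus (s x))) (M x)"
        using null_frame_flip[OF st null_frame_image[of "s x"]] V(2)[OF x1(2)] by (simp add: n_def M_def)
      show "n x $ 2 > 0" using x1 by (simp add: V1_def)
      show "(z x)\<^sup>2 = Complex (n x $ 1) (n x $ 3)" by (rule z2)
      show "z x * w x = Complex (M x $ 1) (M x $ 3)" using zn[OF x1(1)] by (simp add: w_def)
      show "area (z x) (w x) > 0" using x by (simp add: V2_def)
    qed
    then show ?thesis using st V(2)[OF x1(2)] by (simp add: lifts_def n_def M_def \<zeta>_def)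
  qed
  have V2: "V2 \<subseteq> V" using V1(2) unfolding V2_def by blast
  have "continuous_on V2 (\<lambda>x. if i = 1 then z x else w x)" for i :: 2
    using cz cw continuous_on_subset[of V1 _ V2] unfolding V2_def by (cases "i = 1") auto
  then have "continuous_on V2 \<zeta>" unfolding \<zeta>_def by (intro continuous_on_vec_lambda)
  then show ?thesis using that[OF \<open>open V2\<close> \<open>p \<in> V2\<close> s V2 t] lft by blast
qed

lemma rho_mult: "rho (inverse (k * h)) *v y = rho (inverse h) *v (rho (inverse k) *v y)"
  unfolding vec_eq_iff forall_2 rho_nth by (simp add: mult.commute)

text \<open>A point over \<open>p\<close> of the double covering of the surface: the restriction of a spinor field to the
  frames at \<open>p\<close>, extended by zero to the other frames.\<close>

definition fibre :: "'m \<Rightarrow> ('q \<Rightarrow> complex^2) set" where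
  "fibre p = {\<eta>. (\<forall>q. pr q \<noteq> p \<longrightarrow> \<eta> q = 0) \<and>
     (\<forall>q h. pr q = p \<and> h \<noteq> 0 \<longrightarrow> \<eta> (act q h) = rho (inverse h) *v \<eta> q) \<and>
     (\<forall>q. pr q = p \<longrightarrow> (\<exists>\<sigma> \<tau>. lifts \<sigma> \<tau> q (\<eta> q)))}"

definition lift_section :: "'m set \<Rightarrow> ('m \<Rightarrow> 'q \<Rightarrow> complex^2) \<Rightarrow> bool" where
  "lift_section U f \<longleftrightarrow> open U \<and> (\<forall>x\<in>U. f x \<in> fibre x) \<and>
     (\<forall>V s. spinorial_frame A \<Phi> V s \<longrightarrow> continuous_on (U \<inter> V) (\<lambda>x. f x (s x)))"

lemma fibreD:
  assumes "\<eta> \<in> fibre p"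
  shows "pr q \<noteq> p \<Longrightarrow> \<eta> q = 0" "pr q = p \<Longrightarrow> h \<noteq> 0 \<Longrightarrow> \<eta> (act q h) = rho (inverse h) *v \<eta> q"
    "pr q = p \<Longrightarrow> \<exists>\<sigma> \<tau>. lifts \<sigma> \<tau> q (\<eta> q)"
  using assms unfolding fibre_def by blast+

lemma fibre_eqI:
  assumes "\<eta> \<in> fibre p" "\<eta>' \<in> fibre p" "pr q = p" "\<eta> q = \<eta>' q"
  shows "\<eta> = \<eta>'"
proof
  fix r
  show "\<eta> r = \<eta>' r"
  proof (cases "pr r = p")
    case True
    then obtain h where "h \<noteq> 0" "r = act q h" using fibre_transitive[of q r] assms(3) by metis
    then show ?thesis using fibreD(2)[OF assms(1,3)] fibreD(2)[OF assms(2,3)] assms(4) by simp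
  next
    case False
    then show ?thesis using fibreD(1)[OF assms(1)] fibreD(1)[OF assms(2)] by simp
  qed
qed

lemma fibre_minus: "\<eta> \<in> fibre p \<Longrightarrow> (\<lambda>q. - \<eta> q) \<in> fibre p"
  unfolding fibre_def using lifts_minus by (auto simp: vec_eq_iff forall_2 rho_nth) blast+

lemma fibre_two_elements:
  assumes "\<eta> \<in> fibre p" "\<eta>' \<in> fibre p"
  shows "\<eta>' = \<eta> \<or> \<eta>' = (\<lambda>q. - \<eta> q)"
proof -
  obtain q where q: "pr q = p" using frame_over by blast
  have "\<eta>' q = \<eta> q \<or> \<eta>' q = - \<eta> q"
    using fibreD(3)[OF assms(1) q] fibreD(3)[OF assms(2) q] lifts_unique by blast
  then show ?thesis
    using fibre_eqI[OF assms(2,1) q] fibre_eqI[OF assms(2) fibre_minus[OF assms(1)] q] by blast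
qed

lemma local_lift_section:
  obtains U f \<sigma> \<tau> where "p \<in> U" "lift_section U f" "\<forall>q. pr q \<in> U \<longrightarrow> lifts \<sigma> \<tau> q (f (pr q) q)"
proof -
  obtain U V s t \<zeta> \<sigma> \<tau> where U: "open U" "p \<in> U" and s: "spinorial_frame A \<Phi> V s" and UV: "U \<subseteq> V"
    and t: "homeomorphism (V \<times> Spin11) {q. pr q \<in> V} (\<lambda>(x, h). act (s x) h) t"
    and z: "continuous_on U \<zeta>" "\<forall>x\<in>U. lifts \<sigma> \<tau> (s x) (\<zeta> x)"
    by (rule local_lift)
  define f where "f x q = (if pr q = x then rho (inverse (snd (t q))) *v \<zeta> x else 0)" for x q
  have k: "snd (t q) \<noteq> 0" "act (s (pr q)) (snd (t q)) = q" if "pr q \<in> U" for q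
    using trivialization_fibre[OF s t, of q] that UV by auto
  have lft: "lifts \<sigma> \<tau> q (f (pr q) q)" if q: "pr q \<in> U" for q
    using lifts_act[OF bspec[OF z(2) q] k(1)[OF q]] k(2)[OF q] by (simp add: f_def)
  have act: "f x (act q h) = rho (inverse h) *v f x q" if q: "pr q = x" "x \<in> U" and h: "h \<noteq> 0" for x q h
  proof -
    have "act q h = act (s x) (snd (t q) * h)"
      using act_mult[of "snd (t q)" h "s x"] k[of q] q h by simp
    then have "snd (t (act q h)) = snd (t q) * h"
      using trivialization_act[OF s t, of x "snd (t q) * h"] k[of q] q h UV by auto
    then show ?thesis
      using q h by (simp add: f_def rho_mult del: inverse_mult_distrib)
  qed
  have "f x \<in> fibre x" if "x \<in> U" for x
    unfolding fibre_def
  proof (intro CollectI conjI allI impI)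
    show "f x q = 0" if "pr q \<noteq> x" for q using that by (simp add: f_def)
    show "f x (act q h) = rho (inverse h) *v f x q" if "pr q = x \<and> h \<noteq> 0" for q h
      using act[of q x h] that \<open>x \<in> U\<close> by blast
    show "\<exists>\<sigma> \<tau>. lifts \<sigma> \<tau> q (f x q)" if "pr q = x" for q using lft[of q] that \<open>x \<in> U\<close> by blast
  qed
  moreover have "continuous_on (U \<inter> V') (\<lambda>x. f x (s' x))" if s': "spinorial_frame A \<Phi> V' s'" for V' s'
  proof -
    have ps: "pr (s' x) = x" if "x \<in> V'" for x using s' that unfolding spinorial_frame_def by blast
    have cs: "continuous_on (U \<inter> V') s'"
      using s' continuous_on_subset unfolding spinorial_frame_def by (metis inf_le2)
    have "continuous_on (U \<inter> V') (\<lambda>x. t (s' x))"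
      by (rule continuous_on_compose2[OF homeomorphism_cont2[OF t] cs]) (use ps UV in auto)
    then have ck: "continuous_on (U \<inter> V') (\<lambda>x. snd (t (s' x)))" by (rule continuous_on_snd)
    have cz: "continuous_on (U \<inter> V') \<zeta>" by (rule continuous_on_subset[OF z(1)]) blast
    have k0: "snd (t (s' x)) \<noteq> 0" if "x \<in> U \<inter> V'" for x using k(1)[of "s' x"] ps that by auto
    have "continuous_on (U \<inter> V') (\<lambda>x. if i = 1 then inverse (snd (t (s' x))) *\<^sub>R \<zeta> x $ 1 else snd (t (s' x)) *\<^sub>R \<zeta> x $ 2)" for i :: 2
      by (cases "i = 1"; simp; intro continuous_intros ck cz ballI k0; assumption?)
    then have "continuous_on (U \<inter> V') (\<lambda>x. \<chi> i::2. if i = 1 then inverse (snd (t (s' x))) *\<^sub>R \<zeta> x $ 1 else snd (t (s' x)) *\<^sub>R \<zeta> x $ 2)"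
      by (intro continuous_on_vec_lambda)
    then show ?thesis
      by (rule continuous_on_eq) (auto simp: f_def ps vec_eq_iff forall_2 rho_nth)
  qed
  ultimately have "lift_section U f" using U unfolding lift_section_def by blast
  then show ?thesis using that[OF U(2)] lft by blast
qed

lemma lift_section_minus: "lift_section U f \<Longrightarrow> lift_section U (\<lambda>x q. - f x q)"
  unfolding lift_section_def using fibre_minus by (auto intro: continuous_on_minus)

lemma lift_section_covering:
  "\<exists>U. open U \<and> p \<in> U \<and> (\<forall>x\<in>U. \<forall>y\<in>fibre x. \<exists>f. lift_section U f \<and> f x = y)"
proof -
  obtain U f \<sigma> \<tau> where U: "p \<in> U" "lift_section U f" "\<forall>q. pr q \<in> U \<longrightarrow> lifts \<sigma> \<tau> q (f (pr q) q)"
    by (rule local_lift_section[of p])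
  have "\<exists>f. lift_section U f \<and> f x = y" if "x \<in> U" "y \<in> fibre x" for x y
  proof -
    have "f x \<in> fibre x" using U(2) that unfolding lift_section_def by blast
    then have "y = f x \<or> y = (\<lambda>q. - f x q)" by (rule fibre_two_elements) (rule that(2))
    then show ?thesis using U(2) lift_section_minus[OF U(2)] by blast
  qed
  then show ?thesis using U unfolding lift_section_def by blast
qed

text \<open>At each point two sections agree up to sign. They agree where the sum of their first components is
  nonzero and differ where the difference is.\<close>

lemma lift_section_separation:
  assumes f: "lift_section U f" and h: "lift_section V h" and x: "x \<in> U" "x \<in> V"
  shows "\<exists>W. open W \<and> x \<in> W \<and> W \<subseteq> U \<inter> V \<and> (\<forall>w\<in>W. f w = h w \<longleftrightarrow> f x = h x)"
proof -
  obtain q where q: "pr q = x" using frame_over by blast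
  obtain O' s where s: "x \<in> O'" "spinorial_frame A \<Phi> O' s" using section_through_frame[of q] q by metis
  have O': "open O'" "\<And>w. w \<in> O' \<Longrightarrow> pr (s w) = w" using s unfolding spinorial_frame_def by blast+
  define D where "D = U \<inter> V \<inter> O'"
  have D: "open D" "x \<in> D" using f h x s O' unfolding D_def lift_section_def by auto
  define a b where "a w = f w (s w) $ 1" and "b w = h w (s w) $ 1" for w
  have "continuous_on (U \<inter> O') (\<lambda>w. f w (s w))" "continuous_on (V \<inter> O') (\<lambda>w. h w (s w))"
    using f h s unfolding lift_section_def by blast+
  then have "continuous_on D (\<lambda>w. f w (s w))" "continuous_on D (\<lambda>w. h w (s w))"
    using continuous_on_subset unfolding D_def by (metis (no_types, lifting) Int_lower1 Int_lower2 inf.boundedI inf_mono order_refl inf.coboundedI1)+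
  then have ab: "continuous_on D a" "continuous_on D b"
    unfolding a_def b_def by (auto intro: continuous_on_component)
  have pm: "f w = h w \<longleftrightarrow> a w = b w" "a w = b w \<or> a w = - b w" "a w \<noteq> 0" if w: "w \<in> D" for w
  proof -
    have w': "f w \<in> fibre w" "h w \<in> fibre w" "pr (s w) = w"
      using w f h O' unfolding D_def lift_section_def by auto
    obtain \<sigma> \<tau> where l: "lifts \<sigma> \<tau> (s w) (f w (s w))" using fibreD(3)[OF w'(1,3)] by blast
    show an: "a w \<noteq> 0" using lifts_nonzero[OF l] by (simp add: a_def)
    have two: "f w = h w \<or> f w = (\<lambda>q. - h w q)" using fibre_two_elements[OF w'(2,1)] .
    then show "a w = b w \<or> a w = - b w" by (auto simp: a_def b_def)
    have "f w = (\<lambda>q. - h w q) \<Longrightarrow> a w = b w \<Longrightarrow> f w = h w"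
      using an by (simp add: a_def b_def)
    with two show "f w = h w \<longleftrightarrow> a w = b w" by (auto simp: a_def b_def)
  qed
  show ?thesis
  proof (cases "f x = h x")
    case True
    let ?W = "D \<inter> (\<lambda>w. a w + b w) -` (- {0})"
    have "open ?W" by (intro continuous_open_preimage D continuous_intros ab)
    moreover have "x \<in> ?W" using True pm[OF D(2)] D(2) by auto
    moreover have "f w = h w" if "w \<in> ?W" for w using that pm[of w] by auto
    ultimately show ?thesis using True unfolding D_def by blast
  next
    case False
    let ?W = "D \<inter> (\<lambda>w. a w - b w) -` (- {0})"
    have "open ?W" by (intro continuous_open_preimage D continuous_intros ab)
    moreover have "x \<in> ?W" using False pm[OF D(2)] D(2) by auto
    moreover have "f w \<noteq> h w" if "w \<in> ?W" for w using that pm[of w] by auto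
    ultimately show ?thesis using False unfolding D_def by blast
  qed
qed

lemma global_lift:
  assumes sc: "simply_connected (UNIV :: 'm set)"
  obtains \<psi> where "equivariant \<psi>"
    "\<forall>p. \<exists>W \<sigma> \<tau>. open W \<and> p \<in> W \<and> (\<forall>q. pr q \<in> W \<longrightarrow> lifts \<sigma> \<tau> q (\<psi> q)) \<and>
       (\<forall>V s. spinorial_frame A \<Phi> V s \<longrightarrow> continuous_on (W \<inter> V) (\<lambda>x. \<psi> (s x)))"
proof -
  interpret local_sections fibre lift_section
  proof
    show "f x \<in> fibre x" if "lift_section U f" "x \<in> U" for U f x using that unfolding lift_section_def by blast
  qed (rule lift_section_covering, rule lift_section_separation)
  \<comment> \<open>The continuation starts at an arbitrary point of the surface.\<close>
  obtain U0 f0 \<sigma>0 \<tau>0 where U0: "undefined \<in> U0" "lift_section U0 f0"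
    "\<forall>q. pr q \<in> U0 \<longrightarrow> lifts \<sigma>0 \<tau>0 q (f0 (pr q) q)" by (rule local_lift_section)
  have y0: "f0 undefined \<in> fibre undefined" using U0 unfolding lift_section_def by blast
  have "\<exists>\<phi>. (\<forall>x. \<phi> x \<in> fibre x) \<and> (\<forall>U f x. lift_section U f \<and> x \<in> U \<and> f x = \<phi> x \<longrightarrow>
      (\<exists>W. open W \<and> x \<in> W \<and> W \<subseteq> U \<and> (\<forall>w\<in>W. \<phi> w = f w)))"
    by (rule monodromy[OF sc locally_path_connected_surface y0])
  then obtain \<phi> where \<phi>: "\<forall>x. \<phi> x \<in> fibre x" and coh: "\<forall>U f x. lift_section U f \<and> x \<in> U \<and> f x = \<phi> x \<longrightarrow>
      (\<exists>W. open W \<and> x \<in> W \<and> W \<subseteq> U \<and> (\<forall>w\<in>W. \<phi> w = f w))"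
    by (elim exE conjE)
  define \<psi> where "\<psi> q = \<phi> (pr q) q" for q
  have "\<psi> (act q h) = rho (inverse h) *v \<psi> q" if "h \<noteq> 0" for q h
    unfolding \<psi>_def proj_act[OF that] by (rule fibreD(2)[OF spec[OF \<phi>] refl that])
  then have "equivariant \<psi>" unfolding equivariant_def Spin11_def by blast
  moreover have "\<exists>W \<sigma> \<tau>. open W \<and> p \<in> W \<and> (\<forall>q. pr q \<in> W \<longrightarrow> lifts \<sigma> \<tau> q (\<psi> q)) \<and>
       (\<forall>V s. spinorial_frame A \<Phi> V s \<longrightarrow> continuous_on (W \<inter> V) (\<lambda>x. \<psi> (s x)))" for p
  proof -
    obtain U f \<sigma> \<tau> where U: "p \<in> U" "lift_section U f" "\<forall>q. pr q \<in> U \<longrightarrow> lifts \<sigma> \<tau> q (f (pr q) q)"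
      by (rule local_lift_section)
    have "f p \<in> fibre p" using U(1,2) unfolding lift_section_def by blast
    \<comment> \<open>The reflection is the same for \<open>f\<close> and \<open>- f\<close>, hence for the continued section near \<open>p\<close>.\<close>
    then have two: "\<phi> p = f p \<or> \<phi> p = (\<lambda>q. - f p q)" by (rule fibre_two_elements) (rule spec[OF \<phi>])
    obtain k where k: "lift_section U k" "\<forall>q. pr q \<in> U \<longrightarrow> lifts \<sigma> \<tau> q (k (pr q) q)" "k p = \<phi> p"
    proof (cases "\<phi> p = f p")
      case True then show ?thesis using that[of f] U by simp
    next
      case False
      then show ?thesis using that[of "\<lambda>x q. - f x q"] two lift_section_minus[OF U(2)] U(3) lifts_minus by simp
    qed
    obtain W where W: "open W" "p \<in> W" "W \<subseteq> U" "\<forall>w\<in>W. \<phi> w = k w" using coh[rule_format, of U k p] k(1,3) U(1) by auto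
    have "lifts \<sigma> \<tau> q (\<psi> q)" if "pr q \<in> W" for q
      using k(2) W that by (auto simp: \<psi>_def)
    moreover have "continuous_on (W \<inter> V) (\<lambda>x. \<psi> (s x))" if s: "spinorial_frame A \<Phi> V s" for V s
    proof -
      have "continuous_on (W \<inter> V) (\<lambda>x. k x (s x))"
        by (rule continuous_on_subset[of "U \<inter> V"]) (use k(1) s W(3) in \<open>auto simp: lift_section_def\<close>)
      then show ?thesis
      proof (rule continuous_on_eq)
        fix x assume x: "x \<in> W \<inter> V"
        then have "pr (s x) = x" using s unfolding spinorial_frame_def by blast
        then show "k x (s x) = \<psi> (s x)" using W(4) x by (simp add: \<psi>_def)
      qed
    qed
    ultimately show ?thesis using W by blast
  qed
  ultimately show ?thesis using that by blast
qed

text \<open>The first component is a continuous square root of a smooth function without zeros, and the second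
  is the quotient of a smooth function by the first.\<close>

lemma smooth_lift:
  assumes W: "open W" and l: "\<And>q. pr q \<in> W \<Longrightarrow> lifts \<sigma> \<tau> q (\<psi> q)"
    and s: "spinorial_frame A \<Phi> V s" and cont: "continuous_on (W \<inter> V) (\<lambda>x. \<psi> (s x))"
  shows "smooth_map_on A (W \<inter> V) (\<lambda>x. \<psi> (s x))"
  unfolding smooth_map_on_def o_def
proof
  fix c assume c: "c \<in> A"
  have V: "open V" "\<And>x. x \<in> V \<Longrightarrow> pr (s x) = x" using s unfolding spinorial_frame_def by blast+
  let ?T = "crd c ` (W \<inter> V \<inter> cdom c)"
  have T: "open ?T" by (rule open_chart_image[OF c open_Int[OF W V(1)]])
  have ix: "icrd c x \<in> W" "icrd c x \<in> V" "icrd c x \<in> cdom c" if "x \<in> ?T" for x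
    using chart_image[OF c that] by (auto simp: around_def)
  define n where "n x = flip \<sigma> \<tau> (null_plus (s (icrd c x)))" for x
  define M where "M x = flip \<sigma> \<tau> (N (icrd c x))" for x
  have sub: "?T \<subseteq> crd c ` (V \<inter> cdom c)" by blast
  have "smooth_on ?T (\<lambda>x. null_plus (s (icrd c x)))" "smooth_on ?T (\<lambda>x. N (icrd c x))"
    using smooth_null[OF s] c smooth_on_mono[OF sub] unfolding smooth_map_on_def by (auto simp: o_def)
  then have sn: "smooth_on ?T n" "smooth_on ?T M"
    unfolding n_def M_def by (auto intro: smooth_on_bounded_linear[OF T bounded_linear_flip])
  have cplx: "smooth_on ?T (\<lambda>x. Complex (k x $ 1) (k x $ 3))" if k: "smooth_on ?T k" for k :: "real^2 \<Rightarrow> real^3"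
  proof -
    have "smooth_on ?T (\<lambda>x. (k x $ 1) *\<^sub>R (1::complex) + (k x $ 3) *\<^sub>R \<i>)"
      by (intro smooth_on_add smooth_on_scaleR smooth_on_const smooth_on_vec_nth T k)
    then show ?thesis
      by (rule smooth_on_cong[OF T, rotated]) (simp add: complex_eq_iff)
  qed
  have eq: "(\<psi> (s (icrd c x)) $ 1)\<^sup>2 = Complex (n x $ 1) (n x $ 3)"
      "\<psi> (s (icrd c x)) $ 1 * \<psi> (s (icrd c x)) $ 2 = Complex (M x $ 1) (M x $ 3)"
      "\<psi> (s (icrd c x)) $ 1 \<noteq> 0" if x: "x \<in> ?T" for x
  proof -
    have L: "lifts \<sigma> \<tau> (s (icrd c x)) (\<psi> (s (icrd c x)))" using l[of "s (icrd c x)"] ix[OF x] V(2) by simp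
    show "\<psi> (s (icrd c x)) $ 1 \<noteq> 0" by (rule lifts_nonzero[OF L])
    have "spins (\<psi> (s (icrd c x)) $ 1) (\<psi> (s (icrd c x)) $ 2) (n x) (flip \<sigma> \<tau> (null_minus (s (icrd c x)))) (M x)"
      using L ix[OF x] V(2) by (simp add: lifts_def n_def M_def)
    from spins_square[OF this] show "(\<psi> (s (icrd c x)) $ 1)\<^sup>2 = Complex (n x $ 1) (n x $ 3)"
      "\<psi> (s (icrd c x)) $ 1 * \<psi> (s (icrd c x)) $ 2 = Complex (M x $ 1) (M x $ 3)"
      by blast+
  qed
  have "continuous_on ?T (\<lambda>x. \<psi> (s (icrd c x)))"
    by (rule continuous_on_compose2[OF cont continuous_on_subset[OF homeomorphism_cont2[OF chart_homeomorphism[OF c]]]])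
      (use ix in auto)
  then have "continuous_on ?T (\<lambda>x. \<psi> (s (icrd c x)) $ 1)" by (rule continuous_on_component)
  then have s1: "smooth_on ?T (\<lambda>x. \<psi> (s (icrd c x)) $ 1)"
    by (rule smooth_on_square_root[OF T _ eq(1) eq(3) cplx[OF sn(1)]])
  have "smooth_on ?T (\<lambda>x. Complex (M x $ 1) (M x $ 3) * inverse (\<psi> (s (icrd c x)) $ 1))"
    by (intro smooth_on_mult[OF T] cplx[OF sn(2)] smooth_on_inverse[OF T eq(3) s1])
  then have s2: "smooth_on ?T (\<lambda>x. \<psi> (s (icrd c x)) $ 2)"
  proof (rule smooth_on_cong[OF T, rotated])
    fix x assume "x \<in> ?T"
    then show "Complex (M x $ 1) (M x $ 3) * inverse (\<psi> (s (icrd c x)) $ 1) = \<psi> (s (icrd c x)) $ 2"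
      using eq(3) by (simp add: eq(2)[symmetric])
  qed
  have "smooth_on ?T (\<lambda>x. (axis 1 (\<psi> (s (icrd c x)) $ 1) :: complex^2) + axis 2 (\<psi> (s (icrd c x)) $ 2))"
    by (rule smooth_on_add[OF T smooth_on_bounded_linear[OF T bounded_linear_axis s1] smooth_on_bounded_linear[OF T bounded_linear_axis s2]])
  then show "smooth_on ?T (\<lambda>x. \<psi> (s (icrd c x)))"
    by (rule smooth_on_cong[OF T, rotated]) (simp add: vec_eq_iff forall_2 axis_def)
qed

lemma xi_lift:
  assumes e: "equivariant \<psi>" and l: "lifts \<sigma> \<tau> q (\<psi> q)" and c: "around c (pr q)"
  shows "xi \<psi> c (pr q) u = flip \<sigma> \<tau> (dF c (pr q) u)" "normal \<psi> (pr q) = flip \<sigma> \<tau> (N (pr q))"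
proof -
  have sp: "spin_prod (\<psi> q $ 1) (\<psi> q $ 1) = flip \<sigma> \<tau> (null_plus q)"
    "spin_prod (\<psi> q $ 2) (\<psi> q $ 2) = flip \<sigma> \<tau> (null_minus q)"
    "spin_prod (\<psi> q $ 1) (\<psi> q $ 2) = flip \<sigma> \<tau> (N (pr q))"
    using l by (simp_all add: lifts_def spins_def)
  show "normal \<psi> (pr q) = flip \<sigma> \<tau> (N (pr q))" unfolding normal_eq[OF e] sp ..
  let ?ep = "frame2 \<Phi> q c + frame3 \<Phi> q c" and ?em = "frame2 \<Phi> q c - frame3 \<Phi> q c"
  let ?a = "- bil (gram A g c (pr q)) u ?em / 2" and ?b = "- bil (gram A g c (pr q)) u ?ep / 2"
  have "dF c (pr q) u = dF c (pr q) (?a *\<^sub>R ?ep + ?b *\<^sub>R ?em)"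
    using lorentz_frame_expansion[OF lorentz_frame_chart[OF c], of u] by (rule arg_cong)
  also have "\<dots> = ?a *\<^sub>R null_plus q + ?b *\<^sub>R null_minus q"
    unfolding null_in_chart[OF c] linear_add[OF linear_dF[OF c], of "?a *\<^sub>R ?ep"] linear_scale[OF linear_dF[OF c]] ..
  finally show "xi \<psi> c (pr q) u = flip \<sigma> \<tau> (dF c (pr q) u)"
    unfolding xi_covec[OF e] covec_def sp
    by (simp add: linear_simps[OF bounded_linear_flip] scaleR_add_right)
qed

text \<open>Near the base point \<open>\<xi>\<close> is the reflection of \<open>dF\<close>. It is closed by the symmetry of second
  derivatives, and its trace is given by the mean curvature.\<close>

lemma dirac_of_lift:
  assumes e: "spinor_field A \<Phi> act \<psi>" and W: "open W" "pr q \<in> W" and l: "\<And>q. pr q \<in> W \<Longrightarrow> lifts \<sigma> \<tau> q (\<psi> q)"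
  shows "dirac A g \<Phi> \<psi> q = H (pr q) *\<^sub>R \<psi> q"
proof -
  have eq: "equivariant \<psi>" using e unfolding spinor_field_def equivariant_def by blast
  let ?p = "pr q"
  define c where "c = chart_at A ?p"
  have c: "around c ?p" unfolding c_def by (rule around_chart_at)
  then have cA: "c \<in> A" by (simp add: around_def)
  have ar: "area (\<psi> q $ 1) (\<psi> q $ 2) = 1" and st: "\<sigma>\<^sup>2 = 1" "\<tau>\<^sup>2 = 1"
    using l[OF W(2)] by (simp_all add: lifts_def spins_def)
  let ?T = "crd c ` (W \<inter> cdom c)"
  have T: "open ?T" "crd c ?p \<in> ?T" using open_chart_image[OF cA W(1)] crd_in[OF c W(2)] .
  have sm: "smooth_on (crd c ` cdom c) (F \<circ> icrd c)" by (rule immersion_in_chart(1)[OF immersion c])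
  define K where "K v u = frechet_derivative (\<lambda>x. frechet_derivative (F \<circ> icrd c) (at x) u) (at (crd c ?p)) v" for v u
  have x0: "crd c ?p \<in> crd c ` cdom c" using c by (simp add: around_def)
  have xiK: "frechet_derivative (\<lambda>x. xi \<psi> c (icrd c x) u) (at (crd c ?p)) v = flip \<sigma> \<tau> (K v u)" for u v
  proof -
    have "((\<lambda>x. flip \<sigma> \<tau> (frechet_derivative (F \<circ> icrd c) (at x) u)) has_derivative (\<lambda>v. flip \<sigma> \<tau> (K v u))) (at (crd c ?p))"
      unfolding K_def
      by (rule bounded_linear.has_derivative[OF bounded_linear_flip
            smooth_on_has_derivative[OF smooth_on_frechet_derivative[OF sm] x0]])
    then have "((\<lambda>x. xi \<psi> c (icrd c x) u) has_derivative (\<lambda>v. flip \<sigma> \<tau> (K v u))) (at (crd c ?p))"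
    proof (rule has_derivative_cong_open[OF _ T])
      fix y assume "y \<in> ?T"
      then have y: "around c (icrd c y)" "icrd c y \<in> W" "crd c (icrd c y) = y" using chart_image[OF cA] by auto
      obtain r where r: "pr r = icrd c y" using frame_over by blast
      have "xi \<psi> c (icrd c y) u = flip \<sigma> \<tau> (dF c (icrd c y) u)"
        using xi_lift(1)[OF eq l, of r c u] y r by simp
      then show "flip \<sigma> \<tau> (frechet_derivative (F \<circ> icrd c) (at y) u) = xi \<psi> c (icrd c y) u"
        using y(3) by (simp add: dF_def)
    qed
    from frechet_derivative_eqI[OF this] show ?thesis by simp
  qed
  have Ksym: "K u v = K v u" for u v
    unfolding K_def by (rule frechet_derivative_commute[OF chart_open_range[OF cA] x0 sm])
  let ?ep = "frame2 \<Phi> q c + frame3 \<Phi> q c" and ?em = "frame2 \<Phi> q c - frame3 \<Phi> q c"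
  have "mean_curvature_vector A g F ?p
      = (- (mink (K ?ep ?em) (N ?p) + mink (K ?em ?ep) (N ?p)) / 4) *\<^sub>R N ?p"
    using mean_curvature_null_frame[OF immersion unit_normal, of ?p] lorentz_frame_chart[OF c]
    unfolding c_def[symmetric] K_def by blast
  then have "(- (mink (K ?ep ?em) (N ?p) + mink (K ?em ?ep) (N ?p)) / 4) *\<^sub>R N ?p = H ?p *\<^sub>R N ?p"
    unfolding mean_curvature by (rule sym)
  moreover have "N ?p \<noteq> 0" using normal_in_chart(1)[OF immersion unit_normal c] by (auto simp: mink_simps)
  ultimately have "mink (K ?ep ?em) (N ?p) + mink (K ?em ?ep) (N ?p) = - 4 * H ?p" by simp
  then show ?thesis
    unfolding dirac_iff_xi(1)[OF e ar c] xiK xi_lift(2)[OF eq l[OF W(2)] c] mink_flip[OF st]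
    using Ksym by simp
qed

lemma spinor_of_immersion:
  assumes sc: "simply_connected (UNIV :: 'm set)"
  shows "\<exists>\<psi>. spinor_field A \<Phi> act \<psi> \<and> (\<forall>q. dirac A g \<Phi> \<psi> q = H (proj \<Phi> q) *\<^sub>R \<psi> q) \<and>
    (\<forall>q. spinor_inner (\<psi> q) (\<psi> q) = 1)"
proof -
  obtain \<psi> where e: "equivariant \<psi>"
    and loc: "\<forall>p. \<exists>W \<sigma> \<tau>. open W \<and> p \<in> W \<and> (\<forall>q. pr q \<in> W \<longrightarrow> lifts \<sigma> \<tau> q (\<psi> q)) \<and>
       (\<forall>V s. spinorial_frame A \<Phi> V s \<longrightarrow> continuous_on (W \<inter> V) (\<lambda>x. \<psi> (s x)))"
    by (rule global_lift[OF sc])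
  have "smooth_map_on A V (\<lambda>x. \<psi> (s x))" if s: "spinorial_frame A \<Phi> V s" for V s
  proof (rule smooth_map_on_local)
    fix p assume p: "p \<in> V"
    obtain W \<sigma> \<tau> where W: "open W" "p \<in> W" and l: "\<forall>q. pr q \<in> W \<longrightarrow> lifts \<sigma> \<tau> q (\<psi> q)"
      and cont: "\<forall>V s. spinorial_frame A \<Phi> V s \<longrightarrow> continuous_on (W \<inter> V) (\<lambda>x. \<psi> (s x))"
      using spec[OF loc, of p] by (elim exE conjE)
    have "smooth_map_on A (W \<inter> V) (\<lambda>x. \<psi> (s x))"
      by (rule smooth_lift[OF W(1) _ s]) (use l cont s in auto)
    moreover have "open (W \<inter> V)" using W s unfolding spinorial_frame_def by auto
    ultimately show "\<exists>W. open W \<and> p \<in> W \<and> W \<subseteq> V \<and> smooth_map_on A W (\<lambda>x. \<psi> (s x))"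
      using W p by (intro exI[of _ "W \<inter> V"]) simp
  qed
  then have sf: "spinor_field A \<Phi> act \<psi>" using e unfolding spinor_field_def equivariant_def by blast
  have "dirac A g \<Phi> \<psi> q = H (pr q) *\<^sub>R \<psi> q \<and> spinor_inner (\<psi> q) (\<psi> q) = 1" for q
  proof -
    obtain W \<sigma> \<tau> where W: "open W" "pr q \<in> W" and l: "\<forall>q. pr q \<in> W \<longrightarrow> lifts \<sigma> \<tau> q (\<psi> q)"
      using spec[OF loc, of "pr q"] by (elim exE conjE)
    have "dirac A g \<Phi> \<psi> q = H (pr q) *\<^sub>R \<psi> q" by (rule dirac_of_lift[OF sf W]) (use l in blast)
    moreover have "area (\<psi> q $ 1) (\<psi> q $ 2) = 1" using l W by (simp add: lifts_def spins_def)
    then have "spinor_inner (\<psi> q) (\<psi> q) = 1" by (simp add: spinor_inner_def Let_def area_altdef field_simps)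
    ultimately show ?thesis ..
  qed
  then show ?thesis using sf by blast
qed

end

section \<open>The equivalence\<close>

theorem mainTheorem3:
  fixes A :: "'m::{t2_space, second_countable_topology} chart set"
    and g :: "'m metric"
    and T S :: "'m \<Rightarrow> 'm tangent set"
    and \<Phi> :: "'q::topological_space \<Rightarrow> 'm frame"
    and act :: "'q \<Rightarrow> real \<Rightarrow> 'q"
    and H :: "'m \<Rightarrow> real"
  assumes "smooth_atlas A"
    and "simply_connected (UNIV :: 'm set)"
    and "lorentzian_metric A g"
    and "time_orientation A g T"
    and "space_orientation A g S"
    and "spin_structure A g T S \<Phi> act"
    and "smooth_map_on A UNIV H"
  shows "(\<exists>\<psi>. spinor_field A \<Phi> act \<psi> \<and>
            (\<forall>q. dirac A g \<Phi> \<psi> q = H (proj \<Phi> q) *\<^sub>R \<psi> q) \<and>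
            (\<forall>q. spinor_inner (\<psi> q) (\<psi> q) = 1))
         \<longleftrightarrow>
         (\<exists>F N. isometric_immersion A g F \<and> unit_normal_field A F N \<and>
            (\<forall>p. mean_curvature_vector A g F p = H p *\<^sub>R N p))"
proof
  have spin: "spin_surface A g T S \<Phi> act"
    by unfold_locales (rule assms(1) assms(3) assms(6))+
  {
    assume "\<exists>\<psi>. spinor_field A \<Phi> act \<psi> \<and> (\<forall>q. dirac A g \<Phi> \<psi> q = H (proj \<Phi> q) *\<^sub>R \<psi> q) \<and>
            (\<forall>q. spinor_inner (\<psi> q) (\<psi> q) = 1)"
    then obtain \<psi> where "spinor_field A \<Phi> act \<psi>" "\<And>q. dirac A g \<Phi> \<psi> q = H (proj \<Phi> q) *\<^sub>R \<psi> q"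
      "\<And>q. spinor_inner (\<psi> q) (\<psi> q) = 1" by blast
    then have "dirac_spinor A g T S \<Phi> act \<psi> H"
      by (intro dirac_spinor.intro[OF spin] dirac_spinor_axioms.intro)
    then show "\<exists>F N. isometric_immersion A g F \<and> unit_normal_field A F N \<and>
            (\<forall>p. mean_curvature_vector A g F p = H p *\<^sub>R N p)"
      by (rule dirac_spinor.immersion_of_spinor[OF _ assms(2)])
  }
  {
    assume "\<exists>F N. isometric_immersion A g F \<and> unit_normal_field A F N \<and>
            (\<forall>p. mean_curvature_vector A g F p = H p *\<^sub>R N p)"
    then obtain F N where "isometric_immersion A g F" "unit_normal_field A F N"
      "\<And>p. mean_curvature_vector A g F p = H p *\<^sub>R N p" by blast
    then have "immersed_surface A g T S \<Phi> act F N H"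
      by (intro immersed_surface.intro[OF spin] immersed_surface_axioms.intro)
    then show "\<exists>\<psi>. spinor_field A \<Phi> act \<psi> \<and> (\<forall>q. dirac A g \<Phi> \<psi> q = H (proj \<Phi> q) *\<^sub>R \<psi> q) \<and>
            (\<forall>q. spinor_inner (\<psi> q) (\<psi> q) = 1)"
      by (rule immersed_surface.spinor_of_immersion[OF _ assms(2)])
  }
qed

end
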